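(* Let $\theta:\mathbb{R}^n\to[-\infty,\infty]$ be a symmetric function that is locally Lipschitz continuous relative to its domain, and let $X\in\mathbf{S}^n$ with $(\theta\circ\lambda)(X)$ finite. Then: (a) If $H\in T_{\mathrm{dom}(\theta\circ\lambda)}(X)$ and $\theta$ is parabolically epi-differentiable at $\lambda(X)$ for $\lambda'(X;H)$, then $\theta\circ\lambda$ is parabolically epi-differentiable at $X$ for $H$, and for all $W\in\mathbf{S}^n$ $$\mathrm{d}^2(\theta\circ\lambda)(X)(H\,|\,W)=\mathrm{d}^2\theta(\lambda(X))\big(\lambda'(X;H)\,|\,\lambda''(X;H,W)\big),$$ $$\mathrm{dom}\,\mathrm{d}^2(\theta\circ\lambda)(X)(H\,|\,\cdot)=T^2_{\mathrm{dom}(\theta\circ\lambda)}(X,H).$$ If moreover $\theta$ is lower semicontinuous and convex, then $W\mapsto\mathrm{d}^2(\theta\circ\lambda)(X)(H\,|\,W)$ is convex. (b) If $\theta\circ\lambda$ is parabolically epi-differentiable at $X$, then $\theta$ is parabolically epi-differentiable at $\lambda(X)$.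
   Context: $\mathbf{S}^n$: real symmetric matrices; $\lambda(X)$: eigenvalues in nonincreasing order; $\theta$ symmetric: $\theta(Px)=\theta(x)$ for permutation matrices $P$. Locally Lipschitz relative to its domain: around every $\bar x\in\mathrm{dom}\,\theta$ there are $\ell,V$ with $|\theta(x)-\theta(y)|\le\ell\|x-y\|$ on $V\cap\mathrm{dom}\,\theta$. Tangent cone $T_C(\bar x)=\{w:\exists t_k\downarrow0,w_k\to w,\bar x+t_kw_k\in C\}$; $T^2_C(\bar x,w)=\{u:\exists t_k\downarrow0,u_k\to u,\bar x+t_kw+\frac12t_k^2u_k\in C\}$. Subderivative $\mathrm{d}f(\bar x)(\bar w)=\liminf_{t\downarrow0,w\to\bar w}\frac{f(\bar x+tw)-f(\bar x)}{t}$. For $w$ with $\mathrm{d}f(\bar x)(w)$ finite, the parabolic subderivative is $\mathrm{d}^2f(\bar x)(w\,|\,z)=\liminf_{t\downarrow0,z'\to z}\frac{f(\bar x+tw+\frac12t^2z')-f(\bar x)-t\,\mathrm{d}f(\bar x)(w)}{\frac12t^2}$. $f$ is parabolically epi-differentiable at $\bar x$ for $w$ if $\{z:\mathrm{d}^2f(\bar x)(w|z)<\infty\}\ne\emptyset$ and for every $z$ and every $t_k\downarrow0$ there is $z_k\to z$ with $\mathrm{d}^2f(\bar x)(w|z)=\lim_k\frac{f(\bar x+t_kw+\frac12t_k^2z_k)-f(\bar x)-t_k\mathrm{d}f(\bar x)(w)}{\frac12t_k^2}$; $f$ is parabolically epi-differentiable at $\bar x$ if this holds for every $w$ with $\mathrm{d}f(\bar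 x)(w)$ finite. $\lambda'(X;H)=\lim_{t\downarrow0}(\lambda(X+tH)-\lambda(X))/t$, $\lambda''(X;H,W)=\lim_{t\downarrow0}\frac{\lambda(X+tH+\frac12t^2W)-\lambda(X)-t\lambda'(X;H)}{\frac12t^2}$ (both exist). *)

theory Defs
  imports "HOL-Analysis.Analysis"
begin

definition edom :: "('a \<Rightarrow> ereal) \<Rightarrow> 'a set" where
  "edom f = {x. f x < \<infinity>}"

definition loc_lipschitz_rel_dom :: "('a::real_normed_vector \<Rightarrow> ereal) \<Rightarrow> bool" where
  "loc_lipschitz_rel_dom f \<longleftrightarrow>
     (\<forall>xb \<in> edom f. \<exists>l V. open V \<and> xb \<in> V \<and>
        (\<forall>x \<in> V \<inter> edom f. \<forall>y \<in> V \<inter> edom f. \<bar>f x - f y\<bar> \<le> ereal (l * norm (x - y))))"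

definition tangent_cone :: "'a::real_normed_vector set \<Rightarrow> 'a \<Rightarrow> 'a set" where
  "tangent_cone C x = {w. \<exists>t ws. (\<forall>k. 0 < t k) \<and> t \<longlonglongrightarrow> 0 \<and> ws \<longlonglongrightarrow> w \<and>
                               (\<forall>k. x + t k *\<^sub>R ws k \<in> C)}"

definition second_tangent :: "'a::real_normed_vector set \<Rightarrow> 'a \<Rightarrow> 'a \<Rightarrow> 'a set" where
  "second_tangent C x w = {u. \<exists>t us. (\<forall>k. 0 < t k) \<and> t \<longlonglongrightarrow> 0 \<and> us \<longlonglongrightarrow> u \<and>
       (\<forall>k. x + t k *\<^sub>R w + ((t k)\<^sup>2 / 2) *\<^sub>R us k \<in> C)}"

definition subderiv :: "('a::real_normed_vector \<Rightarrow> ereal) \<Rightarrow> 'a \<Rightarrow> 'a \<Rightarrow> ereal" where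
  "subderiv f x wb = Liminf (at_right (0::real) \<times>\<^sub>F nhds wb)
      (\<lambda>(t, w). (f (x + t *\<^sub>R w) - f x) / ereal t)"

definition par_quot :: "('a::real_normed_vector \<Rightarrow> ereal) \<Rightarrow> 'a \<Rightarrow> 'a \<Rightarrow> real \<Rightarrow> 'a \<Rightarrow> ereal" where
  "par_quot f x w t z =
     (f (x + t *\<^sub>R w + (t\<^sup>2 / 2) *\<^sub>R z) - f x - ereal t * subderiv f x w) / ereal (t\<^sup>2 / 2)"

text \<open>Parabolic subderivative (meaningful when the subderivative at w is finite).\<close>
definition par_subderiv :: "('a::real_normed_vector \<Rightarrow> ereal) \<Rightarrow> 'a \<Rightarrow> 'a \<Rightarrow> 'a \<Rightarrow> ereal" where
  "par_subderiv f x w z = Liminf (at_right (0::real) \<times>\<^sub>F nhds z) (\<lambda>(t, z'). par_quot f x w t z')"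

definition par_epi_diff_for :: "('a::real_normed_vector \<Rightarrow> ereal) \<Rightarrow> 'a \<Rightarrow> 'a \<Rightarrow> bool" where
  "par_epi_diff_for f x w \<longleftrightarrow>
     \<bar>subderiv f x w\<bar> \<noteq> \<infinity> \<and>
     {z. par_subderiv f x w z < \<infinity>} \<noteq> {} \<and>
     (\<forall>z t. (\<forall>k. 0 < t k) \<and> t \<longlonglongrightarrow> 0 \<longrightarrow>
        (\<exists>zs. zs \<longlonglongrightarrow> z \<and> (\<lambda>k. par_quot f x w (t k) (zs k)) \<longlonglongrightarrow> par_subderiv f x w z))"

definition par_epi_diff :: "('a::real_normed_vector \<Rightarrow> ereal) \<Rightarrow> 'a \<Rightarrow> bool" where
  "par_epi_diff f x \<longleftrightarrow> (\<forall>w. \<bar>subderiv f x w\<bar> \<noteq> \<infinity> \<longrightarrow> par_epi_diff_for f x w)"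

definition ereal_lsc :: "('a::topological_space \<Rightarrow> ereal) \<Rightarrow> bool" where
  "ereal_lsc f \<longleftrightarrow> (\<forall>x. f x \<le> Liminf (at x) f)"

definition ereal_convex :: "('a::real_vector \<Rightarrow> ereal) \<Rightarrow> bool" where
  "ereal_convex f \<longleftrightarrow> convex {(x, a::real). f x \<le> ereal a}"

definition symmetric_fun :: "(real^'n \<Rightarrow> ereal) \<Rightarrow> bool" where
  "symmetric_fun \<theta> \<longleftrightarrow> (\<forall>\<sigma> x. \<sigma> permutes (UNIV::'n set) \<longrightarrow> \<theta> (\<chi> i. x $ \<sigma> i) = \<theta> x)"

definition symmetric_mat :: "real^('n::{finite,linorder})^('n::{finite,linorder}) \<Rightarrow> bool" where
  "symmetric_mat X \<longleftrightarrow> transpose X = X"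

definition eigvals :: "real^('n::{finite,linorder})^('n::{finite,linorder}) \<Rightarrow> real^('n::{finite,linorder})" where
  "eigvals X = (THE v. (\<forall>i j. i \<le> j \<longrightarrow> v $ j \<le> v $ i) \<and>
                    (\<forall>s::real. det (s *\<^sub>R mat 1 - X) = (\<Prod>i\<in>UNIV. s - v $ i)))"

definition spectral_fun :: "(real^('n::{finite,linorder}) \<Rightarrow> ereal) \<Rightarrow> real^('n::{finite,linorder})^('n::{finite,linorder}) \<Rightarrow> ereal" where
  "spectral_fun \<theta> X = (if symmetric_mat X then \<theta> (eigvals X) else \<infinity>)"

definition eig_dir1 :: "real^('n::{finite,linorder})^('n::{finite,linorder}) \<Rightarrow> real^('n::{finite,linorder})^('n::{finite,linorder}) \<Rightarrow> real^('n::{finite,linorder})" where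
  "eig_dir1 X H = Lim (at_right (0::real)) (\<lambda>t. (1 / t) *\<^sub>R (eigvals (X + t *\<^sub>R H) - eigvals X))"

definition eig_dir2 :: "real^('n::{finite,linorder})^('n::{finite,linorder}) \<Rightarrow> real^('n::{finite,linorder})^('n::{finite,linorder}) \<Rightarrow> real^('n::{finite,linorder})^('n::{finite,linorder}) \<Rightarrow> real^('n::{finite,linorder})" where
  "eig_dir2 X H W = Lim (at_right (0::real))
     (\<lambda>t. (1 / (t\<^sup>2 / 2)) *\<^sub>R
        (eigvals (X + t *\<^sub>R H + (t\<^sup>2 / 2) *\<^sub>R W) - eigvals X - t *\<^sub>R eig_dir1 X H))"

end

theory Submission
  imports Defs "HOL-Combinatorics.Permutations"
begin

text \<open>Subderivatives and parabolic subderivatives are lower limits of difference quotients, so they are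
  compared by transporting nearby points. A symmetric perturbation \<open>W'\<close> of \<open>W\<close> moves the eigenvalues along
  \<open>\<lambda>(X) + t \<lambda>'(X;H) + (t\<^sup>2/2) z'\<close> with \<open>z'\<close> close to \<open>\<lambda>''(X;H,W)\<close>, because eigenvalues are Lipschitz.
  Conversely, any such \<open>z'\<close> is realised by some \<open>W'\<close> close to \<open>W\<close>: replace the eigenvalues of
  \<open>X + t H + (t\<^sup>2/2) W\<close> and keep its eigenbasis; since \<open>\<theta>\<close> is symmetric, the order of the new eigenvalues
  is irrelevant. The directional derivatives of the eigenvalues exist because bounded quotients of them
  converge (their level sets are zero sets of polynomials), and boundedness of the second order quotient
  follows from Ky Fan's maximum principle. For the converse direction, diagonal \<open>H\<close> and \<open>W\<close> in an
  eigenbasis of \<open>X\<close> realise every \<open>w\<close> and \<open>z\<close> up to a permutation fixing \<open>\<lambda>(X)\<close>.\<close>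

section \<open>Symmetric matrices and orthonormal frames\<close>

text \<open>The composite is infinite off the symmetric matrices, while limits are taken over all
  matrices, so nonsymmetric perturbations have to be absorbed as infinite quotients.

  The delicate estimate is the second order bound for eigenvalues. A single eigenvalue is not convex
  in the matrix, but the sums over the largest ones are, which bounds their second order error from
  below. From above, the eigenvectors at time \<open>t\<close> serve as trial vectors at time
  \<open>t / 2\<close>; they are nearly eigenvectors of \<open>X\<close>, so the loss is of order
  \<open>t\<^sup>2\<close>, and under repeated halving the losses of the first order quotients form
  a geometric series.

  A second obstacle: a vector at which the parabolic subderivative of \<open>\<theta>\<close> is
  finite need not be a second derivative of the eigenvalues for any \<open>W\<close>. A matrix with
  finite parabolic subderivative is therefore found by compactness.\<close>

type_synonym 'n sqmat = "((real, 'n) vec, 'n) vec"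

definition orthonormal_frame :: "('n \<Rightarrow> real^'n) \<Rightarrow> bool" where
  "orthonormal_frame u \<longleftrightarrow> (\<forall>i j. u i \<bullet> u j = (if i = j then 1 else 0))"

text \<open>This is \<open>U diag(v) U^T\<close> with the vectors \<open>u i\<close> as the columns
  of \<open>U\<close>. The order of \<open>v\<close> is left free, so that eigenvalues can be moved
  inside a fixed frame without sorting.\<close>

definition spec_mat :: "('n \<Rightarrow> real^'n) \<Rightarrow> real^'n \<Rightarrow> real^'n^'n" where
  "spec_mat u v = (\<chi> a b. \<Sum>i\<in>UNIV. v $ i * u i $ a * u i $ b)"

lemma symmetric_mat_inner:
  assumes "symmetric_mat A"
  shows "(A *v x) \<bullet> y = x \<bullet> (A *v y)"
  by (metis assms dot_lmul_matrix symmetric_mat_def transpose_matrix_vector)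

lemma symmetric_mat_add: "symmetric_mat A \<Longrightarrow> symmetric_mat B \<Longrightarrow> symmetric_mat (A + B)"
  by (simp add: symmetric_mat_def transpose_def vec_eq_iff)

lemma symmetric_mat_diff: "symmetric_mat A \<Longrightarrow> symmetric_mat B \<Longrightarrow> symmetric_mat (A - B)"
  by (simp add: symmetric_mat_def transpose_def vec_eq_iff)

lemma symmetric_mat_scaleR: "symmetric_mat A \<Longrightarrow> symmetric_mat (c *\<^sub>R A)"
  by (simp add: symmetric_mat_def transpose_def vec_eq_iff)

lemma symmetric_mat_scaleR_cancel: "c \<noteq> 0 \<Longrightarrow> symmetric_mat (c *\<^sub>R A) \<Longrightarrow> symmetric_mat A"
  by (simp add: symmetric_mat_def transpose_def vec_eq_iff)

lemma symmetric_mat_add_cancel: "symmetric_mat A \<Longrightarrow> symmetric_mat (A + B) \<Longrightarrow> symmetric_mat B"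
  by (simp add: symmetric_mat_def transpose_def vec_eq_iff)

lemmas symmetric_mat_intros = symmetric_mat_add symmetric_mat_diff symmetric_mat_scaleR

lemma symmetric_mat_spec_mat: "symmetric_mat (spec_mat u v)"
  by (simp add: symmetric_mat_def transpose_def vec_eq_iff spec_mat_def mult_ac)

lemma closed_symmetric_mat: "closed {A :: 'n::{finite,linorder} sqmat. symmetric_mat A}"
proof -
  have "{A :: 'n sqmat. symmetric_mat A} = (\<Inter>a b. {A. A $ b $ a = A $ a $ b})"
    by (auto simp: symmetric_mat_def transpose_def vec_eq_iff)
  then show ?thesis
    by (simp only:) (intro closed_INT ballI closed_Collect_eq continuous_intros)
qed

text \<open>A maximiser \<open>u\<close> of the quadratic form on the unit sphere of the invariant
  subspace is an eigenvector: otherwise moving along the residual \<open>y\<close> would violate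
  maximality.\<close>

lemma symmetric_mat_eigenvector:
  fixes A :: "'n::{finite,linorder} sqmat"
  assumes A: "symmetric_mat A" and S: "subspace S" "S \<noteq> {0}" and inv: "\<And>x. x \<in> S \<Longrightarrow> A *v x \<in> S"
  obtains u c where "u \<in> S" "norm u = 1" "A *v u = c *\<^sub>R u"
proof -
  let ?q = "\<lambda>x. x \<bullet> (A *v x)"
  let ?K = "S \<inter> sphere 0 1"
  obtain x0 where x0: "x0 \<in> S" "x0 \<noteq> 0"
    using S subspace_0 by blast
  then have "(1 / norm x0) *\<^sub>R x0 \<in> ?K"
    using S(1) by (simp add: subspace_scale)
  moreover have "compact ?K"
    by (metis closed_subspace[OF S(1)] closed_Int_compact compact_sphere)
  moreover have "continuous_on ?K ?q"
    by (intro continuous_intros matrix_vector_mult_linear_continuous_on)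
  ultimately obtain u where u: "u \<in> ?K" and max: "\<And>x. x \<in> ?K \<Longrightarrow> ?q x \<le> ?q u"
    using continuous_attains_sup[of ?K ?q] by blast
  define m where "m = ?q u"
  define y where "y = m *\<^sub>R u - A *v u"
  have nonneg: "?q x \<le> m * (x \<bullet> x)" if "x \<in> S" for x
  proof (cases "x = 0")
    case False
    have "(1 / norm x) *\<^sub>R x \<in> ?K"
      using S(1) False that by (simp add: subspace_scale)
    from max[OF this] have "?q x / (norm x)^2 \<le> m"
      by (simp add: m_def matrix_vector_mult_scaleR power2_eq_square)
    then show ?thesis
      using False by (simp add: divide_le_eq dot_square_norm)
  qed simp
  have yS: "y \<in> S"
    unfolding y_def using S(1) u inv by (simp add: subspace_diff subspace_scale)
  \<comment> \<open>Maximality tested at \<open>u + s *\<^sub>R y\<close>; the constant terms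
    cancel, and the linear coefficient is twice the squared length of the residual.\<close>
  have *: "0 \<le> 2 * s * (y \<bullet> y) + s^2 * (m * (y \<bullet> y) - ?q y)" for s :: real
  proof -
    have "u + s *\<^sub>R y \<in> S"
      using S(1) u yS by (simp add: subspace_add subspace_scale)
    from nonneg[OF this] have "?q (u + s *\<^sub>R y) \<le> m * ((u + s *\<^sub>R y) \<bullet> (u + s *\<^sub>R y))" .
    moreover have "?q (u + s *\<^sub>R y) = m + 2 * s * ((A *v u) \<bullet> y) + s^2 * ?q y"
      using symmetric_mat_inner[OF A, of u y] inner_commute[of y "A *v u"]
      by (simp add: m_def matrix_vector_right_distrib matrix_vector_mult_scaleR inner_add_left
          inner_add_right power2_eq_square) (simp add: algebra_simps)
    moreover have "(u + s *\<^sub>R y) \<bullet> (u + s *\<^sub>R y) = 1 + 2 * s * (u \<bullet> y) + s^2 * (y \<bullet> y)"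
      using u inner_commute[of y u]
      by (simp add: inner_add_left inner_add_right power2_eq_square norm_eq_1) (simp add: algebra_simps)
    moreover have "y \<bullet> y = m * (u \<bullet> y) - (A *v u) \<bullet> y"
      by (subst (1) y_def) (simp add: inner_diff_left)
    then have "2 * s * (y \<bullet> y) = m * (2 * s * (u \<bullet> y)) - 2 * s * ((A *v u) \<bullet> y)"
      by (simp add: right_diff_distrib)
    ultimately show ?thesis
      by (simp add: distrib_left right_diff_distrib) (simp add: mult_ac)
  qed
  have "y \<bullet> y = 0"
  proof (rule ccontr)
    assume ne: "y \<bullet> y \<noteq> 0"
    then have pos: "y \<bullet> y > 0" by simp
    define k where "k = m * (y \<bullet> y) - ?q y"
    have k0: "k \<ge> 0" using nonneg[OF yS] by (simp add: k_def)
    \<comment> \<open>A small negative \<open>s\<close> makes the linear term win; dividing by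
      \<open>k + 1\<close> instead of \<open>k\<close> also covers \<open>k = 0\<close>.\<close>
    have "0 \<le> 2 * (- (y \<bullet> y) / (k + 1)) * (y \<bullet> y) + (- (y \<bullet> y) / (k + 1))^2 * k"
      using * unfolding k_def by blast
    also have "\<dots> = (y \<bullet> y)^2 / (k + 1)^2 * (k - 2 * (k + 1))"
      using k0 by (simp add: divide_simps power2_eq_square) (simp add: algebra_simps)
    also have "\<dots> < 0"
      using pos k0 by (intro mult_pos_neg) auto
    finally show False by simp
  qed
  then have "A *v u = m *\<^sub>R u"
    by (simp add: y_def)
  then show ?thesis
    using that u by auto
qed

text \<open>Eigenvectors are added one at a time: the orthogonal complement of those already found
  is invariant by symmetry, and it is nonzero as long as there are fewer than
  \<open>CARD('n)\<close> of them.\<close>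

lemma symmetric_mat_orthonormal_eigenvectors:
  fixes A :: "'n::{finite,linorder} sqmat"
  assumes A: "symmetric_mat A" and "k \<le> CARD('n)"
  shows "\<exists>B. finite B \<and> card B = k \<and> (\<forall>b\<in>B. \<forall>b'\<in>B. b \<bullet> b' = (if b = b' then 1 else 0))
     \<and> (\<forall>b\<in>B. \<exists>c. A *v b = c *\<^sub>R b)"
  using assms(2)
proof (induction k)
  case 0
  show ?case by (rule exI[of _ "{}"]) simp
next
  case (Suc k)
  then obtain B where B: "finite B" "card B = k"
      "\<forall>b\<in>B. \<forall>b'\<in>B. b \<bullet> b' = (if b = b' then 1 else 0)" "\<forall>b\<in>B. \<exists>c. A *v b = c *\<^sub>R b"
    by auto
  define S where "S = {x. \<forall>b\<in>B. b \<bullet> x = 0}"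
  have S: "subspace S"
    by (auto simp: S_def subspace_def inner_add_right)
  have "dim B < DIM((real, 'n) vec)"
    using dim_le_card'[OF B(1)] B(2) Suc.prems by simp
  from orthogonal_to_subspace_exists[OF this]
  obtain a where a: "a \<noteq> 0" "\<And>x. x \<in> span B \<Longrightarrow> a \<bullet> x = 0"
    unfolding orthogonal_def by blast
  then have "a \<in> S"
    by (auto simp: S_def inner_commute span_base)
  with a have "S \<noteq> {0}" by auto
  moreover have "A *v x \<in> S" if "x \<in> S" for x
    using that B(4) by (fastforce simp: S_def symmetric_mat_inner[OF A, symmetric])
  ultimately obtain u c where u: "u \<in> S" "norm u = 1" "A *v u = c *\<^sub>R u"
    using symmetric_mat_eigenvector[OF A S] by metis
  then have "u \<notin> B"
    by (auto simp: S_def norm_eq_1)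
  with B u show ?case
    by (intro exI[of _ "insert u B"]) (auto simp: S_def inner_commute norm_eq_1)
qed

text \<open>The index type is an abstract finite linear order, so the sorted list of indices is
  addressed through the rank \<open>r i\<close>, the number of indices below
  \<open>i\<close>.\<close>

lemma ex_antimono_permutation:
  fixes v :: "'n::{finite,linorder} \<Rightarrow> real"
  shows "\<exists>\<sigma>. \<sigma> permutes UNIV \<and> (\<forall>i j. i \<le> j \<longrightarrow> v (\<sigma> j) \<le> v (\<sigma> i))"
proof -
  define ys where "ys = sort_key (\<lambda>i. - v i) (sorted_list_of_set (UNIV :: 'n set))"
  define r where "r i = card {k :: 'n. k < i}" for i
  have ys: "set ys = UNIV" "distinct ys" "sorted (map (\<lambda>i. - v i) ys)"
    by (auto simp: ys_def)
  then have len: "length ys = CARD('n)"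
    using distinct_card by fastforce
  have r_less: "r i < length ys" for i
    unfolding r_def len by (rule psubset_card_mono) auto
  have r_mono: "r i \<le> r j" if "i \<le> j" for i j
    unfolding r_def using that by (intro card_mono) auto
  have "inj r"
  proof (rule linorder_injI)
    fix i j :: 'n assume "i < j"
    then have "r i < r j"
      unfolding r_def by (intro psubset_card_mono) auto
    then show "r i \<noteq> r j" by simp
  qed
  then have "inj (\<lambda>i. ys ! r i)"
    using ys(2) r_less by (simp add: inj_def nth_eq_iff_index_eq)
  then have "(\<lambda>i. ys ! r i) permutes UNIV"
    by (intro bij_imp_permutes) (auto simp: bij_betw_def finite_UNIV_inj_surj)
  moreover have "v (ys ! r j) \<le> v (ys ! r i)" if "i \<le> j" for i j
    using sorted_nth_mono[OF ys(3) r_mono[OF that]] r_less by simp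
  ultimately show ?thesis by blast
qed

lemma orthonormal_frame_inner:
  "orthonormal_frame u \<Longrightarrow> u i \<bullet> u j = (if i = j then 1 else 0)"
  by (simp add: orthonormal_frame_def)

lemma orthonormal_frame_expansion:
  assumes "orthonormal_frame u"
  shows "(\<Sum>i\<in>UNIV. (x \<bullet> u i) *\<^sub>R u i) = x"
proof -
  have inj: "inj u"
    using assms by (auto simp: inj_def orthonormal_frame_def) (metis zero_neq_one)
  have orth: "pairwise orthogonal (range u)"
    using assms by (auto simp: pairwise_def orthogonal_def orthonormal_frame_def)
  have "0 \<notin> range u"
    using assms by (auto simp: orthonormal_frame_def) (metis inner_zero_left zero_neq_one)
  then have "independent (range u)"
    using orth pairwise_orthogonal_independent by blast
  moreover have "card (range u) = CARD('a)"
    using inj by (simp add: card_image)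
  ultimately have "span (range u) = UNIV"
    by (simp add: dim_eq_full[symmetric] dim_eq_card_independent)
  then have x: "x \<in> span (range u)" by simp
  define y where "y = x - (\<Sum>i\<in>UNIV. (x \<bullet> u i) *\<^sub>R u i)"
  have "y \<bullet> u j = 0" for j
    by (simp add: y_def inner_diff_left inner_sum_left orthonormal_frame_inner[OF assms]
        if_distrib cong: if_cong)
  then have "orthogonal y z" if "z \<in> span (range u)" for z
    using that by (intro orthogonal_to_span[of z "range u"]) (auto simp: orthogonal_def)
  then have "y \<bullet> y = 0"
    using \<open>span (range u) = UNIV\<close> by (simp add: orthogonal_def)
  then show ?thesis
    by (simp add: y_def)
qed

lemma orthonormal_frame_parseval:
  assumes "orthonormal_frame u"
  shows "(\<Sum>i\<in>UNIV. (x \<bullet> u i) * (y \<bullet> u i)) = x \<bullet> y"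
proof -
  have "(\<Sum>i\<in>UNIV. (x \<bullet> u i) * (y \<bullet> u i)) = (\<Sum>i\<in>UNIV. (x \<bullet> u i) *\<^sub>R u i) \<bullet> y"
    by (simp add: inner_sum_left inner_commute[of y])
  then show ?thesis
    by (simp add: orthonormal_frame_expansion[OF assms])
qed

lemma spec_mat_mult:
  "spec_mat u v *v x = (\<Sum>i\<in>UNIV. (v $ i * (u i \<bullet> x)) *\<^sub>R u i)"
proof -
  have "(spec_mat u v *v x) $ a = (\<Sum>i\<in>UNIV. (v $ i * (u i \<bullet> x)) *\<^sub>R u i) $ a" for a
    by (simp add: spec_mat_def matrix_vector_mult_def inner_vec_def sum_distrib_left
        sum_distrib_right) (subst sum.swap, simp add: mult_ac)
  then show ?thesis by (simp add: vec_eq_iff)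
qed

lemma spec_mat_eigen:
  assumes "orthonormal_frame u"
  shows "spec_mat u v *v u i = v $ i *\<^sub>R u i"
proof -
  have "(v $ j * (u j \<bullet> u i)) *\<^sub>R u j = (if i = j then v $ i *\<^sub>R u i else 0)" for j
    using assms by (simp add: orthonormal_frame_def)
  then show ?thesis
    by (simp add: spec_mat_mult)
qed

lemma spec_mat_add: "spec_mat u (v + w) = spec_mat u v + spec_mat u w"
  by (simp add: spec_mat_def vec_eq_iff sum.distrib algebra_simps)

lemma spec_mat_scaleR: "spec_mat u (c *\<^sub>R v) = c *\<^sub>R spec_mat u v"
  by (simp add: spec_mat_def vec_eq_iff sum_distrib_left algebra_simps)

text \<open>A crude entrywise estimate: one factor \<open>CARD('n)\<close> comes from the sum over
  the frame, one from the entries of a row, one from the rows. What matters later is linearity in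
  \<open>norm v\<close>, uniformly in the frame.\<close>

lemma norm_spec_mat_le:
  fixes u :: "'n::finite \<Rightarrow> real^'n"
  assumes "orthonormal_frame u"
  shows "norm (spec_mat u v) \<le> real CARD('n) ^ 3 * norm v"
proof -
  have comp: "\<bar>u i $ a\<bar> \<le> 1" for i a
  proof -
    have "norm (u i) = 1"
      using assms by (simp add: orthonormal_frame_def norm_eq_1)
    then show ?thesis
      using component_le_norm_cart[of "u i" a] by simp
  qed
  have ent: "\<bar>spec_mat u v $ a $ b\<bar> \<le> real CARD('n) * norm v" for a b
  proof -
    have "\<bar>spec_mat u v $ a $ b\<bar> \<le> (\<Sum>i\<in>UNIV. \<bar>v $ i * u i $ a * u i $ b\<bar>)"
      by (simp add: spec_mat_def)
    also have "\<dots> \<le> (\<Sum>i\<in>(UNIV :: 'n set). norm v)"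
    proof (rule sum_mono)
      fix i
      have "\<bar>v $ i * u i $ a * u i $ b\<bar> \<le> norm v * 1 * 1"
        unfolding abs_mult using comp component_le_norm_cart[of v i] by (intro mult_mono) auto
      then show "\<bar>v $ i * u i $ a * u i $ b\<bar> \<le> norm v" by simp
    qed
    finally show ?thesis by simp
  qed
  have row: "norm (spec_mat u v $ a) \<le> real CARD('n)^2 * norm v" for a
  proof -
    have "norm (spec_mat u v $ a) \<le> (\<Sum>b\<in>UNIV. \<bar>spec_mat u v $ a $ b\<bar>)"
      by (rule norm_le_l1_cart)
    also have "\<dots> \<le> (\<Sum>b\<in>(UNIV::'n set). real CARD('n) * norm v)"
      by (intro sum_mono ent)
    finally show ?thesis by (simp add: power2_eq_square)
  qed
  have "norm (spec_mat u v) \<le> (\<Sum>a\<in>UNIV. norm (spec_mat u v $ a))"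
    unfolding norm_vec_def by (rule L2_set_le_sum) simp
  also have "\<dots> \<le> (\<Sum>a\<in>(UNIV::'n set). real CARD('n)^2 * norm v)"
    by (intro sum_mono row)
  finally show ?thesis by (simp add: power3_eq_cube power2_eq_square)
qed

lemma mat_eq_on_frame:
  assumes "orthonormal_frame u" and "\<And>i. A *v u i = B *v u i"
  shows "A = (B :: real^'n^'m)"
proof -
  have "A *v x = B *v x" for x
  proof -
    have "A *v (\<Sum>i\<in>UNIV. (x \<bullet> u i) *\<^sub>R u i) = B *v (\<Sum>i\<in>UNIV. (x \<bullet> u i) *\<^sub>R u i)"
      by (simp add: matrix_vector_mult_scaleR assms(2) linear_sum[OF matrix_vector_mul_linear])
    then show ?thesis
      by (simp add: orthonormal_frame_expansion[OF assms(1)])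
  qed
  then show ?thesis by (simp add: matrix_eq)
qed

lemma spectral_theorem:
  fixes A :: "'n::{finite,linorder} sqmat"
  assumes A: "symmetric_mat A"
  obtains u v where "orthonormal_frame u" "A = spec_mat u v" "\<And>i j. i \<le> j \<Longrightarrow> v $ j \<le> v $ i"
proof -
  obtain B where B: "finite B" "card B = CARD('n)"
      "\<forall>b\<in>B. \<forall>b'\<in>B. b \<bullet> b' = (if b = b' then 1 else 0)" "\<forall>b\<in>B. \<exists>c. A *v b = c *\<^sub>R b"
    using symmetric_mat_orthonormal_eigenvectors[OF A, of "CARD('n)"] by auto
  obtain g where g: "bij_betw g (UNIV :: 'n set) B"
    using B(1,2) by (metis finite_class.finite_UNIV finite_same_card_bij)
  have g_orth: "g i \<bullet> g j = (if i = j then 1 else 0)" for i j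
    using g B(3) by (metis UNIV_I bij_betwE bij_betw_imp_inj_on inj_eq)
  have "\<forall>i. \<exists>c. A *v g i = c *\<^sub>R g i"
    using g B(4) by (metis UNIV_I bij_betwE)
  then obtain c where c: "\<And>i. A *v g i = c i *\<^sub>R g i"
    by metis
  obtain \<sigma> where \<sigma>: "\<sigma> permutes (UNIV :: 'n set)" "\<And>i j. i \<le> j \<Longrightarrow> c (\<sigma> j) \<le> c (\<sigma> i)"
    using ex_antimono_permutation[of c] by blast
  define u where "u i = g (\<sigma> i)" for i
  define v where "v = (\<chi> i. c (\<sigma> i))"
  have u: "orthonormal_frame u"
    using g_orth permutes_inj[OF \<sigma>(1)] by (auto simp: orthonormal_frame_def u_def inj_def)
  moreover have "A = spec_mat u v"
    by (rule mat_eq_on_frame[OF u]) (simp add: spec_mat_eigen[OF u], simp add: u_def v_def c)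
  ultimately show ?thesis
    using that \<sigma>(2) by (simp add: v_def)
qed

section \<open>Eigenvalues and Ky Fan's inequality\<close>

text \<open>The orthogonal matrix \<open>Q\<close> with the frame as columns intertwines the
  left-hand matrix with the diagonal matrix \<open>D\<close>, and its determinant cancels.\<close>

lemma det_spec_mat:
  fixes u :: "'n::finite \<Rightarrow> real^'n"
  assumes "orthonormal_frame u"
  shows "det (s *\<^sub>R mat 1 - spec_mat u v) = (\<Prod>i\<in>UNIV. s - v $ i)"
proof -
  define Q :: "real^'n^'n" where "Q = (\<chi> a i. u i $ a)"
  define D :: "real^'n^'n" where "D = (\<chi> i j. if i = j then s - v $ i else 0)"
  have "transpose Q ** Q = mat 1"
    using assms
    by (simp add: vec_eq_iff matrix_matrix_mult_def transpose_def Q_def mat_def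
        orthonormal_frame_def inner_vec_def)
  then have "det Q * det Q = 1"
    by (metis det_I det_mul det_transpose)
  then have Q: "det Q \<noteq> 0" by auto
  have "((s *\<^sub>R mat 1 - spec_mat u v) ** Q) $ a $ i = (Q ** D) $ a $ i" for a i
  proof -
    have "((s *\<^sub>R mat 1 - spec_mat u v) ** Q) $ a $ i
        = ((s *\<^sub>R mat 1 - spec_mat u v) *v u i) $ a"
      by (simp add: matrix_matrix_mult_def matrix_vector_mult_def Q_def)
    also have "(s *\<^sub>R mat 1 - spec_mat u v) *v u i = (s - v $ i) *\<^sub>R u i"
      by (simp add: matrix_vector_mult_diff_rdistrib spec_mat_eigen[OF assms]
          scaleR_matrix_vector_assoc[symmetric] algebra_simps)
    also have "\<dots> $ a = (Q ** D) $ a $ i"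
      by (simp add: matrix_matrix_mult_def Q_def D_def if_distrib cong: if_cong)
    finally show ?thesis .
  qed
  then have "(s *\<^sub>R mat 1 - spec_mat u v) ** Q = Q ** D"
    by (simp add: vec_eq_iff)
  then have "det (s *\<^sub>R mat 1 - spec_mat u v) * det Q = det D * det Q"
    by (metis det_mul mult.commute)
  then have "det (s *\<^sub>R mat 1 - spec_mat u v) = det D"
    using Q by simp
  also have "\<dots> = (\<Prod>i\<in>UNIV. s - v $ i)"
    by (subst det_diagonal) (simp_all add: D_def)
  finally show ?thesis .
qed

text \<open>This is the uniqueness behind the definite description in \<open>eigvals\<close>. Equal
  products give equal polynomials, hence equal multisets of roots, hence equally many entries above
  each threshold; for decreasing families these counts determine every entry.\<close>

lemma antimono_eq_if_prod_eq:
  fixes v w :: "'n::{finite,linorder} \<Rightarrow> real"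
  assumes prod: "\<And>s. (\<Prod>i\<in>UNIV. s - v i) = (\<Prod>i\<in>UNIV. s - w i)"
    and v: "antimono v" and w: "antimono w"
  shows "v = w"
proof -
  have proots: "proots (\<Prod>i\<in>UNIV. [:- f i, 1:]) = image_mset f (mset_set UNIV)"
    for f :: "'n \<Rightarrow> real"
  proof -
    have "proots (\<Prod>i\<in>UNIV. [:- f i, 1:]) = (\<Sum>i\<in>UNIV. {#f i#})"
      by (subst proots_prod) auto
    also have "\<dots> = image_mset f (mset_set UNIV)"
      by (induction rule: finite_induct[OF finite_class.finite_UNIV]) auto
    finally show ?thesis .
  qed
  have "(\<Prod>i\<in>UNIV. [:- v i, 1:]) = (\<Prod>i\<in>UNIV. [:- w i, 1:])"
    unfolding poly_eq_poly_eq_iff[symmetric] by (rule ext) (use prod in \<open>simp add: poly_prod\<close>)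
  from arg_cong[OF this, of proots]
  have mset: "image_mset v (mset_set UNIV) = image_mset w (mset_set UNIV)"
    by (simp only: proots)
  have card: "card {i. c \<le> v i} = card {i. c \<le> w i}" for c
  proof -
    have "card {i. c \<le> f i} = size (filter_mset (\<lambda>x. c \<le> x) (image_mset f (mset_set UNIV)))"
      for f :: "'n \<Rightarrow> real"
      by (simp add: filter_mset_image_mset)
    then show ?thesis by (simp add: mset)
  qed
  \<comment> \<open>If \<open>g i < f i\<close>, then at the threshold \<open>f i\<close> all
    indices up to \<open>i\<close> count for \<open>f\<close>, but only indices strictly below
    \<open>i\<close> count for \<open>g\<close>.\<close>
  have le: "f i \<le> g i" if f: "antimono f" and g: "antimono g"
    and card: "\<And>c. card {i. c \<le> f i} = card {i. c \<le> g i}" for f g :: "'n \<Rightarrow> real" and i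
  proof (rule ccontr)
    assume "\<not> f i \<le> g i"
    then have "{j. f i \<le> g j} \<subseteq> {..<i}"
    proof (intro subsetI)
      fix j assume "j \<in> {j. f i \<le> g j}"
      with \<open>\<not> f i \<le> g i\<close> have "g i < g j" by simp
      then show "j \<in> {..<i}"
        using antimonoD[OF g, of i j] by (metis lessThan_iff not_le)
    qed
    then have "card {j. f i \<le> g j} \<le> card {..<i}"
      by (intro card_mono) auto
    moreover have "{..i} \<subseteq> {j. f i \<le> f j}"
      using f by (auto dest: antimonoD)
    then have "card {..i} \<le> card {j. f i \<le> f j}"
      by (intro card_mono) auto
    moreover have "card {..<i} < card {..i}"
      by (rule psubset_card_mono) auto
    ultimately show False by (simp add: card)
  qed
  show ?thesis
    using le[OF v w card] le[OF w v card[symmetric]] by (auto intro!: ext antisym)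
qed

lemma eigvals_spec_mat:
  fixes u :: "'n::{finite,linorder} \<Rightarrow> (real, 'n) vec"
  assumes "orthonormal_frame u" and v: "\<And>i j. i \<le> j \<Longrightarrow> v $ j \<le> v $ i"
  shows "eigvals (spec_mat u v) = v"
  unfolding eigvals_def
proof (rule the_equality)
  show "(\<forall>i j. i \<le> j \<longrightarrow> v $ j \<le> v $ i) \<and>
      (\<forall>s. det (s *\<^sub>R mat 1 - spec_mat u v) = (\<Prod>i\<in>UNIV. s - v $ i))"
    using v by (simp add: det_spec_mat[OF assms(1)])
next
  fix w :: "(real, 'n) vec"
  assume w: "(\<forall>i j. i \<le> j \<longrightarrow> w $ j \<le> w $ i) \<and>
      (\<forall>s. det (s *\<^sub>R mat 1 - spec_mat u v) = (\<Prod>i\<in>UNIV. s - w $ i))"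
  have "vec_nth w = vec_nth v"
    by (rule antimono_eq_if_prod_eq)
      (use w v in \<open>auto simp: antimono_def det_spec_mat[OF assms(1)]\<close>)
  then show "w = v" by (simp add: vec_eq_iff)
qed

lemma symmetric_mat_eigvals:
  assumes "symmetric_mat A"
  obtains u where "orthonormal_frame u" "A = spec_mat u (eigvals A)"
  by (metis assms eigvals_spec_mat spectral_theorem)

lemma eigvals_antimono:
  assumes "symmetric_mat A" "i \<le> j"
  shows "eigvals A $ j \<le> eigvals A $ i"
  by (metis assms eigvals_spec_mat spectral_theorem)

lemma orthonormal_frame_compose:
  assumes "orthonormal_frame u" "\<sigma> permutes UNIV"
  shows "orthonormal_frame (\<lambda>i. u (\<sigma> i))"
  using assms permutes_inj[OF assms(2)] by (simp add: orthonormal_frame_def inj_eq)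

lemma spec_mat_permute:
  assumes "\<sigma> permutes UNIV"
  shows "spec_mat (\<lambda>i. u (\<sigma> i)) (\<chi> i. v $ \<sigma> i) = spec_mat u v"
proof -
  have "(\<Sum>i\<in>UNIV. v $ \<sigma> i * u (\<sigma> i) $ a * u (\<sigma> i) $ b) = (\<Sum>i\<in>UNIV. v $ i * u i $ a * u i $ b)"
    for a b
    using sum.permute[OF assms, of "\<lambda>i. v $ i * u i $ a * u i $ b"] by (simp add: o_def)
  then show ?thesis
    by (simp add: spec_mat_def)
qed

lemma eigvals_spec_mat_permute:
  assumes "orthonormal_frame u" "\<sigma> permutes UNIV" "\<And>i j. i \<le> j \<Longrightarrow> v $ \<sigma> j \<le> v $ \<sigma> i"
  shows "eigvals (spec_mat u v) = (\<chi> i. v $ \<sigma> i)"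
proof -
  have "eigvals (spec_mat (\<lambda>i. u (\<sigma> i)) (\<chi> i. v $ \<sigma> i)) = (\<chi> i. v $ \<sigma> i)"
    by (rule eigvals_spec_mat[OF orthonormal_frame_compose[OF assms(1,2)]]) (simp add: assms(3))
  then show ?thesis
    by (simp add: spec_mat_permute[OF assms(2)])
qed

lemma spectral_fun_spec_mat:
  assumes "symmetric_fun \<theta>" "orthonormal_frame u"
  shows "spectral_fun \<theta> (spec_mat u v) = \<theta> v"
proof -
  obtain \<sigma> where \<sigma>: "\<sigma> permutes UNIV" "\<And>i j. i \<le> j \<Longrightarrow> v $ \<sigma> j \<le> v $ \<sigma> i"
    using ex_antimono_permutation[of "vec_nth v"] by blast
  then have "spectral_fun \<theta> (spec_mat u v) = \<theta> (\<chi> i. v $ \<sigma> i)"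
    by (simp add: spectral_fun_def symmetric_mat_spec_mat eigvals_spec_mat_permute[OF assms(2)])
  then show ?thesis
    using assms(1) \<sigma>(1) by (simp add: symmetric_fun_def)
qed

section \<open>Abel summation and Ky Fan's maximum principle\<close>

lemma spec_mat_quadratic_form: "x \<bullet> (spec_mat u v *v x) = (\<Sum>i\<in>UNIV. v $ i * (x \<bullet> u i)\<^sup>2)"
  by (simp add: spec_mat_mult inner_sum_right power2_eq_square inner_commute mult_ac)

text \<open>Induction removes the largest index \<open>b\<close>. The lower bound \<open>c\<close>
  has to vary, because the smaller set is treated with the bound \<open>a b\<close>, the least
  weight; the initial segments are relative to \<open>A\<close> for the same reason.\<close>

lemma abel_summation_le:
  fixes a d :: "'n::linorder \<Rightarrow> real"
  assumes "finite A"
    and "\<And>J. J \<subseteq> A \<Longrightarrow> (\<And>i k. i \<in> J \<Longrightarrow> k \<in> A \<Longrightarrow> k \<le> i \<Longrightarrow> k \<in> J) \<Longrightarrow> 0 \<le> sum d J"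
    and "\<And>i j. i \<in> A \<Longrightarrow> j \<in> A \<Longrightarrow> i \<le> j \<Longrightarrow> a j \<le> a i"
    and "\<And>i. i \<in> A \<Longrightarrow> c \<le> a i"
  shows "c * sum d A \<le> (\<Sum>i\<in>A. a i * d i)"
  using assms
proof (induction A arbitrary: c rule: finite_linorder_max_induct)
  case (insert b A)
  have "a b * sum d A \<le> (\<Sum>i\<in>A. a i * d i)"
  proof (rule insert.IH)
    fix J assume J: "J \<subseteq> A" "\<And>i k. i \<in> J \<Longrightarrow> k \<in> A \<Longrightarrow> k \<le> i \<Longrightarrow> k \<in> J"
    show "0 \<le> sum d J"
      by (rule insert.prems(1)) (use J insert.hyps(2) in \<open>auto dest!: subsetD\<close>)
  qed (use insert in \<open>auto intro: less_imp_le\<close>)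
  moreover have "0 \<le> sum d (insert b A)"
    by (rule insert.prems(1)) auto
  then have "c * sum d (insert b A) \<le> a b * sum d (insert b A)"
    using insert.prems(3) by (intro mult_right_mono) auto
  moreover have "b \<notin> A"
    using insert.hyps(2) by auto
  ultimately show ?case
    using insert.hyps(1) by (simp add: distrib_left)
qed simp

definition initial_segment :: "'n::order set \<Rightarrow> bool" where
  "initial_segment I \<longleftrightarrow> (\<forall>i\<in>I. \<forall>k\<le>i. k \<in> I)"

lemma initial_segment_linear:
  fixes I J :: "'n::linorder set"
  shows "initial_segment I \<Longrightarrow> initial_segment J \<Longrightarrow> I \<subseteq> J \<or> J \<subseteq> I"
  by (metis initial_segment_def linear subsetI)

text \<open>A zero total makes the term with the lower bound of the weights vanish, so the weights
  may have any sign.\<close>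

lemma abel_summation_nonneg:
  fixes a d :: "'n::{finite,linorder} \<Rightarrow> real"
  assumes "\<And>J. initial_segment J \<Longrightarrow> 0 \<le> sum d J" and "sum d UNIV = 0" and "antimono a"
  shows "0 \<le> (\<Sum>i\<in>UNIV. a i * d i)"
proof -
  have "Min (range a) * sum d UNIV \<le> (\<Sum>i\<in>UNIV. a i * d i)"
    using assms(1,3) by (intro abel_summation_le) (auto simp: initial_segment_def antimono_def)
  then show ?thesis
    by (simp add: assms(2))
qed

text \<open>Invariance of the trace under a change of frame; it supplies the zero total when Abel
  summation is applied to Ky Fan's inequality.\<close>

lemma trace_frame:
  assumes A: "symmetric_mat A" and w: "orthonormal_frame w"
  shows "(\<Sum>i\<in>UNIV. w i \<bullet> (A *v w i)) = (\<Sum>i\<in>UNIV. eigvals A $ i)"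
proof -
  obtain u where u: "orthonormal_frame u" and Au: "A = spec_mat u (eigvals A)"
    using symmetric_mat_eigvals[OF A] .
  have "(\<Sum>i\<in>UNIV. w i \<bullet> (A *v w i)) = (\<Sum>i\<in>UNIV. \<Sum>j\<in>UNIV. eigvals A $ j * (w i \<bullet> u j)\<^sup>2)"
    by (subst Au) (simp add: spec_mat_quadratic_form)
  also have "\<dots> = (\<Sum>j\<in>UNIV. eigvals A $ j * (\<Sum>i\<in>UNIV. (u j \<bullet> w i) * (u j \<bullet> w i)))"
    by (subst sum.swap) (simp add: sum_distrib_left power2_eq_square inner_commute)
  finally show ?thesis
    by (simp add: orthonormal_frame_parseval[OF w] orthonormal_frame_inner[OF u])
qed

text \<open>The squares of the inner products of two frames form a doubly stochastic matrix. Hence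
  the column sums \<open>p\<close> over \<open>I\<close> lie between 0 and 1 with total
  \<open>card I\<close>, and pairing them with decreasing eigenvalues gives at most what the
  indicator \<open>e\<close> of \<open>I\<close> gives. Initial segments are nested, which leaves
  two cases when comparing partial sums of \<open>e\<close> and \<open>p\<close>.\<close>

lemma ky_fan:
  fixes A :: "'n::{finite,linorder} sqmat"
  assumes A: "symmetric_mat A" and w: "orthonormal_frame w" and I: "initial_segment I"
  shows "(\<Sum>i\<in>I. w i \<bullet> (A *v w i)) \<le> (\<Sum>i\<in>I. eigvals A $ i)"
proof -
  obtain u where u: "orthonormal_frame u" and Au: "A = spec_mat u (eigvals A)"
    using symmetric_mat_eigvals[OF A] .
  define p where "p j = (\<Sum>i\<in>I. (w i \<bullet> u j)\<^sup>2)" for j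
  define e where "e j = (if j \<in> I then 1 else 0 :: real)" for j
  have row: "(\<Sum>j\<in>UNIV. (w i \<bullet> u j)\<^sup>2) = 1" for i
    using orthonormal_frame_parseval[OF u, of "w i" "w i"]
    by (simp add: power2_eq_square orthonormal_frame_inner[OF w])
  have col: "(\<Sum>i\<in>UNIV. (w i \<bullet> u j)\<^sup>2) = 1" for j
    using orthonormal_frame_parseval[OF w, of "u j" "u j"]
    by (simp add: power2_eq_square orthonormal_frame_inner[OF u] inner_commute)
  have sum_e: "sum e J = card (J \<inter> I)" for J :: "'n set"
    by (simp add: e_def sum.If_cases)
  have p_le: "p j \<le> 1" for j
    unfolding p_def col[of j, symmetric] by (rule sum_mono2) auto
  have sum_p: "sum p J \<le> card I" for J
  proof -
    have "sum p J = (\<Sum>i\<in>I. \<Sum>j\<in>J. (w i \<bullet> u j)\<^sup>2)"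
      unfolding p_def by (rule sum.swap)
    also have "\<dots> \<le> (\<Sum>i\<in>I. 1)"
    proof (rule sum_mono)
      fix i show "(\<Sum>j\<in>J. (w i \<bullet> u j)\<^sup>2) \<le> 1"
        unfolding row[of i, symmetric] by (rule sum_mono2) auto
    qed
    finally show ?thesis by simp
  qed
  have "0 \<le> (\<Sum>j\<in>UNIV. eigvals A $ j * (e j - p j))"
  proof (rule abel_summation_nonneg)
    fix J :: "'n set" assume "initial_segment J"
    then consider "I \<subseteq> J" | "J \<subseteq> I"
      using I initial_segment_linear by blast
    then show "0 \<le> (\<Sum>j\<in>J. e j - p j)"
    proof cases
      case 1
      then have "J \<inter> I = I" by blast
      then show ?thesis
        using sum_p[of J] by (simp add: sum_subtractf sum_e)
    next
      case 2
      then have "J \<inter> I = J" by blast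
      moreover have "sum p J \<le> (\<Sum>j\<in>J. 1)" by (intro sum_mono p_le)
      ultimately show ?thesis
        by (simp add: sum_subtractf sum_e)
    qed
  next
    have "sum p UNIV = (\<Sum>i\<in>I. \<Sum>j\<in>UNIV. (w i \<bullet> u j)\<^sup>2)"
      unfolding p_def by (rule sum.swap)
    then show "(\<Sum>j\<in>UNIV. e j - p j) = 0"
      by (simp add: sum_subtractf sum_e row)
  next
    show "antimono (\<lambda>j. eigvals A $ j)"
      by (simp add: antimono_def eigvals_antimono[OF A])
  qed
  moreover have "(\<Sum>j\<in>UNIV. eigvals A $ j * e j) = (\<Sum>i\<in>I. eigvals A $ i)"
    by (simp add: e_def if_distrib sum.If_cases cong: if_cong)
  moreover have "(\<Sum>j\<in>UNIV. eigvals A $ j * p j) = (\<Sum>i\<in>I. w i \<bullet> (A *v w i))"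
  proof -
    have "(\<Sum>i\<in>I. w i \<bullet> (A *v w i)) = (\<Sum>i\<in>I. \<Sum>j\<in>UNIV. eigvals A $ j * (w i \<bullet> u j)\<^sup>2)"
      by (subst Au) (simp add: spec_mat_quadratic_form)
    also have "\<dots> = (\<Sum>j\<in>UNIV. eigvals A $ j * p j)"
      unfolding p_def sum_distrib_left by (rule sum.swap)
    finally show ?thesis ..
  qed
  ultimately show ?thesis
    by (simp add: right_diff_distrib sum_subtractf)
qed

text \<open>Abel summation combines the inequalities for all initial segments. This form confines
  the diagonal of a symmetric matrix to the convex hull of the rearrangements of its
  eigenvalues.\<close>

lemma weighted_ky_fan:
  fixes A :: "'n::{finite,linorder} sqmat"
  assumes A: "symmetric_mat A" and w: "orthonormal_frame w" and c: "antimono c"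
  shows "(\<Sum>i\<in>UNIV. c i * (w i \<bullet> (A *v w i))) \<le> (\<Sum>i\<in>UNIV. c i * eigvals A $ i)"
proof -
  have "0 \<le> (\<Sum>i\<in>UNIV. c i * (eigvals A $ i - w i \<bullet> (A *v w i)))"
    by (rule abel_summation_nonneg[OF _ _ c])
      (simp_all add: sum_subtractf ky_fan[OF A w] trace_frame[OF A w])
  then show ?thesis
    by (simp add: right_diff_distrib sum_subtractf)
qed

text \<open>The norm of a matrix is here the Euclidean norm of nested vectors, that is, the
  Frobenius norm, so Cauchy-Schwarz in each row suffices.\<close>

lemma norm_matrix_vector_mult_le: "norm (A *v x) \<le> norm (A :: real^'n^'m) * norm x"
proof -
  have "(norm (A *v x))\<^sup>2 = (\<Sum>i\<in>UNIV. (A $ i \<bullet> x)\<^sup>2)"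
    by (simp add: norm_vec_def L2_set_def sum_nonneg matrix_vector_mul_component)
  also have "\<dots> \<le> (\<Sum>i\<in>UNIV. (norm (A $ i))\<^sup>2 * (norm x)\<^sup>2)"
  proof (rule sum_mono)
    fix i
    have "\<bar>A $ i \<bullet> x\<bar> \<le> norm (A $ i) * norm x"
      by (rule Cauchy_Schwarz_ineq2)
    then have "\<bar>A $ i \<bullet> x\<bar>\<^sup>2 \<le> (norm (A $ i) * norm x)\<^sup>2"
      by (rule power_mono) simp
    then show "(A $ i \<bullet> x)\<^sup>2 \<le> (norm (A $ i))\<^sup>2 * (norm x)\<^sup>2"
      by (simp add: power_mult_distrib)
  qed
  also have "\<dots> = (norm A * norm x)\<^sup>2"
    by (simp add: norm_vec_def[of A] L2_set_def sum_nonneg power_mult_distrib sum_distrib_right)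
  finally show ?thesis
    by (rule power2_le_imp_le) simp
qed

lemma abs_quadratic_form_le:
  assumes "norm x = 1"
  shows "\<bar>x \<bullet> (A *v x)\<bar> \<le> norm (A :: real^'n^'n)"
  using Cauchy_Schwarz_ineq2[of x "A *v x"] norm_matrix_vector_mult_le[of A x] assms by simp

lemma orthonormal_frame_norm: "orthonormal_frame u \<Longrightarrow> norm (u i) = 1"
  by (simp add: orthonormal_frame_def norm_eq_1)

text \<open>The eigenvectors of \<open>B\<close> are used as trial vectors for \<open>A\<close> in
  Ky Fan's inequality.\<close>

lemma sum_eigvals_le:
  fixes A B :: "'n::{finite,linorder} sqmat"
  assumes A: "symmetric_mat A" and B: "symmetric_mat B" and I: "initial_segment I"
  shows "(\<Sum>i\<in>I. eigvals B $ i) - (\<Sum>i\<in>I. eigvals A $ i) \<le> real CARD('n) * norm (A - B)"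
proof -
  obtain u where u: "orthonormal_frame u" and Bu: "B = spec_mat u (eigvals B)"
    using symmetric_mat_eigvals[OF B] .
  have "eigvals B $ i - norm (A - B) \<le> u i \<bullet> (A *v u i)" for i
  proof -
    have "u i \<bullet> (A *v u i) = u i \<bullet> (B *v u i) + u i \<bullet> ((A - B) *v u i)"
      by (simp add: matrix_vector_mult_diff_rdistrib inner_diff_right)
    moreover have "u i \<bullet> (B *v u i) = eigvals B $ i"
      by (subst Bu) (simp add: spec_mat_eigen[OF u] orthonormal_frame_inner[OF u])
    moreover have "\<bar>u i \<bullet> ((A - B) *v u i)\<bar> \<le> norm (A - B)"
      by (rule abs_quadratic_form_le) (rule orthonormal_frame_norm[OF u])
    ultimately show ?thesis by linarith
  qed
  then have "(\<Sum>i\<in>I. eigvals B $ i - norm (A - B)) \<le> (\<Sum>i\<in>I. u i \<bullet> (A *v u i))"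
    by (intro sum_mono)
  also have "\<dots> \<le> (\<Sum>i\<in>I. eigvals A $ i)"
    by (rule ky_fan[OF A u I])
  finally have "(\<Sum>i\<in>I. eigvals B $ i) - (\<Sum>i\<in>I. eigvals A $ i) \<le> card I * norm (A - B)"
    by (simp add: sum_subtractf)
  also have "\<dots> \<le> real CARD('n) * norm (A - B)"
    by (intro mult_right_mono) (auto intro: card_mono)
  finally show ?thesis .
qed

lemma initial_segment_atMost: "initial_segment {..i :: 'n::linorder}"
  and initial_segment_lessThan: "initial_segment {..<i :: 'n::linorder}"
  by (auto simp: initial_segment_def)

text \<open>Ky Fan's inequality speaks about sums over initial segments; this is how estimates for
  single eigenvalues are recovered, at the price of doubling the constants.\<close>

lemma component_eq_sum_diff:
  fixes f :: "'n::{finite,linorder} \<Rightarrow> real"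
  shows "f i = sum f {..i} - sum f {..<i}"
proof -
  have "{..i} = insert i {..<i}" by auto
  then show ?thesis by simp
qed

text \<open>The factor 2 stems from the two segment sums behind each component; one factor
  \<open>CARD('n)\<close> comes from \<open>sum_eigvals_le\<close>, the other from passing to the
  sum of absolute components.\<close>

lemma eigvals_lipschitz:
  fixes A B :: "'n::{finite,linorder} sqmat"
  assumes A: "symmetric_mat A" and B: "symmetric_mat B"
  shows "norm (eigvals A - eigvals B) \<le> 2 * (real CARD('n))\<^sup>2 * norm (A - B)"
proof -
  have "\<bar>eigvals A $ i - eigvals B $ i\<bar> \<le> 2 * real CARD('n) * norm (A - B)" for i
    using sum_eigvals_le[OF A B initial_segment_atMost[of i]]
      sum_eigvals_le[OF A B initial_segment_lessThan[of i]]
      sum_eigvals_le[OF B A initial_segment_atMost[of i]]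
      sum_eigvals_le[OF B A initial_segment_lessThan[of i]]
    unfolding component_eq_sum_diff[of "vec_nth (eigvals A)" i]
      component_eq_sum_diff[of "vec_nth (eigvals B)" i] norm_minus_commute[of B A]
    by linarith
  then have "(\<Sum>i\<in>UNIV. \<bar>(eigvals A - eigvals B) $ i\<bar>)
      \<le> (\<Sum>i\<in>(UNIV :: 'n set). 2 * real CARD('n) * norm (A - B))"
    by (intro sum_mono) simp
  then show ?thesis
    using norm_le_l1_cart[of "eigvals A - eigvals B"] by (simp add: power2_eq_square)
qed

section \<open>Directional derivatives of the eigenvalue map\<close>

lemma real_polynomial_function_ident: "real_polynomial_function (\<lambda>t::real. t)"
  by (rule real_polynomial_function.intros(1)) (rule bounded_linear_ident)

lemmas real_polynomial_function_intros =
  real_polynomial_function_ident real_polynomial_function.intros(2-4)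
  real_polynomial_function_diff real_polynomial_function_power real_polynomial_function_divide

lemma real_polynomial_function_det:
  fixes A :: "real \<Rightarrow> real^'n^'n"
  assumes "\<And>i j. real_polynomial_function (\<lambda>t. A t $ i $ j)"
  shows "real_polynomial_function (\<lambda>t. det (A t))"
  unfolding det_def using assms by (intro real_polynomial_function_sum real_polynomial_function_prod
      real_polynomial_function.intros(2,4) finite_permutations) auto

lemma real_polynomial_function_eventually_nonzero:
  fixes p :: "real \<Rightarrow> real"
  assumes "real_polynomial_function p" and "p s \<noteq> 0"
  shows "\<forall>\<^sub>F t in at_right 0. p t \<noteq> 0"
proof -
  obtain a n where p: "p = (\<lambda>x. \<Sum>i\<le>n. a i * x ^ i)"
    using real_polynomial_function_imp_sum[OF assms(1)] by blast
  have "\<exists>k\<le>n. a k \<noteq> 0"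
    using assms(2) unfolding p by (metis (mono_tags, lifting) atMost_iff mult_zero_left sum.neutral)
  then have "finite {x. p x = 0}"
    unfolding p by (subst polyfun_finite_roots) blast
  \<comment> \<open>A root at 0 itself is tolerated, since only positive \<open>t\<close> matter for
    the one-sided limit.\<close>
  then have "open (- ({x. p x = 0} - {0}))"
    by (intro open_Compl finite_imp_closed) simp
  then have "\<forall>\<^sub>F t in nhds 0. t \<in> - ({x. p x = 0} - {0})"
    by (rule eventually_nhds_in_open) simp
  then have "\<forall>\<^sub>F t in at_right 0. t \<in> - ({x. p x = 0} - {0})"
    by (rule filter_leD[OF at_within_le_nhds])
  moreover have "\<forall>\<^sub>F t in at_right (0::real). t > 0"
    by (simp add: eventually_at_right_less)
  ultimately show ?thesis
    by eventually_elim auto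
qed

lemma eventually_less_or_greater:
  fixes f :: "real \<Rightarrow> real"
  assumes "continuous_on {0<..} f" and "\<forall>\<^sub>F t in at_right 0. f t \<noteq> c"
  shows "(\<forall>\<^sub>F t in at_right 0. f t < c) \<or> (\<forall>\<^sub>F t in at_right 0. c < f t)"
proof (rule ccontr)
  assume neg: "\<not> ?thesis"
  obtain d where d: "d > 0" "\<And>t. 0 < t \<Longrightarrow> t < d \<Longrightarrow> f t \<noteq> c"
    using assms(2) by (auto simp: eventually_at_right_field)
  have "\<not> (\<forall>\<^sub>F t in at_right 0. f t < c)" and "\<not> (\<forall>\<^sub>F t in at_right 0. c < f t)"
    using neg by blast+
  then obtain t1 t2 where t1: "0 < t1" "t1 < d" "f t1 \<ge> c" and t2: "0 < t2" "t2 < d" "f t2 \<le> c"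
    using d(1) unfolding eventually_at_right_field by (meson not_less)
  have "connected (f ` {0<..<d})"
    using assms(1) by (intro connected_continuous_image connected_Ioo)
      (auto intro: continuous_on_subset)
  from connectedD_interval[OF this, of "f t2" "f t1" c] t1 t2
  have "c \<in> f ` {0<..<d}" by auto
  then show False using d(2) by (metis greaterThanLessThan_iff imageE)
qed

text \<open>The limit is the supremum of the levels that \<open>f\<close> eventually exceeds. By
  continuity, a level that is eventually avoided is eventually passed on one side; between the
  supremum and any larger \<open>a\<close> there is such a level because \<open>F\<close> is finite,
  and \<open>f\<close> must end up below it.\<close>

lemma tendsto_if_eventually_avoids:
  fixes f :: "real \<Rightarrow> real"
  assumes cont: "continuous_on {0<..} f" and bound: "\<And>t. 0 < t \<Longrightarrow> t < 1 \<Longrightarrow> \<bar>f t\<bar> \<le> M"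
    and F: "finite F" and avoid: "\<And>c. c \<notin> F \<Longrightarrow> \<forall>\<^sub>F t in at_right 0. f t \<noteq> c"
  shows "\<exists>l. (f \<longlongrightarrow> l) (at_right 0)"
proof -
  define S where "S = {c. \<forall>\<^sub>F t in at_right 0. c < f t}"
  have ev: "\<forall>\<^sub>F t in at_right 0. \<bar>f t\<bar> \<le> M"
    using bound by (auto simp: eventually_at_right_field intro!: exI[of _ 1])
  have "- M - 1 \<in> S"
    unfolding S_def mem_Collect_eq using ev by eventually_elim auto
  have bdd: "bdd_above S"
  proof (rule bdd_aboveI)
    fix c assume "c \<in> S"
    then have "\<forall>\<^sub>F t in at_right 0. c < f t" by (simp add: S_def)
    with ev have "\<forall>\<^sub>F t in at_right (0::real). c \<le> M" by eventually_elim auto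
    then show "c \<le> M" by simp
  qed
  have "(f \<longlongrightarrow> Sup S) (at_right 0)"
  proof (rule order_tendstoI)
    fix a assume "a < Sup S"
    then obtain c where "c \<in> S" "a < c"
      using \<open>- M - 1 \<in> S\<close> less_cSup_iff[OF _ bdd] by blast
    then have "\<forall>\<^sub>F t in at_right 0. c < f t" by (simp add: S_def)
    then show "\<forall>\<^sub>F t in at_right 0. a < f t"
      by eventually_elim (use \<open>a < c\<close> in auto)
  next
    fix a assume a: "Sup S < a"
    have "infinite ({Sup S<..<a} - F)"
      using F infinite_Ioo[OF a] by simp
    then obtain c where c: "Sup S < c" "c < a" "c \<notin> F"
      by (metis DiffE ex_in_conv finite.emptyI greaterThanLessThan_iff)
    then have "c \<notin> S"
      using cSup_upper[OF _ bdd] by fastforce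
    then have "\<forall>\<^sub>F t in at_right 0. f t < c"
      using eventually_less_or_greater[OF cont avoid[OF c(3)]] by (auto simp: S_def)
    then show "\<forall>\<^sub>F t in at_right 0. f t < a"
      by eventually_elim (use c in auto)
  qed
  then show ?thesis ..
qed

lemma det_eigvals:
  fixes A :: "'n::{finite,linorder} sqmat"
  assumes "symmetric_mat A"
  shows "det (s *\<^sub>R mat 1 - A) = 0 \<longleftrightarrow> s \<in> range (($) (eigvals A))"
proof -
  obtain u where u: "orthonormal_frame u" "A = spec_mat u (eigvals A)"
    using symmetric_mat_eigvals[OF assms] .
  have "det (s *\<^sub>R mat 1 - A) = (\<Prod>i\<in>UNIV. s - eigvals A $ i)"
    using det_spec_mat[OF u(1), of s "eigvals A"] u(2) by simp
  then show ?thesis by auto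
qed

lemma continuous_on_eigvals: "continuous_on {A :: 'n::{finite,linorder} sqmat. symmetric_mat A} eigvals"
proof (rule continuous_on_subset)
  have "(2 * (real CARD('n))\<^sup>2)-lipschitz_on {A :: 'n sqmat. symmetric_mat A} eigvals"
    by (rule lipschitz_onI) (auto simp: dist_norm eigvals_lipschitz)
  then show "continuous_on {A :: 'n sqmat. symmetric_mat A} eigvals"
    by (rule lipschitz_on_continuous_on)
qed simp

text \<open>For a polynomial curve of symmetric matrices, a quotient built from one eigenvalue takes the
  value \<open>c\<close> only where the characteristic polynomial vanishes along a polynomial curve, hence,
  for all but finitely many \<open>c\<close>, nowhere near \<open>0\<close>. So boundedness already forces convergence,
  and no analytic perturbation theory is needed.\<close>

lemma eigval_quotient_tendsto:
  fixes X H W :: "'n::{finite,linorder} sqmat"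
  assumes sym: "symmetric_mat X" "symmetric_mat H" "symmetric_mat W"
    and a: "real_polynomial_function a" and b: "real_polynomial_function b"
    and b_pos: "\<And>t. 0 < t \<Longrightarrow> b t \<noteq> (0::real)"
    and bound: "\<And>t. 0 < t \<Longrightarrow> t < 1 \<Longrightarrow>
      \<bar>(eigvals (X + t *\<^sub>R H + (t\<^sup>2 / 2) *\<^sub>R W) $ i - a t) / b t\<bar> \<le> M"
  shows "\<exists>l. ((\<lambda>t. (eigvals (X + t *\<^sub>R H + (t\<^sup>2 / 2) *\<^sub>R W) $ i - a t) / b t) \<longlongrightarrow> l) (at_right 0)"
proof -
  define A where "A t = X + t *\<^sub>R H + (t\<^sup>2 / 2) *\<^sub>R W" for t
  have symA: "symmetric_mat (A t)" for t
    unfolding A_def by (intro symmetric_mat_intros sym)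
  \<comment> \<open>These are exactly the levels \<open>c\<close> for which the polynomial
    \<open>p\<close> below vanishes at time 1. Any other level yields a polynomial that is not
    identically zero; time 1 is just a convenient positive time.\<close>
  define F where "F = (\<lambda>s. (s - a 1) / b 1) ` range (($) (eigvals (A 1)))"
  have "\<exists>l. ((\<lambda>t. (eigvals (A t) $ i - a t) / b t) \<longlongrightarrow> l) (at_right 0)"
  proof (rule tendsto_if_eventually_avoids)
    have "continuous_on {0<..} a" "continuous_on {0<..} b"
      using a b by (auto intro!: continuous_on_polymonial_function simp: real_polynomial_function_eq)
    moreover have "continuous_on {0<..} A"
      unfolding A_def by (intro continuous_intros) auto
    then have "continuous_on {0<..} (\<lambda>t. eigvals (A t))"
      by (rule continuous_on_compose2[OF continuous_on_eigvals]) (use symA in auto)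
    ultimately show "continuous_on {0<..} (\<lambda>t. (eigvals (A t) $ i - a t) / b t)"
      by (auto intro!: continuous_intros b_pos)
  next
    fix t :: real assume "0 < t" "t < 1"
    from bound[OF this] show "\<bar>(eigvals (A t) $ i - a t) / b t\<bar> \<le> M"
      by (simp add: A_def)
  next
    show "finite F" by (simp add: F_def)
  next
    fix c assume c: "c \<notin> F"
    define p where "p t = det ((a t + c * b t) *\<^sub>R mat 1 - A t)" for t
    have "real_polynomial_function (\<lambda>t. A t $ j $ k)" for j k
      unfolding A_def vector_add_component vector_scaleR_component real_scaleR_def
      by (intro real_polynomial_function_intros)
    then have "real_polynomial_function p"
      unfolding p_def
      by (intro real_polynomial_function_det)
        (unfold vector_minus_component vector_scaleR_component real_scaleR_def,
          intro a b real_polynomial_function_intros)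
    moreover have "p 1 \<noteq> 0"
    proof
      assume "p 1 = 0"
      then have "a 1 + c * b 1 \<in> range (($) (eigvals (A 1)))"
        by (simp add: p_def det_eigvals[OF symA])
      then have "(a 1 + c * b 1 - a 1) / b 1 \<in> F"
        unfolding F_def by (rule imageI)
      then show False using c b_pos[of 1] by simp
    qed
    ultimately have "\<forall>\<^sub>F t in at_right 0. p t \<noteq> 0"
      by (rule real_polynomial_function_eventually_nonzero)
    moreover have "\<forall>\<^sub>F t in at_right (0::real). t > 0"
      by (simp add: eventually_at_right_less)
    ultimately show "\<forall>\<^sub>F t in at_right 0. (eigvals (A t) $ i - a t) / b t \<noteq> c"
    proof eventually_elim
      case (elim t)
      have "eigvals (A t) $ i \<noteq> a t + c * b t"
        using elim(1) unfolding p_def det_eigvals[OF symA] by (metis rangeI)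
      then show ?case
        using b_pos[OF elim(2)] by (auto simp: divide_eq_eq)
    qed
  qed
  then show ?thesis by (simp add: A_def)
qed

section \<open>Existence of the first and second directional derivatives\<close>

lemma symmetric_mat_0: "symmetric_mat 0"
  by (simp add: symmetric_mat_def transpose_def vec_eq_iff)

lemma tendsto_vec_exists:
  fixes f :: "'a \<Rightarrow> real^'n"
  assumes "\<And>i. \<exists>l. ((\<lambda>t. f t $ i) \<longlongrightarrow> l) F"
  shows "\<exists>l. (f \<longlongrightarrow> l) F"
proof -
  obtain l where "\<And>i. ((\<lambda>t. f t $ i) \<longlongrightarrow> l i) F"
    using assms by metis
  then have "(f \<longlongrightarrow> (\<chi> i. l i)) F"
    by (intro vec_tendstoI) simp
  then show ?thesis ..
qed

text \<open>Lipschitz continuity bounds the quotient, and boundedness gives convergence; the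
  quadratic part of the curve is switched off by taking the zero matrix. Only with this convergence
  does the \<open>Lim\<close> in \<open>eig_dir1\<close> denote the intended derivative.\<close>

lemma eig_dir1_tendsto:
  fixes X H :: "'n::{finite,linorder} sqmat"
  assumes sym: "symmetric_mat X" "symmetric_mat H"
  shows "((\<lambda>t. (1 / t) *\<^sub>R (eigvals (X + t *\<^sub>R H) - eigvals X)) \<longlongrightarrow> eig_dir1 X H) (at_right 0)"
proof -
  define L where "L = 2 * (real CARD('n))\<^sup>2"
  have ex: "\<exists>l. ((\<lambda>t. ((1 / t) *\<^sub>R (eigvals (X + t *\<^sub>R H) - eigvals X)) $ i) \<longlongrightarrow> l) (at_right 0)" for i
  proof -
    have "\<exists>l. ((\<lambda>t. (eigvals (X + t *\<^sub>R H + (t\<^sup>2 / 2) *\<^sub>R 0) $ i - eigvals X $ i) / t) \<longlongrightarrow> l) (at_right 0)"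
    proof (rule eigval_quotient_tendsto[where a = "\<lambda>_. eigvals X $ i" and b = "\<lambda>t. t" and M = "L * norm H"])
      fix t :: real assume t: "0 < t" "t < 1"
      have "\<bar>(eigvals (X + t *\<^sub>R H) - eigvals X) $ i\<bar> \<le> norm (eigvals (X + t *\<^sub>R H) - eigvals X)"
        by (rule component_le_norm_cart)
      also have "\<dots> \<le> L * norm (X + t *\<^sub>R H - X)"
        unfolding L_def by (intro eigvals_lipschitz symmetric_mat_intros sym)
      finally have "\<bar>eigvals (X + t *\<^sub>R H) $ i - eigvals X $ i\<bar> \<le> L * norm H * t"
        using t by (simp add: mult_ac)
      then show "\<bar>(eigvals (X + t *\<^sub>R H + (t\<^sup>2 / 2) *\<^sub>R 0) $ i - eigvals X $ i) / t\<bar> \<le> L * norm H"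
        using t by (simp add: divide_le_eq)
    qed (use sym in \<open>auto intro!: symmetric_mat_0 real_polynomial_function_intros\<close>)
    then show ?thesis by simp
  qed
  have "\<exists>l. ((\<lambda>t. (1 / t) *\<^sub>R (eigvals (X + t *\<^sub>R H) - eigvals X)) \<longlongrightarrow> l) (at_right 0)"
    by (rule tendsto_vec_exists) (rule ex)
  then obtain l where
    l: "((\<lambda>t. (1 / t) *\<^sub>R (eigvals (X + t *\<^sub>R H) - eigvals X)) \<longlongrightarrow> l) (at_right 0)" ..
  then have "eig_dir1 X H = l"
    unfolding eig_dir1_def by (rule tendsto_Lim[rotated]) simp
  with l show ?thesis by simp
qed

text \<open>In an eigenbasis of \<open>X\<close>, a residual of size \<open>r\<close> bounds the
  coefficient of \<open>u\<close> at an eigenvector of another eigenvalue by \<open>r\<close> over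
  the gap, and the error of the Rayleigh quotient contains the squares of these coefficients. The
  constant collects reciprocal gaps over all pairs, so that it serves every
  \<open>i\<close>.\<close>

lemma rayleigh_quotient_second_order:
  fixes X :: "'n::{finite,linorder} sqmat"
  assumes X: "symmetric_mat X"
  obtains M where "0 \<le> M"
    "\<And>i u r. norm u = 1 \<Longrightarrow> norm (X *v u - eigvals X $ i *\<^sub>R u) \<le> r \<Longrightarrow>
      \<bar>u \<bullet> (X *v u) - eigvals X $ i\<bar> \<le> M * r\<^sup>2"
proof -
  obtain q where q: "orthonormal_frame q" and Xq: "X = spec_mat q (eigvals X)"
    using symmetric_mat_eigvals[OF X] .
  define x where "x = eigvals X"
  \<comment> \<open>terms with \<open>x $ j = x $ i\<close> are harmless junk: \<open>1 / 0 = 0\<close>\<close>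
  define M where "M = (\<Sum>i\<in>UNIV. \<Sum>j\<in>UNIV. 1 / \<bar>x $ j - x $ i\<bar>)"
  have "0 \<le> M"
    unfolding M_def by (intro sum_nonneg) auto
  moreover have "\<bar>u \<bullet> (X *v u) - x $ i\<bar> \<le> M * r\<^sup>2"
    if u: "norm u = 1" and r: "norm (X *v u - x $ i *\<^sub>R u) \<le> r" for i u r
  proof -
    have each: "\<bar>(x $ j - x $ i) * (u \<bullet> q j)\<^sup>2\<bar> \<le> r\<^sup>2 * (1 / \<bar>x $ j - x $ i\<bar>)" for j
    proof (cases "x $ j = x $ i")
      case False
      have "q j \<bullet> (X *v u) = x $ j * (u \<bullet> q j)"
        using symmetric_mat_inner[OF X, of "q j" u] spec_mat_eigen[OF q, of x j] Xq
        by (simp add: x_def inner_commute)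
      then have "\<bar>(x $ j - x $ i) * (u \<bullet> q j)\<bar> = \<bar>q j \<bullet> (X *v u - x $ i *\<^sub>R u)\<bar>"
        by (simp add: inner_diff_right algebra_simps inner_commute)
      also have "\<dots> \<le> r"
        using Cauchy_Schwarz_ineq2[of "q j" "X *v u - x $ i *\<^sub>R u"] r
        by (simp add: orthonormal_frame_norm[OF q])
      finally have "\<bar>(x $ j - x $ i) * (u \<bullet> q j)\<bar>\<^sup>2 \<le> r\<^sup>2"
        by (rule power_mono) simp
      moreover have "\<bar>(x $ j - x $ i) * (u \<bullet> q j)\<bar>\<^sup>2
          = \<bar>(x $ j - x $ i) * (u \<bullet> q j)\<^sup>2\<bar> * \<bar>x $ j - x $ i\<bar>"
        by (simp add: abs_mult power2_eq_square mult_ac)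
      ultimately show ?thesis
        using False by (simp add: field_simps)
    qed simp
    have "u \<bullet> (X *v u) = (\<Sum>j\<in>UNIV. x $ j * (u \<bullet> q j)\<^sup>2)"
      by (subst Xq) (simp add: spec_mat_quadratic_form x_def)
    moreover have "(\<Sum>j\<in>UNIV. (u \<bullet> q j)\<^sup>2) = 1"
      using orthonormal_frame_parseval[OF q, of u u] u by (simp add: power2_eq_square norm_eq_1)
    ultimately have "u \<bullet> (X *v u) - x $ i = (\<Sum>j\<in>UNIV. (x $ j - x $ i) * (u \<bullet> q j)\<^sup>2)"
      by (simp add: left_diff_distrib sum_subtractf sum_distrib_left[symmetric])
    also have "\<bar>\<dots>\<bar> \<le> (\<Sum>j\<in>UNIV. r\<^sup>2 * (1 / \<bar>x $ j - x $ i\<bar>))"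
      by (rule order_trans[OF sum_abs]) (intro sum_mono each)
    also have "\<dots> = r\<^sup>2 * (\<Sum>j\<in>UNIV. 1 / \<bar>x $ j - x $ i\<bar>)"
      by (simp add: sum_distrib_left)
    also have "\<dots> \<le> r\<^sup>2 * M"
      unfolding M_def by (intro mult_left_mono member_le_sum[where f = "\<lambda>i. \<Sum>j\<in>UNIV. 1 / \<bar>x $ j - x $ i\<bar>"])
        (auto intro: sum_nonneg)
    finally show ?thesis by (simp add: mult.commute)
  qed
  ultimately show ?thesis
    using that unfolding x_def by blast
qed

text \<open>Each halving loses at most \<open>c\<close> times the current argument, and
  \<open>t + t / 2 + t / 4 + ...\<close> sums to \<open>2 * t\<close>.\<close>

lemma quotient_limit_bound_if_halving:
  fixes \<phi> :: "real \<Rightarrow> real"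
  assumes lim: "(\<phi> \<longlongrightarrow> l) (at_right 0)"
    and half: "\<And>t. 0 < t \<Longrightarrow> \<phi> t - c * t \<le> \<phi> (t / 2)" and t: "0 < t" and c: "0 \<le> c"
  shows "\<phi> t \<le> l + 2 * c * t"
proof -
  \<comment> \<open>The term \<open>2 * c * (t / 2 ^ k)\<close> is the part of the total loss not
    yet spent; carrying it along makes the induction close.\<close>
  have step: "\<phi> t - 2 * c * t + 2 * c * (t / 2 ^ k) \<le> \<phi> (t / 2 ^ k)" for k
  proof (induction k)
    case (Suc k)
    define a where "a = c * (t / 2 ^ k)"
    have "\<phi> (t / 2 ^ k) - a \<le> \<phi> (t / 2 ^ k / 2)"
      unfolding a_def using t by (intro half) simp
    then have "\<phi> (t / 2 ^ k) - a \<le> \<phi> (t / 2 ^ Suc k)" by (simp add: mult.commute)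
    moreover have "\<phi> t - 2 * c * t + 2 * a \<le> \<phi> (t / 2 ^ k)"
      using Suc by (simp add: a_def mult.assoc)
    ultimately have "\<phi> t - 2 * c * t + a \<le> \<phi> (t / 2 ^ Suc k)"
      by linarith
    moreover have "2 * c * (t / 2 ^ Suc k) = a"
      by (simp add: a_def)
    ultimately show ?case by (simp only:)
  qed simp
  have "(\<lambda>k. t / 2 ^ k) \<longlonglongrightarrow> 0"
    using LIMSEQ_divide_realpow_zero[of 2 t] by simp
  then have "filterlim (\<lambda>k. t / 2 ^ k) (at_right 0) sequentially"
    using t by (auto simp: filterlim_at)
  then have "(\<lambda>k. \<phi> (t / 2 ^ k)) \<longlonglongrightarrow> l"
    by (rule filterlim_compose[OF lim])
  moreover have "\<phi> t - 2 * c * t \<le> \<phi> (t / 2 ^ k)" for k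
  proof -
    have "0 \<le> 2 * c * (t / 2 ^ k)" using c t by simp
    then show ?thesis using step[of k] by linarith
  qed
  ultimately have "\<phi> t - 2 * c * t \<le> l"
    by (intro LIMSEQ_le_const) auto
  then show ?thesis by simp
qed

text \<open>For sums over initial segments, the quotient \<open>\<phi>\<close> is monotone by
  convexity and therefore lies above its limit; the halving argument bounds it above by the limit
  plus a multiple of \<open>t\<close>. Multiplying by \<open>t\<close> gives the quadratic
  error.\<close>

lemma eigvals_second_order_bound:
  fixes X H :: "'n::{finite,linorder} sqmat"
  assumes X: "symmetric_mat X" and H: "symmetric_mat H"
  obtains C where "0 \<le> C"
    "\<And>t i. 0 < t \<Longrightarrow> \<bar>eigvals (X + t *\<^sub>R H) $ i - eigvals X $ i - t * eig_dir1 X H $ i\<bar> \<le> C * t\<^sup>2"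
proof -
  define A where "A t = X + t *\<^sub>R H" for t :: real
  define x where "x = eigvals X"
  define L where "L = 2 * (real CARD('n))\<^sup>2"
  have symA: "symmetric_mat (A t)" for t
    unfolding A_def by (intro symmetric_mat_intros X H)
  obtain M where M: "0 \<le> M"
    "\<And>i u r. norm u = 1 \<Longrightarrow> norm (X *v u - x $ i *\<^sub>R u) \<le> r \<Longrightarrow> \<bar>u \<bullet> (X *v u) - x $ i\<bar> \<le> M * r\<^sup>2"
    using rayleigh_quotient_second_order[OF X] unfolding x_def by metis
  \<comment> \<open>An eigenvector of \<open>A t\<close> has residual at most
    \<open>(L + 1) * norm H * t\<close> for \<open>X\<close>: the summand with \<open>L\<close>
    accounts for the displacement of the eigenvalue, the other one for the matrix
    perturbation.\<close>
  define K where "K = M * ((L + 1) * norm H)\<^sup>2"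
  have K: "0 \<le> K" using M(1) by (simp add: K_def)
  have Amult: "A s *v v = X *v v + s *\<^sub>R (H *v v)" for s v
    by (simp add: A_def matrix_vector_mult_add_rdistrib scaleR_matrix_vector_assoc[symmetric])
  have eig: "A t *v u i = eigvals (A t) $ i *\<^sub>R u i"
    if "orthonormal_frame u" "A t = spec_mat u (eigvals (A t))" for u t i
    using spec_mat_eigen[OF that(1), of "eigvals (A t)" i] that(2) by simp
  have rayleigh: "\<bar>u i \<bullet> (X *v u i) - x $ i\<bar> \<le> K * t\<^sup>2"
    if t: "0 < t" and u: "orthonormal_frame u" "A t = spec_mat u (eigvals (A t))" for u t i
  proof -
    have "X *v u i - x $ i *\<^sub>R u i = (eigvals (A t) $ i - x $ i) *\<^sub>R u i - t *\<^sub>R (H *v u i)"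
      using eig[OF u, of i] unfolding Amult by (simp add: algebra_simps)
    also have "norm \<dots> \<le> norm ((eigvals (A t) $ i - x $ i) *\<^sub>R u i) + norm (t *\<^sub>R (H *v u i))"
      by (rule norm_triangle_ineq4)
    also have "\<dots> \<le> L * (t * norm H) + t * norm H"
    proof (rule add_mono)
      have "\<bar>(eigvals (A t) - x) $ i\<bar> \<le> norm (eigvals (A t) - x)"
        by (rule component_le_norm_cart)
      also have "\<dots> \<le> L * norm (A t - X)"
        unfolding L_def x_def by (intro eigvals_lipschitz symA X)
      finally show "norm ((eigvals (A t) $ i - x $ i) *\<^sub>R u i) \<le> L * (t * norm H)"
        using t by (simp add: orthonormal_frame_norm[OF u(1)] A_def)
      show "norm (t *\<^sub>R (H *v u i)) \<le> t * norm H"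
        using t norm_matrix_vector_mult_le[of H "u i"] by (simp add: orthonormal_frame_norm[OF u(1)])
    qed
    finally have "norm (X *v u i - x $ i *\<^sub>R u i) \<le> (L + 1) * norm H * t"
      by (simp add: algebra_simps)
    from M(2)[OF orthonormal_frame_norm[OF u(1)] this] show ?thesis
      by (simp add: K_def power_mult_distrib mult_ac)
  qed
  define S where "S I t = (\<Sum>i\<in>I. eigvals (A t) $ i)" for I t
  define s where "s I = (\<Sum>i\<in>I. eig_dir1 X H $ i)" for I
  define \<phi> where "\<phi> I t = (S I t - (\<Sum>i\<in>I. x $ i)) / t" for I t
  define c where "c = real CARD('n) * K"
  have c: "0 \<le> c" using K by (simp add: c_def)
  have lim: "(\<phi> I \<longlongrightarrow> s I) (at_right 0)" for I
  proof -
    have "((\<lambda>t. \<Sum>i\<in>I. ((1 / t) *\<^sub>R (eigvals (A t) - x)) $ i) \<longlongrightarrow> s I) (at_right 0)"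
      unfolding s_def A_def x_def by (intro tendsto_intros eig_dir1_tendsto X H)
    moreover have "(\<lambda>t. \<Sum>i\<in>I. ((1 / t) *\<^sub>R (eigvals (A t) - x)) $ i) = \<phi> I"
      by (auto simp: fun_eq_iff \<phi>_def S_def sum_subtractf sum_divide_distrib[symmetric])
    ultimately show ?thesis by simp
  qed
  \<comment> \<open>\<open>A (t / 2)\<close> is the midpoint of \<open>X\<close> and
    \<open>A t\<close>. Testing it with the eigenvectors of \<open>A t\<close> gives half of the
    eigenvalues of \<open>A t\<close> plus half of a Rayleigh quotient of \<open>X\<close> that is
    accurate up to \<open>K * t\<^sup>2\<close>.\<close>
  have half: "\<phi> I t - c * t \<le> \<phi> I (t / 2)" if I: "initial_segment I" and t: "0 < t" for I t
  proof -
    obtain u where u: "orthonormal_frame u" "A t = spec_mat u (eigvals (A t))"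
      using symmetric_mat_eigvals[OF symA] .
    have "(x $ i - K * t\<^sup>2) / 2 + eigvals (A t) $ i / 2 \<le> u i \<bullet> (A (t / 2) *v u i)" for i
    proof -
      have "u i \<bullet> (A t *v u i) = eigvals (A t) $ i"
        by (simp add: eig[OF u] orthonormal_frame_inner[OF u(1)])
      then have "u i \<bullet> (X *v u i) + t * (u i \<bullet> (H *v u i)) = eigvals (A t) $ i"
        by (simp add: Amult inner_add_right)
      moreover have "u i \<bullet> (A (t / 2) *v u i) = u i \<bullet> (X *v u i) + t / 2 * (u i \<bullet> (H *v u i))"
        by (simp add: Amult inner_add_right)
      ultimately show ?thesis
        using rayleigh[OF t u, of i] by (simp add: field_simps abs_le_iff)
    qed
    then have "(\<Sum>i\<in>I. (x $ i - K * t\<^sup>2) / 2 + eigvals (A t) $ i / 2)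
        \<le> (\<Sum>i\<in>I. u i \<bullet> (A (t / 2) *v u i))"
      by (intro sum_mono)
    also have "\<dots> \<le> S I (t / 2)"
      unfolding S_def by (rule ky_fan[OF symA u(1) I])
    finally have "(\<Sum>i\<in>I. x $ i) / 2 - card I * (K * t\<^sup>2) / 2 + S I t / 2 \<le> S I (t / 2)"
      by (simp add: sum.distrib sum_subtractf sum_divide_distrib[symmetric] S_def diff_divide_distrib)
    moreover have "card I * (K * t\<^sup>2) \<le> c * t\<^sup>2"
    proof -
      have "card I \<le> CARD('n)" by (rule card_mono) auto
      then show ?thesis
        unfolding c_def using K by (simp add: mult.assoc mult_right_mono)
    qed
    moreover have "s - a - k' \<le> 2 * (s' - a)"
      if "a / 2 - k / 2 + s / 2 \<le> s'" "k \<le> k'" for a k k' s s' :: real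
      using that by argo
    ultimately have "S I t - (\<Sum>i\<in>I. x $ i) - c * t\<^sup>2 \<le> 2 * (S I (t / 2) - (\<Sum>i\<in>I. x $ i))"
      by blast
    then have "(S I t - (\<Sum>i\<in>I. x $ i) - c * t\<^sup>2) / t \<le> 2 * (S I (t / 2) - (\<Sum>i\<in>I. x $ i)) / t"
      using t by (intro divide_right_mono) auto
    moreover have "c * t\<^sup>2 / t = c * t"
      using t by (simp add: power2_eq_square)
    ultimately show ?thesis
      by (simp add: \<phi>_def diff_divide_distrib mult.commute)
  qed
  \<comment> \<open>\<open>A r\<close> is a convex combination of \<open>X\<close> and
    \<open>A t\<close>. Its eigenvectors are trial vectors for both matrices at once, which is
    convexity of the segment sums along the line.\<close>
  have mono: "\<phi> I r \<le> \<phi> I t" if I: "initial_segment I" and r: "0 < r" "r < t" for I r t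
  proof -
    obtain u where u: "orthonormal_frame u" "A r = spec_mat u (eigvals (A r))"
      using symmetric_mat_eigvals[OF symA] .
    have "eigvals (A r) $ i = (1 - r / t) * (u i \<bullet> (X *v u i)) + r / t * (u i \<bullet> (A t *v u i))" for i
    proof -
      have "u i \<bullet> (A r *v u i) = eigvals (A r) $ i"
        by (simp add: eig[OF u] orthonormal_frame_inner[OF u(1)])
      moreover have "(1 - r / t) * a + r / t * (a + t * h) = a + r * h" for a h
        using r by (simp add: left_diff_distrib distrib_left)
      ultimately show ?thesis
        by (simp add: Amult inner_add_right)
    qed
    then have "S I r = (1 - r / t) * (\<Sum>i\<in>I. u i \<bullet> (X *v u i)) + r / t * (\<Sum>i\<in>I. u i \<bullet> (A t *v u i))"
      by (simp add: S_def sum.distrib sum_distrib_left)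
    also have "\<dots> \<le> (1 - r / t) * (\<Sum>i\<in>I. x $ i) + r / t * S I t"
      unfolding S_def x_def using r
      by (intro add_mono mult_left_mono ky_fan[OF X u(1) I] ky_fan[OF symA u(1) I]) auto
    finally have "S I r - (\<Sum>i\<in>I. x $ i) \<le> r / t * (S I t - (\<Sum>i\<in>I. x $ i))"
      by (simp add: algebra_simps)
    then show ?thesis
      using r by (simp add: \<phi>_def field_simps)
  qed
  have seg: "\<bar>S I t - (\<Sum>i\<in>I. x $ i) - t * s I\<bar> \<le> 2 * c * t\<^sup>2"
    if I: "initial_segment I" and t: "0 < t" for I t
  proof -
    have "\<phi> I t \<le> s I + 2 * c * t"
      by (rule quotient_limit_bound_if_halving[OF lim half[OF I] t c])
    moreover have "s I \<le> \<phi> I t"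
    proof (rule tendsto_upperbound[OF lim])
      show "\<forall>\<^sub>F r in at_right 0. \<phi> I r \<le> \<phi> I t"
        using mono[OF I] t by (auto simp: eventually_at_right_field)
    qed simp
    ultimately have "0 \<le> t * (\<phi> I t - s I)" "t * (\<phi> I t - s I) \<le> t * (2 * c * t)"
      using t by (auto intro!: mult_left_mono)
    moreover have "t * \<phi> I t = S I t - (\<Sum>i\<in>I. x $ i)"
      using t by (simp add: \<phi>_def)
    ultimately show ?thesis
      by (simp add: right_diff_distrib power2_eq_square mult_ac)
  qed
  \<comment> \<open>The constant doubles to \<open>4 * c\<close>, since one component is the
    difference of two segment sums.\<close>
  have "\<bar>eigvals (A t) $ i - x $ i - t * eig_dir1 X H $ i\<bar> \<le> 4 * c * t\<^sup>2" if t: "0 < t" for t i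
  proof -
    have "eigvals (A t) $ i - x $ i - t * eig_dir1 X H $ i
        = (S {..i} t - (\<Sum>i\<in>{..i}. x $ i) - t * s {..i})
          - (S {..<i} t - (\<Sum>i\<in>{..<i}. x $ i) - t * s {..<i})"
      unfolding S_def s_def component_eq_sum_diff[of "vec_nth (eigvals (A t))" i]
        component_eq_sum_diff[of "vec_nth x" i] component_eq_sum_diff[of "vec_nth (eig_dir1 X H)" i]
      by (simp add: right_diff_distrib)
    then show ?thesis
      using seg[OF initial_segment_atMost t, of i] seg[OF initial_segment_lessThan t, of i]
      by linarith
  qed
  then show ?thesis
    using that[of "4 * c"] c unfolding A_def x_def by simp
qed

text \<open>The bound \<open>2 * C + L * norm W\<close> has two sources: the second order error
  along the line, measured in units of \<open>t\<^sup>2 / 2\<close>, and the Lipschitz effect of the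
  quadratic term.\<close>

lemma eig_dir2_tendsto:
  fixes X H W :: "'n::{finite,linorder} sqmat"
  assumes sym: "symmetric_mat X" "symmetric_mat H" "symmetric_mat W"
  shows "((\<lambda>t. (1 / (t\<^sup>2 / 2)) *\<^sub>R (eigvals (X + t *\<^sub>R H + (t\<^sup>2 / 2) *\<^sub>R W) - eigvals X - t *\<^sub>R eig_dir1 X H))
    \<longlongrightarrow> eig_dir2 X H W) (at_right 0)"
proof -
  define L where "L = 2 * (real CARD('n))\<^sup>2"
  define l1 where "l1 = eig_dir1 X H"
  obtain C where C: "0 \<le> C"
    "\<And>t i. 0 < t \<Longrightarrow> \<bar>eigvals (X + t *\<^sub>R H) $ i - eigvals X $ i - t * l1 $ i\<bar> \<le> C * t\<^sup>2"
    using eigvals_second_order_bound[OF sym(1,2)] unfolding l1_def by metis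
  have ex: "\<exists>l. ((\<lambda>t. ((1 / (t\<^sup>2 / 2)) *\<^sub>R (eigvals (X + t *\<^sub>R H + (t\<^sup>2 / 2) *\<^sub>R W) - eigvals X - t *\<^sub>R l1)) $ i) \<longlongrightarrow> l)
      (at_right 0)" for i
  proof -
    have "\<exists>l. ((\<lambda>t. (eigvals (X + t *\<^sub>R H + (t\<^sup>2 / 2) *\<^sub>R W) $ i - (eigvals X $ i + t * l1 $ i)) / (t\<^sup>2 / 2))
        \<longlongrightarrow> l) (at_right 0)"
    proof (rule eigval_quotient_tendsto[where a = "\<lambda>t. eigvals X $ i + t * l1 $ i"
          and b = "\<lambda>t. t\<^sup>2 / 2" and M = "2 * C + L * norm W"])
      fix t :: real assume t: "0 < t" "t < 1"
      let ?B = "X + t *\<^sub>R H" and ?D = "X + t *\<^sub>R H + (t\<^sup>2 / 2) *\<^sub>R W"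
      have "\<bar>(eigvals ?D - eigvals ?B) $ i\<bar> \<le> norm (eigvals ?D - eigvals ?B)"
        by (rule component_le_norm_cart)
      also have "\<dots> \<le> L * norm (?D - ?B)"
        unfolding L_def by (intro eigvals_lipschitz symmetric_mat_intros sym)
      finally have "\<bar>eigvals ?D $ i - eigvals ?B $ i\<bar> \<le> L * norm W * (t\<^sup>2 / 2)"
        by (simp add: mult_ac)
      with C(2)[OF t(1), of i]
      have "\<bar>eigvals ?D $ i - (eigvals X $ i + t * l1 $ i)\<bar> \<le> C * t\<^sup>2 + L * norm W * (t\<^sup>2 / 2)"
        by linarith
      also have "\<dots> = (2 * C + L * norm W) * (t\<^sup>2 / 2)"
        by (simp add: algebra_simps)
      finally have "\<bar>eigvals ?D $ i - (eigvals X $ i + t * l1 $ i)\<bar> \<le> (2 * C + L * norm W) * (t\<^sup>2 / 2)" .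
      then show "\<bar>(eigvals ?D $ i - (eigvals X $ i + t * l1 $ i)) / (t\<^sup>2 / 2)\<bar> \<le> 2 * C + L * norm W"
        using t unfolding abs_divide[of _ "t\<^sup>2 / 2"] by (subst abs_of_pos[of "t\<^sup>2 / 2"], simp)
          (subst pos_divide_le_eq, simp_all)
    qed (use sym in \<open>auto intro!: real_polynomial_function_intros\<close>)
    moreover have "((1 / (t\<^sup>2 / 2)) *\<^sub>R (eigvals (X + t *\<^sub>R H + (t\<^sup>2 / 2) *\<^sub>R W) - eigvals X - t *\<^sub>R l1)) $ i
        = (eigvals (X + t *\<^sub>R H + (t\<^sup>2 / 2) *\<^sub>R W) $ i - (eigvals X $ i + t * l1 $ i)) / (t\<^sup>2 / 2)" for t
      by (simp only: vector_scaleR_component vector_minus_component vector_add_component real_scaleR_def diff_diff_eq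
          times_divide_eq_left mult_1)
    ultimately show ?thesis by (simp only:)
  qed
  have "\<exists>l. ((\<lambda>t. (1 / (t\<^sup>2 / 2)) *\<^sub>R
      (eigvals (X + t *\<^sub>R H + (t\<^sup>2 / 2) *\<^sub>R W) - eigvals X - t *\<^sub>R l1)) \<longlongrightarrow> l) (at_right 0)"
    by (rule tendsto_vec_exists) (rule ex)
  then obtain l where l: "((\<lambda>t. (1 / (t\<^sup>2 / 2)) *\<^sub>R
      (eigvals (X + t *\<^sub>R H + (t\<^sup>2 / 2) *\<^sub>R W) - eigvals X - t *\<^sub>R l1)) \<longlongrightarrow> l) (at_right 0)" ..
  then have "eig_dir2 X H W = l"
    unfolding eig_dir2_def l1_def by (rule tendsto_Lim[rotated]) simp
  with l show ?thesis by (simp add: l1_def)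
qed

section \<open>Transfer of lower limits along the eigenvalue map\<close>

text \<open>Reparametrisation can only raise a lower limit; two reparametrisations in opposite
  directions therefore give an equality.\<close>

lemma Liminf_le_compose:
  fixes g :: "'b \<Rightarrow> 'c::complete_linorder"
  assumes "filterlim \<phi> G F"
  shows "Liminf G g \<le> Liminf F (\<lambda>x. g (\<phi> x))"
  unfolding le_Liminf_iff
proof (intro allI impI)
  fix y assume "y < Liminf G g"
  then have "\<forall>\<^sub>F x in G. y < g x"
    by (rule less_LiminfD)
  then show "\<forall>\<^sub>F x in F. y < g (\<phi> x)"
    by (rule eventually_compose_filterlim[OF _ assms])
qed

lemma filterlim_fst': "filterlim fst F (F \<times>\<^sub>F G)"
  and filterlim_snd': "filterlim snd G (F \<times>\<^sub>F G)"
  unfolding filterlim_iff eventually_prod_filter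
  by (auto intro: exI[of _ "\<lambda>_. True"] eventually_True)

lemma eventually_fst_pos: "\<forall>\<^sub>F p in at_right (0::real) \<times>\<^sub>F G. 0 < fst p"
  by (rule eventually_compose_filterlim[OF eventually_at_right_less filterlim_fst'])

lemma filterlim_Pair_at_right:
  assumes "\<And>k. 0 < t k" "t \<longlonglongrightarrow> (0::real)" "zs \<longlonglongrightarrow> z"
  shows "filterlim (\<lambda>k. (t k, zs k)) (at_right 0 \<times>\<^sub>F nhds z) sequentially"
  using assms by (intro filterlim_Pair) (auto simp: filterlim_at less_imp_neq[symmetric])

lemma Liminf_le_lim_sequence:
  fixes g :: "real \<Rightarrow> 'a::topological_space \<Rightarrow> ereal"
  assumes "\<And>k. 0 < t k" "t \<longlonglongrightarrow> 0" "zs \<longlonglongrightarrow> z" and "\<forall>\<^sub>F k in sequentially. g (t k) (zs k) \<le> c"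
  shows "Liminf (at_right 0 \<times>\<^sub>F nhds z) (\<lambda>(t, z). g t z) \<le> c"
proof -
  have "Liminf (at_right 0 \<times>\<^sub>F nhds z) (\<lambda>(t, z). g t z) \<le> Liminf sequentially (\<lambda>k. g (t k) (zs k))"
    using Liminf_le_compose[OF filterlim_Pair_at_right[OF assms(1-3)], of "\<lambda>(t, z). g t z"] by simp
  also have "\<dots> \<le> c"
    by (rule Liminf_le[OF _ assms(4)]) simp
  finally show ?thesis .
qed

lemma Liminf_less_sequence:
  fixes g :: "real \<Rightarrow> 'a::metric_space \<Rightarrow> ereal"
  assumes "Liminf (at_right 0 \<times>\<^sub>F nhds z) (\<lambda>(t, z). g t z) < c"
  obtains t zs where "\<And>k. 0 < t k" "t \<longlonglongrightarrow> 0" "zs \<longlonglongrightarrow> z" "\<And>k. g (t k) (zs k) < c"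
proof -
  have "\<exists>s w. 0 < s \<and> s < r \<and> dist w z < r \<and> g s w < c" if r: "0 < r" for r :: real
  proof (rule ccontr)
    assume neg: "\<not> ?thesis"
    have "\<forall>\<^sub>F s in at_right (0::real). 0 < s \<and> s < r"
      using r by (auto simp: eventually_at_right_field)
    moreover have "\<forall>\<^sub>F w in nhds z. dist w z < r"
      using r by (auto simp: eventually_nhds_metric)
    ultimately have "\<forall>\<^sub>F p in at_right 0 \<times>\<^sub>F nhds z. (0 < fst p \<and> fst p < r) \<and> dist (snd p) z < r"
      by (rule eventually_prodI)
    then have "\<forall>\<^sub>F p in at_right 0 \<times>\<^sub>F nhds z. c \<le> (case p of (t, z) \<Rightarrow> g t z)"
    proof eventually_elim
      case (elim p)
      then show ?case
        using neg by (cases p) (metis case_prod_conv fst_conv not_less snd_conv)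
    qed
    then have "c \<le> Liminf (at_right 0 \<times>\<^sub>F nhds z) (\<lambda>(t, z). g t z)"
      by (rule Liminf_bounded)
    with assms show False by simp
  qed
  then have "\<forall>k. \<exists>s w. 0 < s \<and> s < 1 / real (Suc k) \<and> dist w z < 1 / real (Suc k) \<and> g s w < c"
    by simp
  then obtain t zs where *: "\<And>k. 0 < t k" "\<And>k. t k < 1 / real (Suc k)"
      "\<And>k. dist (zs k) z < 1 / real (Suc k)" "\<And>k. g (t k) (zs k) < c"
    by metis
  have lim: "(\<lambda>k. 1 / real (Suc k)) \<longlonglongrightarrow> 0"
    using LIMSEQ_inverse_real_of_nat by (simp add: inverse_eq_divide)
  have "\<forall>k. 0 \<le> t k" "\<forall>k. t k \<le> 1 / real (Suc k)" "\<forall>k. dist (zs k) z \<le> 1 / real (Suc k)"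
    using * less_imp_le by blast+
  note le = this[THEN always_eventually]
  have "t \<longlonglongrightarrow> 0"
    by (rule tendsto_sandwich[OF le(1,2) tendsto_const lim])
  moreover have "(\<lambda>k. dist (zs k) z) \<longlonglongrightarrow> 0"
    by (rule tendsto_sandwich[OF _ le(3) tendsto_const lim]) simp
  then have "zs \<longlonglongrightarrow> z"
    by (rule tendsto_dist_iff[THEN iffD2])
  ultimately show ?thesis
    using that * by blast
qed

section \<open>Matching matrix perturbations with eigenvalue perturbations\<close>

lemma spectral_fun_eq: "symmetric_mat A \<Longrightarrow> spectral_fun \<theta> A = \<theta> (eigvals A)"
  and spectral_fun_infinity: "\<not> symmetric_mat A \<Longrightarrow> spectral_fun \<theta> A = \<infinity>"
  by (simp_all add: spectral_fun_def)

text \<open>Covers first and second order expansions at once: \<open>B t + s t *\<^sub>R W\<close> stands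
  for \<open>X + t *\<^sub>R H\<close> or \<open>X + t *\<^sub>R H + (t\<^sup>2 / 2) *\<^sub>R W\<close>, and \<open>b t + s t *\<^sub>R z\<close> for the corresponding
  expansion of the eigenvalues. Moving the eigenvalues inside an eigenbasis of \<open>B t + s t *\<^sub>R W\<close>
  realises every perturbation of \<open>z\<close> by a perturbation of \<open>W\<close> of comparable size.\<close>

lemma spectral_lift:
  fixes B :: "real \<Rightarrow> 'n::{finite,linorder} sqmat"
  assumes B: "\<And>t. symmetric_mat (B t)" and W: "symmetric_mat W" and s: "\<forall>t>0. 0 < s t"
    and lim: "((\<lambda>t. (1 / s t) *\<^sub>R (eigvals (B t + s t *\<^sub>R W) - b t)) \<longlongrightarrow> l) (at_right 0)"
  shows "\<exists>\<omega>. (\<forall>\<theta> t z. symmetric_fun \<theta> \<longrightarrow> 0 < t \<longrightarrow>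
      spectral_fun \<theta> (B t + s t *\<^sub>R \<omega> t z) = \<theta> (b t + s t *\<^sub>R z)) \<and>
    (\<forall>t z. 0 < t \<longrightarrow> norm (\<omega> t z - W)
      \<le> real CARD('n) ^ 3 * norm (z - (1 / s t) *\<^sub>R (eigvals (B t + s t *\<^sub>R W) - b t))) \<and>
    filterlim (\<lambda>(t, z). (t, \<omega> t z)) (at_right 0 \<times>\<^sub>F nhds W) (at_right 0 \<times>\<^sub>F nhds l)"
proof -
  define Y where "Y t = B t + s t *\<^sub>R W" for t
  have Y: "symmetric_mat (Y t)" for t
    unfolding Y_def by (intro symmetric_mat_intros B W)
  then have "\<forall>t. \<exists>u. orthonormal_frame u \<and> Y t = spec_mat u (eigvals (Y t))"
    by (metis symmetric_mat_eigvals)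
  then obtain u where u: "\<And>t. orthonormal_frame (u t)" "\<And>t. Y t = spec_mat (u t) (eigvals (Y t))"
    by metis
  define \<psi> where "\<psi> t = (1 / s t) *\<^sub>R (eigvals (Y t) - b t)" for t
  \<comment> \<open>\<open>\<psi> t\<close> is the normalised displacement that the eigenvalues of
    \<open>Y t\<close> already have; adding the missing part \<open>z - \<psi> t\<close> in the
    eigenbasis places the eigenvalues exactly at \<open>b t + s t *\<^sub>R z\<close>, up to
    order.\<close>
  define \<omega> where "\<omega> t z = W + spec_mat (u t) (z - \<psi> t)" for t z
  have 2: "spectral_fun \<theta> (B t + s t *\<^sub>R \<omega> t z) = \<theta> (b t + s t *\<^sub>R z)"
    if "symmetric_fun \<theta>" "0 < t" for \<theta> t z
  proof -
    have "B t + s t *\<^sub>R \<omega> t z = Y t + spec_mat (u t) (s t *\<^sub>R (z - \<psi> t))"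
      by (simp add: \<omega>_def Y_def spec_mat_scaleR scaleR_add_right)
    also have "\<dots> = spec_mat (u t) (eigvals (Y t) + s t *\<^sub>R (z - \<psi> t))"
      using u(2)[of t] by (simp add: spec_mat_add)
    also have "eigvals (Y t) + s t *\<^sub>R (z - \<psi> t) = b t + s t *\<^sub>R z"
      using s[rule_format, OF that(2)] by (simp add: \<psi>_def scaleR_diff_right)
    finally show ?thesis
      by (simp add: spectral_fun_spec_mat[OF that(1) u(1)])
  qed
  \<comment> \<open>The bound holds for every \<open>z\<close>, however far from \<open>l\<close>.
    Compactness later needs it for sequences with a different limit.\<close>
  have 3: "norm (\<omega> t z - W) \<le> real CARD('n) ^ 3 * norm (z - \<psi> t)" for t z
    by (simp add: \<omega>_def norm_spec_mat_le[OF u(1)])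
  let ?F = "at_right (0::real) \<times>\<^sub>F nhds l"
  have "((\<lambda>p. \<omega> (fst p) (snd p) - W) \<longlongrightarrow> 0) ?F"
  proof (rule Lim_null_comparison)
    show "\<forall>\<^sub>F p in ?F. norm (\<omega> (fst p) (snd p) - W) \<le> real CARD('n) ^ 3 * norm (snd p - \<psi> (fst p))"
      by (intro always_eventually allI 3)
    have "((\<lambda>p. \<psi> (fst p)) \<longlongrightarrow> l) ?F"
      using lim unfolding \<psi>_def Y_def by (rule filterlim_compose[OF _ filterlim_fst'])
    then have "((\<lambda>p. real CARD('n) ^ 3 * norm (snd p - \<psi> (fst p))) \<longlongrightarrow> real CARD('n) ^ 3 * norm (l - l)) ?F"
      by (intro tendsto_intros filterlim_snd')
    then show "((\<lambda>p. real CARD('n) ^ 3 * norm (snd p - \<psi> (fst p))) \<longlongrightarrow> 0) ?F"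
      by simp
  qed
  then have "((\<lambda>p. \<omega> (fst p) (snd p)) \<longlongrightarrow> W) ?F"
    by (rule LIM_zero_cancel)
  then have "filterlim (\<lambda>(t, z). (t, \<omega> t z)) (at_right 0 \<times>\<^sub>F nhds W) ?F"
    unfolding case_prod_beta by (intro filterlim_Pair filterlim_fst')
  with 2 3 show ?thesis
    unfolding \<psi>_def Y_def by (intro exI[of _ \<omega>]) simp
qed

text \<open>The counterpart of \<open>spectral_lift\<close>: the normalised displacement of the
  eigenvalues is read off from a given matrix. The scale \<open>s t\<close> cancels in the Lipschitz
  estimate, so the distance to \<open>l\<close> is bounded by that of \<open>W'\<close> to
  \<open>W\<close> plus the error for \<open>W\<close> itself.\<close>

lemma spectral_projection:
  fixes B :: "real \<Rightarrow> 'n::{finite,linorder} sqmat"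
  assumes B: "\<And>t. symmetric_mat (B t)" and W: "symmetric_mat W" and s: "\<forall>t>0. 0 < s t"
    and lim: "((\<lambda>t. (1 / s t) *\<^sub>R (eigvals (B t + s t *\<^sub>R W) - b t)) \<longlongrightarrow> l) (at_right 0)"
  shows "\<exists>\<pi>. (\<forall>\<theta> t W'. symmetric_mat W' \<longrightarrow> 0 < t \<longrightarrow>
      spectral_fun \<theta> (B t + s t *\<^sub>R W') = \<theta> (b t + s t *\<^sub>R \<pi> t W')) \<and>
    filterlim (\<lambda>(t, W'). (t, \<pi> t W')) (at_right 0 \<times>\<^sub>F nhds l) (at_right 0 \<times>\<^sub>F nhds W)"
proof -
  define L where "L = 2 * (real CARD('n))\<^sup>2"
  define \<psi> where "\<psi> t W' = (1 / s t) *\<^sub>R (eigvals (B t + s t *\<^sub>R W') - b t)" for t W'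
  \<comment> \<open>The default \<open>l\<close> keeps the convergence valid over all matrices near
    \<open>W\<close>, including nonsymmetric ones.\<close>
  define \<pi> where "\<pi> t W' = (if symmetric_mat W' then \<psi> t W' else l)" for t W'
  have 1: "spectral_fun \<theta> (B t + s t *\<^sub>R W') = \<theta> (b t + s t *\<^sub>R \<pi> t W')"
    if "symmetric_mat W'" "0 < t" for \<theta> t W'
    using that s[rule_format, OF that(2)]
    by (simp add: \<pi>_def \<psi>_def spectral_fun_eq symmetric_mat_intros B)
  let ?F = "at_right (0::real) \<times>\<^sub>F nhds W"
  have "((\<lambda>p. \<pi> (fst p) (snd p) - l) \<longlongrightarrow> 0) ?F"
  proof (rule Lim_null_comparison)
    have "norm (\<pi> t W' - l) \<le> L * norm (W' - W) + norm (\<psi> t W - l)" if t: "0 < t" for t W'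
    proof (cases "symmetric_mat W'")
      case True
      have "norm (\<psi> t W' - \<psi> t W) = (1 / s t) * norm (eigvals (B t + s t *\<^sub>R W') - eigvals (B t + s t *\<^sub>R W))"
        using s[rule_format, OF t] by (simp add: \<psi>_def scaleR_diff_right[symmetric] del: scaleR_diff_right)
      also have "\<dots> \<le> (1 / s t) * (L * norm ((B t + s t *\<^sub>R W') - (B t + s t *\<^sub>R W)))"
        unfolding L_def using s[rule_format, OF t]
        by (intro mult_left_mono eigvals_lipschitz symmetric_mat_intros B W True) simp
      also have "(B t + s t *\<^sub>R W') - (B t + s t *\<^sub>R W) = s t *\<^sub>R (W' - W)"
        by (simp add: scaleR_diff_right)
      finally have "norm (\<psi> t W' - \<psi> t W) \<le> L * norm (W' - W)"
        using s[rule_format, OF t] by simp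
      then show ?thesis
        using True norm_triangle_ineq[of "\<psi> t W' - \<psi> t W" "\<psi> t W - l"] by (simp add: \<pi>_def)
    next
      case False
      then show ?thesis by (simp add: \<pi>_def L_def)
    qed
    then show "\<forall>\<^sub>F p in ?F. norm (\<pi> (fst p) (snd p) - l) \<le> L * norm (snd p - W) + norm (\<psi> (fst p) W - l)"
      using eventually_fst_pos by (rule eventually_mono[rotated]) auto
    have "((\<lambda>p. \<psi> (fst p) W) \<longlongrightarrow> l) ?F"
      using lim unfolding \<psi>_def by (rule filterlim_compose[OF _ filterlim_fst'])
    then have "((\<lambda>p. L * norm (snd p - W) + norm (\<psi> (fst p) W - l)) \<longlongrightarrow> L * norm (W - W) + norm (l - l)) ?F"
      by (intro tendsto_intros filterlim_snd')
    then show "((\<lambda>p. L * norm (snd p - W) + norm (\<psi> (fst p) W - l)) \<longlongrightarrow> 0) ?F"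
      by simp
  qed
  then have "((\<lambda>p. \<pi> (fst p) (snd p)) \<longlongrightarrow> l) ?F"
    by (rule LIM_zero_cancel)
  then have "filterlim (\<lambda>(t, z). (t, \<pi> t z)) (at_right 0 \<times>\<^sub>F nhds l) ?F"
    unfolding case_prod_beta by (intro filterlim_Pair filterlim_fst')
  with 1 show ?thesis
    by (intro exI[of _ \<pi>]) simp
qed

text \<open>\<open>Q t\<close> abstracts from the quotient, so that one statement yields both the
  subderivative and the parabolic subderivative. Its value at \<open>\<infinity>\<close> disposes of
  nonsymmetric \<open>W'\<close>, where the composite is infinite.\<close>

lemma Liminf_spectral_fun_eq:
  fixes B :: "real \<Rightarrow> 'n::{finite,linorder} sqmat" and Q :: "real \<Rightarrow> ereal \<Rightarrow> ereal"
  assumes \<theta>: "symmetric_fun \<theta>"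
    and B: "\<And>t. symmetric_mat (B t)" and W: "symmetric_mat W" and s: "\<forall>t>0. 0 < s t"
    and lim: "((\<lambda>t. (1 / s t) *\<^sub>R (eigvals (B t + s t *\<^sub>R W) - b t)) \<longlongrightarrow> l) (at_right 0)"
    and Q: "\<And>t. 0 < t \<Longrightarrow> Q t \<infinity> = \<infinity>"
  shows "Liminf (at_right 0 \<times>\<^sub>F nhds W) (\<lambda>(t, W'). Q t (spectral_fun \<theta> (B t + s t *\<^sub>R W')))
    = Liminf (at_right 0 \<times>\<^sub>F nhds l) (\<lambda>(t, z). Q t (\<theta> (b t + s t *\<^sub>R z)))" (is "?L = ?R")
proof (rule antisym)
  obtain \<omega> where \<omega>: "\<And>t z. 0 < t \<Longrightarrow> spectral_fun \<theta> (B t + s t *\<^sub>R \<omega> t z) = \<theta> (b t + s t *\<^sub>R z)"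
    "filterlim (\<lambda>(t, z). (t, \<omega> t z)) (at_right 0 \<times>\<^sub>F nhds W) (at_right 0 \<times>\<^sub>F nhds l)"
    using spectral_lift[OF B W s lim] \<theta> by blast
  have "?L \<le> Liminf (at_right 0 \<times>\<^sub>F nhds l)
      (\<lambda>p. (\<lambda>(t, W'). Q t (spectral_fun \<theta> (B t + s t *\<^sub>R W'))) ((\<lambda>(t, z). (t, \<omega> t z)) p))"
    by (rule Liminf_le_compose[OF \<omega>(2)])
  also have "\<dots> = ?R"
    by (rule Liminf_eq) (use eventually_fst_pos in \<open>rule eventually_mono; auto simp: \<omega>(1)\<close>)
  finally show "?L \<le> ?R" .
next
  obtain \<pi> where \<pi>: "\<And>t W'. symmetric_mat W' \<Longrightarrow> 0 < t \<Longrightarrow>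
      spectral_fun \<theta> (B t + s t *\<^sub>R W') = \<theta> (b t + s t *\<^sub>R \<pi> t W')"
    "filterlim (\<lambda>(t, W'). (t, \<pi> t W')) (at_right 0 \<times>\<^sub>F nhds l) (at_right 0 \<times>\<^sub>F nhds W)"
    using spectral_projection[OF B W s lim] by blast
  have "?R \<le> Liminf (at_right 0 \<times>\<^sub>F nhds W)
      (\<lambda>p. (\<lambda>(t, z). Q t (\<theta> (b t + s t *\<^sub>R z))) ((\<lambda>(t, W'). (t, \<pi> t W')) p))"
    by (rule Liminf_le_compose[OF \<pi>(2)])
  also have "\<dots> \<le> ?L"
  proof (rule Liminf_mono, rule eventually_mono[OF eventually_fst_pos], clarsimp)
    fix t W' assume t: "0 < (t :: real)"
    show "Q t (\<theta> (b t + s t *\<^sub>R \<pi> t W')) \<le> Q t (spectral_fun \<theta> (B t + s t *\<^sub>R W'))"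
    proof (cases "symmetric_mat W'")
      case True
      then show ?thesis using \<pi>(1)[OF True t] by simp
    next
      case False
      then have "\<not> symmetric_mat (B t + s t *\<^sub>R W')"
        using s[rule_format, OF t] B symmetric_mat_add_cancel symmetric_mat_scaleR_cancel by (metis less_irrefl)
      then show ?thesis
        by (simp add: spectral_fun_infinity Q[OF t])
    qed
  qed
  finally show "?R \<le> ?L" .
qed

lemma subderiv_spectral_fun:
  fixes X H :: "'n::{finite,linorder} sqmat"
  assumes \<theta>: "symmetric_fun \<theta>" and X: "symmetric_mat X" and H: "symmetric_mat H"
    and fin: "\<bar>spectral_fun \<theta> X\<bar> \<noteq> \<infinity>"
  shows "subderiv (spectral_fun \<theta>) X H = subderiv \<theta> (eigvals X) (eig_dir1 X H)"
  unfolding subderiv_def spectral_fun_eq[OF X]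
proof (rule Liminf_spectral_fun_eq[OF \<theta>, where B = "\<lambda>_. X" and s = "\<lambda>t. t" and b = "\<lambda>_. eigvals X"
      and Q = "\<lambda>t v. (v - \<theta> (eigvals X)) / ereal t"])
  show "((\<lambda>t. (1 / t) *\<^sub>R (eigvals (X + t *\<^sub>R H) - eigvals X)) \<longlongrightarrow> eig_dir1 X H) (at_right 0)"
    by (rule eig_dir1_tendsto[OF X H])
  show "(\<infinity> - \<theta> (eigvals X)) / ereal t = \<infinity>" if "0 < t" for t
    using that fin by (cases "\<theta> (eigvals X)") (auto simp: spectral_fun_eq[OF X])
qed (auto intro: X H)

text \<open>The parabolic quotient as a function of the value \<open>v\<close> alone, with base
  value \<open>c\<close> and subderivative \<open>d\<close> fixed; in this form it fits the
  parameter \<open>Q\<close> of \<open>Liminf_spectral_fun_eq\<close>.\<close>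

definition par_value :: "real \<Rightarrow> ereal \<Rightarrow> ereal \<Rightarrow> ereal \<Rightarrow> ereal" where
  "par_value t c d v = (v - c - ereal t * d) / ereal (t\<^sup>2 / 2)"

lemma par_quot_eq:
  "par_quot f x w t z = par_value t (f x) (subderiv f x w) (f (x + t *\<^sub>R w + (t\<^sup>2 / 2) *\<^sub>R z))"
  by (simp add: par_quot_def par_value_def)

lemma par_value_infinity:
  assumes "\<bar>c\<bar> \<noteq> \<infinity>" "\<bar>d\<bar> \<noteq> \<infinity>" "0 < t"
  shows "par_value t c d \<infinity> = \<infinity>"
  using assms by (cases c; cases d) (auto simp: par_value_def)

lemma par_quot_less_infinity:
  assumes "\<bar>f x\<bar> \<noteq> \<infinity>" "\<bar>subderiv f x w\<bar> \<noteq> \<infinity>" "0 < t" "par_quot f x w t z < \<infinity>"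
  shows "f (x + t *\<^sub>R w + (t\<^sup>2 / 2) *\<^sub>R z) < \<infinity>"
  using assms(4) par_value_infinity[OF assms(1,2,3)] unfolding par_quot_eq
  by (cases "f (x + t *\<^sub>R w + (t\<^sup>2 / 2) *\<^sub>R z)") auto

lemma symmetric_mat_curve_iff:
  assumes "symmetric_mat X" "symmetric_mat H" "0 < t"
  shows "symmetric_mat (X + t *\<^sub>R H + (t\<^sup>2 / 2) *\<^sub>R W) \<longleftrightarrow> symmetric_mat W"
proof
  assume *: "symmetric_mat (X + t *\<^sub>R H + (t\<^sup>2 / 2) *\<^sub>R W)"
  have "symmetric_mat (X + t *\<^sub>R H)"
    by (intro symmetric_mat_intros assms)
  from symmetric_mat_add_cancel[OF this *] show "symmetric_mat W"
    using assms(3) by (metis symmetric_mat_scaleR_cancel divide_eq_0_iff less_irrefl power_not_zero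
        zero_neq_numeral)
qed (intro symmetric_mat_intros assms)

lemma par_subderiv_spectral_fun:
  fixes X H W :: "'n::{finite,linorder} sqmat"
  assumes \<theta>: "symmetric_fun \<theta>" and X: "symmetric_mat X" and H: "symmetric_mat H" and W: "symmetric_mat W"
    and fin: "\<bar>spectral_fun \<theta> X\<bar> \<noteq> \<infinity>" "\<bar>subderiv (spectral_fun \<theta>) X H\<bar> \<noteq> \<infinity>"
  shows "par_subderiv (spectral_fun \<theta>) X H W =
    par_subderiv \<theta> (eigvals X) (eig_dir1 X H) (eig_dir2 X H W)"
  unfolding par_subderiv_def par_quot_eq spectral_fun_eq[OF X]
    subderiv_spectral_fun[OF \<theta> X H fin(1), symmetric]
proof (rule Liminf_spectral_fun_eq[OF \<theta>, where B = "\<lambda>t. X + t *\<^sub>R H" and s = "\<lambda>t. t\<^sup>2 / 2"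
      and b = "\<lambda>t. eigvals X + t *\<^sub>R eig_dir1 X H"
      and Q = "\<lambda>t v. par_value t (\<theta> (eigvals X)) (subderiv (spectral_fun \<theta>) X H) v"])
  show "((\<lambda>t. (1 / (t\<^sup>2 / 2)) *\<^sub>R (eigvals (X + t *\<^sub>R H + (t\<^sup>2 / 2) *\<^sub>R W)
      - (eigvals X + t *\<^sub>R eig_dir1 X H))) \<longlongrightarrow> eig_dir2 X H W) (at_right 0)"
    using eig_dir2_tendsto[OF X H W] by (simp add: diff_diff_eq)
  show "par_value t (\<theta> (eigvals X)) (subderiv (spectral_fun \<theta>) X H) \<infinity> = \<infinity>" if "0 < t" for t
    using that fin by (intro par_value_infinity) (auto simp: spectral_fun_eq[OF X])
qed (auto intro: W symmetric_mat_intros X H)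

lemma par_quot_spectral_fun_nonsymmetric:
  assumes X: "symmetric_mat X" and H: "symmetric_mat H" and W: "\<not> symmetric_mat W" and t: "0 < t"
    and fin: "\<bar>spectral_fun \<theta> X\<bar> \<noteq> \<infinity>" "\<bar>subderiv (spectral_fun \<theta>) X H\<bar> \<noteq> \<infinity>"
  shows "par_quot (spectral_fun \<theta>) X H t W = \<infinity>"
  using par_value_infinity[OF fin t] W symmetric_mat_curve_iff[OF X H t, of W]
  by (simp add: par_quot_eq spectral_fun_infinity)

text \<open>The symmetric matrices are closed, so all quotients near \<open>W\<close> are infinite.
  This case arises because epi-differentiability and the domain of the parabolic subderivative
  quantify over all matrices.\<close>

lemma par_subderiv_spectral_fun_nonsymmetric:
  fixes X H W :: "'n::{finite,linorder} sqmat"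
  assumes X: "symmetric_mat X" and H: "symmetric_mat H" and W: "\<not> symmetric_mat W"
    and fin: "\<bar>spectral_fun \<theta> X\<bar> \<noteq> \<infinity>" "\<bar>subderiv (spectral_fun \<theta>) X H\<bar> \<noteq> \<infinity>"
  shows "par_subderiv (spectral_fun \<theta>) X H W = \<infinity>"
proof -
  have "\<forall>\<^sub>F W' in nhds W. W' \<in> - {A. symmetric_mat A}"
    using W by (intro eventually_nhds_in_open open_Compl closed_symmetric_mat) auto
  note eventually_prodI[OF eventually_at_right_less[of "0::real"] this]
  then have "\<forall>\<^sub>F p in at_right 0 \<times>\<^sub>F nhds W.
      \<infinity> \<le> (case p of (t, W') \<Rightarrow> par_quot (spectral_fun \<theta>) X H t W')"
    by eventually_elim (auto simp: par_quot_spectral_fun_nonsymmetric[OF X H _ _ fin])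
  then have "\<infinity> \<le> par_subderiv (spectral_fun \<theta>) X H W"
    unfolding par_subderiv_def by (rule Liminf_bounded)
  then show ?thesis by simp
qed

section \<open>Parabolic epi-differentiability of spectral functions\<close>

lemma loc_lipschitz_rel_domE:
  assumes "loc_lipschitz_rel_dom f" "x \<in> edom f"
  obtains l V where "open V" "x \<in> V"
    "\<And>y y'. y \<in> V \<inter> edom f \<Longrightarrow> y' \<in> V \<inter> edom f \<Longrightarrow> \<bar>f y - f y'\<bar> \<le> ereal (l * norm (y - y'))"
proof -
  from bspec[OF assms(1)[unfolded loc_lipschitz_rel_dom_def] assms(2)]
  obtain l V where "open V \<and> x \<in> V \<and>
      (\<forall>y \<in> V \<inter> edom f. \<forall>y' \<in> V \<inter> edom f. \<bar>f y - f y'\<bar> \<le> ereal (l * norm (y - y')))"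
    by (elim exE)
  then show ?thesis
    using that[of V l] by simp
qed

text \<open>The Lipschitz bound at two equal points rules out the value \<open>-\<infinity>\<close>,
  because subtracting \<open>-\<infinity>\<close> from itself gives \<open>\<infinity>\<close> in
  \<open>ereal\<close>.\<close>

lemma loc_lipschitz_rel_dom_finite:
  assumes "loc_lipschitz_rel_dom f" "y \<in> edom f"
  shows "\<bar>f y\<bar> \<noteq> \<infinity>"
proof -
  obtain l V where V: "open V" "y \<in> V"
    "\<And>x x'. x \<in> V \<inter> edom f \<Longrightarrow> x' \<in> V \<inter> edom f \<Longrightarrow> \<bar>f x - f x'\<bar> \<le> ereal (l * norm (x - x'))"
    by (rule loc_lipschitz_rel_domE[OF assms], rule that)
  have "\<bar>f y - f y\<bar> \<le> ereal (l * norm (y - y))"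
    by (rule V(3)) (use V(2) assms(2) in auto)
  then show ?thesis
    using assms(2) by (cases "f y") (auto simp: edom_def)
qed

lemma tendsto_norm_bounded:
  fixes a :: "nat \<Rightarrow> 'a::real_normed_vector"
  assumes "a \<longlonglongrightarrow> l"
  shows "\<exists>M. \<forall>k. norm (a k) \<le> M"
  using convergent_imp_Bseq[OF convergentI[OF assms]] by (auto simp: Bseq_def)

lemma tendsto_second_order_curve:
  fixes x w :: "'a::real_normed_vector"
  assumes "t \<longlonglongrightarrow> 0" "zs \<longlonglongrightarrow> z"
  shows "(\<lambda>k. x + t k *\<^sub>R w + ((t k)\<^sup>2 / 2) *\<^sub>R zs k) \<longlonglongrightarrow> x"
proof -
  have "(\<lambda>k. x + t k *\<^sub>R w + ((t k)\<^sup>2 / 2) *\<^sub>R zs k) \<longlonglongrightarrow> x + 0 *\<^sub>R w + (0\<^sup>2 / 2) *\<^sub>R z"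
    by (intro tendsto_intros assms) simp
  then show ?thesis by simp
qed

text \<open>Along the times of the tangent sequence, a recovery sequence exists for some
  \<open>z0\<close> with parabolic subderivative below \<open>\<infinity>\<close>. The two arcs
  differ by \<open>(t k)\<^sup>2 / 2\<close> times a bounded vector, so by the Lipschitz bound their
  parabolic quotients differ by a bounded amount.\<close>

lemma par_subderiv_less_infinity_if_second_tangent:
  fixes f :: "'a::real_normed_vector \<Rightarrow> ereal"
  assumes lip: "loc_lipschitz_rel_dom f" and fin: "\<bar>f x\<bar> \<noteq> \<infinity>"
    and epi: "par_epi_diff_for f x w" and z: "z \<in> second_tangent (edom f) x w"
  shows "par_subderiv f x w z < \<infinity>"
proof -
  obtain t zs where t: "\<And>k. 0 < t k" "t \<longlonglongrightarrow> 0" and zs: "zs \<longlonglongrightarrow> z"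
    and dom: "\<And>k. x + t k *\<^sub>R w + ((t k)\<^sup>2 / 2) *\<^sub>R zs k \<in> edom f"
    using z unfolding second_tangent_def by blast
  have sub: "\<bar>subderiv f x w\<bar> \<noteq> \<infinity>"
    using epi by (simp add: par_epi_diff_for_def)
  obtain z0 where z0: "par_subderiv f x w z0 < \<infinity>"
    using epi unfolding par_epi_diff_for_def by blast
  obtain ys where ys: "ys \<longlonglongrightarrow> z0" "(\<lambda>k. par_quot f x w (t k) (ys k)) \<longlonglongrightarrow> par_subderiv f x w z0"
    using epi t unfolding par_epi_diff_for_def by blast
  \<comment> \<open>A real bound is interposed, since the value at \<open>z0\<close> may be
    \<open>-\<infinity>\<close>.\<close>
  obtain c where c: "par_subderiv f x w z0 < ereal c"
    using ereal_dense2[OF z0] by blast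
  have "x \<in> edom f"
    using fin by (auto simp: edom_def)
  obtain l V where V: "open V" "x \<in> V"
    and l: "\<And>y y'. y \<in> V \<inter> edom f \<Longrightarrow> y' \<in> V \<inter> edom f \<Longrightarrow> \<bar>f y - f y'\<bar> \<le> ereal (l * norm (y - y'))"
    by (rule loc_lipschitz_rel_domE[OF lip \<open>x \<in> edom f\<close>], rule that)
  define p where "p k = x + t k *\<^sub>R w + ((t k)\<^sup>2 / 2) *\<^sub>R zs k" for k
  define q where "q k = x + t k *\<^sub>R w + ((t k)\<^sup>2 / 2) *\<^sub>R ys k" for k
  obtain M where M: "\<And>k. norm (zs k - ys k) \<le> M"
    using tendsto_norm_bounded[OF tendsto_diff[OF zs ys(1)]] by blast
  have "\<forall>\<^sub>F k in sequentially. p k \<in> V"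
    using tendsto_second_order_curve[OF t(2) zs, of x w] V unfolding p_def tendsto_def by blast
  moreover have "\<forall>\<^sub>F k in sequentially. q k \<in> V"
    using tendsto_second_order_curve[OF t(2) ys(1), of x w] V unfolding q_def tendsto_def by blast
  moreover have "\<forall>\<^sub>F k in sequentially. par_quot f x w (t k) (ys k) < ereal c"
    by (rule order_tendstoD(2)[OF ys(2) c])
  ultimately have "\<forall>\<^sub>F k in sequentially. par_quot f x w (t k) (zs k) \<le> ereal (c + \<bar>l\<bar> * M)"
  proof eventually_elim
    case (elim k)
    have "par_quot f x w (t k) (ys k) < \<infinity>"
      using elim(3) by (rule less_trans) simp
    then have q: "q k \<in> edom f"
      using par_quot_less_infinity[OF fin sub t(1)] by (simp add: q_def edom_def)
    have p: "p k \<in> edom f"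
      using dom by (simp add: p_def)
    obtain a where a: "f (p k) = ereal a"
      using loc_lipschitz_rel_dom_finite[OF lip p] by auto
    obtain b where b: "f (q k) = ereal b"
      using loc_lipschitz_rel_dom_finite[OF lip q] by auto
    obtain e where e: "f x = ereal e"
      using fin by auto
    obtain d where d: "subderiv f x w = ereal d"
      using sub by auto
    have tk: "0 < (t k)\<^sup>2 / 2"
      using t(1)[of k] by simp
    have "\<bar>a - b\<bar> \<le> l * norm (p k - q k)"
      using l[of "p k" "q k"] elim p q by (simp add: a b)
    \<comment> \<open>The Lipschitz constant \<open>l\<close> comes without a sign, hence the
      absolute value.\<close>
    also have "\<dots> \<le> \<bar>l\<bar> * norm (p k - q k)"
      by (intro mult_right_mono) auto
    also have "norm (p k - q k) = (t k)\<^sup>2 / 2 * norm (zs k - ys k)"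
      by (simp add: p_def q_def scaleR_diff_right[symmetric] del: scaleR_diff_right)
    also have "\<bar>l\<bar> * \<dots> \<le> \<bar>l\<bar> * ((t k)\<^sup>2 / 2 * M)"
      using M[of k] by (intro mult_left_mono) auto
    also have "\<bar>l\<bar> * ((t k)\<^sup>2 / 2 * M) = (\<bar>l\<bar> * M) * ((t k)\<^sup>2 / 2)"
      by simp
    finally have "a - e - t k * d \<le> (b - e - t k * d) + (\<bar>l\<bar> * M) * ((t k)\<^sup>2 / 2)"
      using abs_ge_self[of "a - b"] by linarith
    moreover have "b - e - t k * d \<le> c * ((t k)\<^sup>2 / 2)"
    proof -
      have "par_quot f x w (t k) (ys k) = ereal ((b - e - t k * d) / ((t k)\<^sup>2 / 2))"
        using tk by (simp add: par_quot_eq par_value_def q_def[symmetric] b e d)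
      then have "(b - e - t k * d) / ((t k)\<^sup>2 / 2) < c"
        using elim(3) by simp
      then show ?thesis
        unfolding pos_divide_less_eq[OF tk] by (rule less_imp_le)
    qed
    ultimately have "a - e - t k * d \<le> (c + \<bar>l\<bar> * M) * ((t k)\<^sup>2 / 2)"
      by (simp only: distrib_right)
    then have "(a - e - t k * d) / ((t k)\<^sup>2 / 2) \<le> c + \<bar>l\<bar> * M"
      unfolding pos_divide_le_eq[OF tk] .
    moreover have "par_quot f x w (t k) (zs k) = ereal ((a - e - t k * d) / ((t k)\<^sup>2 / 2))"
      using tk by (simp add: par_quot_eq par_value_def p_def[symmetric] a e d)
    ultimately show ?case by simp
  qed
  then have "par_subderiv f x w z \<le> ereal (c + \<bar>l\<bar> * M)"
    unfolding par_subderiv_def by (rule Liminf_le_lim_sequence[OF t zs])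
  then show ?thesis
    by (rule le_less_trans) simp
qed

lemma second_tangent_if_par_subderiv_less_infinity:
  fixes f :: "'a::real_normed_vector \<Rightarrow> ereal"
  assumes fin: "\<bar>f x\<bar> \<noteq> \<infinity>" "\<bar>subderiv f x w\<bar> \<noteq> \<infinity>" and z: "par_subderiv f x w z < \<infinity>"
  shows "z \<in> second_tangent (edom f) x w"
proof -
  obtain t zs where t: "\<And>k. 0 < t k" "t \<longlonglongrightarrow> 0" "zs \<longlonglongrightarrow> z" and q: "\<And>k. par_quot f x w (t k) (zs k) < \<infinity>"
    using Liminf_less_sequence[OF z[unfolded par_subderiv_def]] by blast
  have "x + t k *\<^sub>R w + ((t k)\<^sup>2 / 2) *\<^sub>R zs k \<in> edom f" for k
    using par_quot_less_infinity[OF fin t(1) q] by (simp add: edom_def)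
  with t show ?thesis
    unfolding second_tangent_def by blast
qed

lemma second_order_lift:
  fixes X H W :: "'n::{finite,linorder} sqmat"
  assumes \<theta>: "symmetric_fun \<theta>" and X: "symmetric_mat X" and H: "symmetric_mat H" and W: "symmetric_mat W"
    and fin: "\<bar>spectral_fun \<theta> X\<bar> \<noteq> \<infinity>"
  shows "\<exists>\<omega>. (\<forall>t z. 0 < t \<longrightarrow> par_quot (spectral_fun \<theta>) X H t (\<omega> t z)
        = par_quot \<theta> (eigvals X) (eig_dir1 X H) t z) \<and>
    (\<forall>t z. 0 < t \<longrightarrow> norm (\<omega> t z - W) \<le> real CARD('n) ^ 3 *
      norm (z - (1 / (t\<^sup>2 / 2)) *\<^sub>R (eigvals (X + t *\<^sub>R H + (t\<^sup>2 / 2) *\<^sub>R W) - (eigvals X + t *\<^sub>R eig_dir1 X H)))) \<and>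
    filterlim (\<lambda>(t, z). (t, \<omega> t z)) (at_right 0 \<times>\<^sub>F nhds W) (at_right 0 \<times>\<^sub>F nhds (eig_dir2 X H W))"
proof -
  have B: "symmetric_mat (X + t *\<^sub>R H)" for t
    by (intro symmetric_mat_intros X H)
  have s: "\<forall>t>0. 0 < (t::real)\<^sup>2 / 2"
    by simp
  have lim: "((\<lambda>t. (1 / (t\<^sup>2 / 2)) *\<^sub>R (eigvals (X + t *\<^sub>R H + (t\<^sup>2 / 2) *\<^sub>R W)
      - (eigvals X + t *\<^sub>R eig_dir1 X H))) \<longlongrightarrow> eig_dir2 X H W) (at_right 0)"
    using eig_dir2_tendsto[OF X H W] by (simp add: diff_diff_eq)
  show ?thesis
    unfolding par_quot_eq subderiv_spectral_fun[OF \<theta> X H fin] spectral_fun_eq[OF X]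
    by (rule ex_forward[OF spectral_lift[OF B W s lim]]) (use \<theta> in simp)
qed

lemma second_order_projection:
  fixes X H W :: "'n::{finite,linorder} sqmat"
  assumes X: "symmetric_mat X" and H: "symmetric_mat H" and W: "symmetric_mat W"
  shows "\<exists>\<pi>. (\<forall>\<theta> t W'. symmetric_mat W' \<longrightarrow> 0 < t \<longrightarrow> spectral_fun \<theta> (X + t *\<^sub>R H + (t\<^sup>2 / 2) *\<^sub>R W')
        = \<theta> (eigvals X + t *\<^sub>R eig_dir1 X H + (t\<^sup>2 / 2) *\<^sub>R \<pi> t W')) \<and>
    filterlim (\<lambda>(t, W'). (t, \<pi> t W')) (at_right 0 \<times>\<^sub>F nhds (eig_dir2 X H W)) (at_right 0 \<times>\<^sub>F nhds W)"
proof -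
  have B: "symmetric_mat (X + t *\<^sub>R H)" for t
    by (intro symmetric_mat_intros X H)
  have s: "\<forall>t>0. 0 < (t::real)\<^sup>2 / 2"
    by simp
  have lim: "((\<lambda>t. (1 / (t\<^sup>2 / 2)) *\<^sub>R (eigvals (X + t *\<^sub>R H + (t\<^sup>2 / 2) *\<^sub>R W)
      - (eigvals X + t *\<^sub>R eig_dir1 X H))) \<longlongrightarrow> eig_dir2 X H W) (at_right 0)"
    using eig_dir2_tendsto[OF X H W] by (simp add: diff_diff_eq)
  show ?thesis
    by (rule spectral_projection[OF B W s lim])
qed

lemma filterlim_snd_sequence:
  assumes "filterlim (\<lambda>(t, z). (t, \<phi> t z)) (at_right 0 \<times>\<^sub>F nhds W) (at_right 0 \<times>\<^sub>F nhds l)"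
    and "\<And>k. 0 < t k" "t \<longlonglongrightarrow> (0::real)" "zs \<longlonglongrightarrow> l"
  shows "(\<lambda>k. \<phi> (t k) (zs k)) \<longlonglongrightarrow> W"
  using filterlim_compose[OF filterlim_snd' filterlim_compose[OF assms(1) filterlim_Pair_at_right[OF assms(2-4)]]]
  by simp

text \<open>For symmetric \<open>W\<close>, a recovery sequence for \<open>\<theta>\<close> at
  \<open>eig_dir2 X H W\<close> is lifted to matrices; the lift preserves each quotient exactly and
  converges to \<open>W\<close>.\<close>

lemma par_epi_diff_for_spectral_fun:
  fixes X H :: "'n::{finite,linorder} sqmat"
  assumes \<theta>: "symmetric_fun \<theta>" and X: "symmetric_mat X" and H: "symmetric_mat H"
    and fin: "\<bar>spectral_fun \<theta> X\<bar> \<noteq> \<infinity>"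
    and epi: "par_epi_diff_for \<theta> (eigvals X) (eig_dir1 X H)"
  shows "par_epi_diff_for (spectral_fun \<theta>) X H"
  unfolding par_epi_diff_for_def
proof (intro conjI allI impI)
  let ?f = "spectral_fun \<theta>" and ?x = "eigvals X" and ?h = "eig_dir1 X H"
  show sub: "\<bar>subderiv ?f X H\<bar> \<noteq> \<infinity>"
    using epi by (simp add: subderiv_spectral_fun[OF \<theta> X H fin] par_epi_diff_for_def)
  \<comment> \<open>The vector \<open>z0\<close> may differ from every
    \<open>eig_dir2 X H W\<close>, so a lift over it need not converge. Lifting around the zero
    matrix at least keeps the matrices bounded, and any cluster point \<open>W\<close> inherits a
    bound on the quotients.\<close>
  show "{W. par_subderiv ?f X H W < \<infinity>} \<noteq> {}"
  proof -
    obtain z0 where z0: "par_subderiv \<theta> ?x ?h z0 < \<infinity>"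
      using epi unfolding par_epi_diff_for_def by blast
    define t where "t = (\<lambda>k. inverse (real (Suc k)))"
    have t: "\<And>k. 0 < t k" "t \<longlonglongrightarrow> 0"
      unfolding t_def by (simp, rule LIMSEQ_inverse_real_of_nat)
    obtain zs where zs: "zs \<longlonglongrightarrow> z0" "(\<lambda>k. par_quot \<theta> ?x ?h (t k) (zs k)) \<longlonglongrightarrow> par_subderiv \<theta> ?x ?h z0"
      using epi t unfolding par_epi_diff_for_def by blast
    obtain c where c: "par_subderiv \<theta> ?x ?h z0 < c" "c < \<infinity>"
      using dense[OF z0] by blast
    define \<psi> where "\<psi> s = (1 / (s\<^sup>2 / 2)) *\<^sub>R (eigvals (X + s *\<^sub>R H + (s\<^sup>2 / 2) *\<^sub>R 0) - (?x + s *\<^sub>R ?h))" for s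
    obtain \<omega> where \<omega>: "\<And>s z. 0 < s \<Longrightarrow> par_quot ?f X H s (\<omega> s z) = par_quot \<theta> ?x ?h s z"
      "\<And>s z. 0 < s \<Longrightarrow> norm (\<omega> s z - 0) \<le> real CARD('n) ^ 3 * norm (z - \<psi> s)"
      using second_order_lift[OF \<theta> X H symmetric_mat_0 fin] unfolding \<psi>_def by blast
    have "filterlim t (at_right 0) sequentially"
      using t by (auto simp: filterlim_at less_imp_neq[symmetric])
    moreover have "(\<psi> \<longlongrightarrow> eig_dir2 X H 0) (at_right 0)"
      unfolding \<psi>_def using eig_dir2_tendsto[OF X H symmetric_mat_0] by (simp add: diff_diff_eq)
    ultimately have "(\<lambda>k. \<psi> (t k)) \<longlonglongrightarrow> eig_dir2 X H 0"
      by (rule filterlim_compose[rotated])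
    from tendsto_norm_bounded[OF tendsto_diff[OF zs(1) this]]
    obtain M where M: "\<And>k. norm (zs k - \<psi> (t k)) \<le> M"
      by blast
    define Ws where "Ws k = \<omega> (t k) (zs k)" for k
    have "norm (Ws k) \<le> real CARD('n) ^ 3 * M" for k
    proof -
      have "norm (Ws k) \<le> real CARD('n) ^ 3 * norm (zs k - \<psi> (t k))"
        using \<omega>(2)[OF t(1), of k "zs k"] by (simp add: Ws_def)
      also have "\<dots> \<le> real CARD('n) ^ 3 * M"
        by (intro mult_left_mono M) simp
      finally show ?thesis .
    qed
    then have "bounded (range Ws)"
      by (auto simp: bounded_iff)
    then obtain W r where r: "strict_mono r" "(Ws \<circ> r) \<longlonglongrightarrow> W"
      using bounded_imp_convergent_subsequence by blast
    have "\<forall>\<^sub>F k in sequentially. par_quot \<theta> ?x ?h (t k) (zs k) < c"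
      by (rule order_tendstoD(2)[OF zs(2) c(1)])
    then have "\<forall>\<^sub>F k in sequentially. par_quot \<theta> ?x ?h (t (r k)) (zs (r k)) < c"
      by (rule eventually_subseq[OF r(1)])
    then have "\<forall>\<^sub>F k in sequentially. par_quot ?f X H ((t \<circ> r) k) ((Ws \<circ> r) k) \<le> c"
      by eventually_elim (simp add: Ws_def \<omega>(1)[OF t(1)])
    moreover have "(t \<circ> r) \<longlonglongrightarrow> 0"
      by (rule LIMSEQ_subseq_LIMSEQ[OF t(2) r(1)])
    ultimately have "par_subderiv ?f X H W \<le> c"
      unfolding par_subderiv_def using t(1) by (intro Liminf_le_lim_sequence[OF _ _ r(2)]) (auto simp: o_def)
    then have "par_subderiv ?f X H W < \<infinity>"
      using c(2) by (rule le_less_trans)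
    then show ?thesis by blast
  qed
  fix W t assume t: "(\<forall>k. 0 < t k) \<and> t \<longlonglongrightarrow> (0::real)"
  show "\<exists>Ws. Ws \<longlonglongrightarrow> W \<and> (\<lambda>k. par_quot ?f X H (t k) (Ws k)) \<longlonglongrightarrow> par_subderiv ?f X H W"
  proof (cases "symmetric_mat W")
    case True
    obtain zs where zs: "zs \<longlonglongrightarrow> eig_dir2 X H W"
      "(\<lambda>k. par_quot \<theta> ?x ?h (t k) (zs k)) \<longlonglongrightarrow> par_subderiv \<theta> ?x ?h (eig_dir2 X H W)"
      using epi t unfolding par_epi_diff_for_def by blast
    obtain \<omega> where \<omega>: "\<And>s z. 0 < s \<Longrightarrow> par_quot ?f X H s (\<omega> s z) = par_quot \<theta> ?x ?h s z"
      "filterlim (\<lambda>(t, z). (t, \<omega> t z)) (at_right 0 \<times>\<^sub>F nhds W) (at_right 0 \<times>\<^sub>F nhds (eig_dir2 X H W))"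
      using second_order_lift[OF \<theta> X H True fin] by blast
    have "(\<lambda>k. \<omega> (t k) (zs k)) \<longlonglongrightarrow> W"
      using filterlim_snd_sequence[OF \<omega>(2) _ _ zs(1)] t by blast
    moreover have "(\<lambda>k. par_quot ?f X H (t k) (\<omega> (t k) (zs k))) \<longlonglongrightarrow> par_subderiv ?f X H W"
      using zs(2) t by (simp add: \<omega>(1) par_subderiv_spectral_fun[OF \<theta> X H True fin sub])
    ultimately show ?thesis by blast
  next
    case False
    \<comment> \<open>The constant sequence suffices: every quotient at a nonsymmetric
      \<open>W\<close> is already infinite.\<close>
    have "(\<lambda>k. par_quot ?f X H (t k) W) \<longlonglongrightarrow> par_subderiv ?f X H W"
      using t par_quot_spectral_fun_nonsymmetric[OF X H False _ fin sub]
      by (simp add: par_subderiv_spectral_fun_nonsymmetric[OF X H False fin sub])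
    then show ?thesis
      by (intro exI[of _ "\<lambda>_. W"]) simp
  qed
qed

text \<open>Epi-differentiability provides recovery sequences for both points along the same times,
  so convexity of \<open>f\<close> can be applied at each time and passed to the lower
  limit.\<close>

lemma par_subderiv_convex:
  fixes f :: "'a::real_normed_vector \<Rightarrow> ereal"
  assumes f: "ereal_convex f" and fin: "\<bar>f x\<bar> \<noteq> \<infinity>" and epi: "par_epi_diff_for f x w"
  shows "ereal_convex (par_subderiv f x w)"
  unfolding ereal_convex_def
proof (rule convexI, clarsimp)
  fix z1 a1 z2 a2 and u v :: real
  assume z: "par_subderiv f x w z1 \<le> ereal a1" "par_subderiv f x w z2 \<le> ereal a2"
    and uv: "0 \<le> u" "0 \<le> v" "u + v = 1"
  obtain d where d: "subderiv f x w = ereal d"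
    using epi unfolding par_epi_diff_for_def by auto
  obtain e where e: "f x = ereal e"
    using fin by auto
  define t where "t = (\<lambda>k. inverse (real (Suc k)))"
  have t: "\<And>k. 0 < t k" "t \<longlonglongrightarrow> 0"
    unfolding t_def by (simp, rule LIMSEQ_inverse_real_of_nat)
  obtain ys where ys: "ys \<longlonglongrightarrow> z1" "(\<lambda>k. par_quot f x w (t k) (ys k)) \<longlonglongrightarrow> par_subderiv f x w z1"
    using epi t unfolding par_epi_diff_for_def by blast
  obtain zs where zs: "zs \<longlonglongrightarrow> z2" "(\<lambda>k. par_quot f x w (t k) (zs k)) \<longlonglongrightarrow> par_subderiv f x w z2"
    using epi t unfolding par_epi_diff_for_def by blast
  \<comment> \<open>Bounds on quotients become membership in the epigraph of \<open>f\<close>, the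
    form in which \<open>ereal_convex\<close> applies.\<close>
  have value_le: "f (x + s *\<^sub>R w + (s\<^sup>2 / 2) *\<^sub>R z) \<le> ereal (e + s * d + (s\<^sup>2 / 2) * c)
      \<longleftrightarrow> par_quot f x w s z \<le> ereal c" if s: "0 < s" for s z c
  proof -
    have "0 < s\<^sup>2 / 2" using s by simp
    then show ?thesis
      by (cases "f (x + s *\<^sub>R w + (s\<^sup>2 / 2) *\<^sub>R z)")
        (auto simp: par_quot_eq par_value_def d e field_simps)
  qed
  show "par_subderiv f x w (u *\<^sub>R z1 + v *\<^sub>R z2) \<le> ereal (u * a1 + v * a2)"
  proof (rule ereal_le_epsilon2)
    fix \<epsilon> :: real assume \<epsilon>: "0 < \<epsilon>"
    have "\<forall>\<^sub>F k in sequentially. par_quot f x w (t k) (ys k) < ereal (a1 + \<epsilon>)"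
      by (rule order_tendstoD(2)[OF ys(2)], rule le_less_trans[OF z(1)]) (use \<epsilon> in simp)
    moreover have "\<forall>\<^sub>F k in sequentially. par_quot f x w (t k) (zs k) < ereal (a2 + \<epsilon>)"
      by (rule order_tendstoD(2)[OF zs(2)], rule le_less_trans[OF z(2)]) (use \<epsilon> in simp)
    ultimately have "\<forall>\<^sub>F k in sequentially.
        par_quot f x w (t k) (u *\<^sub>R ys k + v *\<^sub>R zs k) \<le> ereal (u * a1 + v * a2 + \<epsilon>)"
    proof eventually_elim
      case (elim k)
      let ?s = "t k"
      let ?p = "\<lambda>z. x + ?s *\<^sub>R w + (?s\<^sup>2 / 2) *\<^sub>R z" and ?b = "\<lambda>c. e + ?s * d + (?s\<^sup>2 / 2) * c"
      have "f (?p (ys k)) \<le> ereal (?b (a1 + \<epsilon>))" "f (?p (zs k)) \<le> ereal (?b (a2 + \<epsilon>))"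
        using elim by (simp_all only: value_le[OF t(1)] less_imp_le)
      then have "u *\<^sub>R (?p (ys k), ?b (a1 + \<epsilon>)) + v *\<^sub>R (?p (zs k), ?b (a2 + \<epsilon>)) \<in> {(x, a). f x \<le> ereal a}"
        using f uv unfolding ereal_convex_def by (intro convexD) auto
      moreover have "u *\<^sub>R ?p (ys k) + v *\<^sub>R ?p (zs k) = (u + v) *\<^sub>R (x + ?s *\<^sub>R w)
          + (?s\<^sup>2 / 2) *\<^sub>R (u *\<^sub>R ys k + v *\<^sub>R zs k)"
        by (simp add: algebra_simps)
      moreover have "u * (g + r * (a1 + \<epsilon>)) + v * (g + r * (a2 + \<epsilon>))
          = (u + v) * g + r * (u * a1 + v * a2 + (u + v) * \<epsilon>)" for g r
        by (simp add: algebra_simps)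
      note this[of "e + ?s * d" "?s\<^sup>2 / 2"]
      ultimately have "f (?p (u *\<^sub>R ys k + v *\<^sub>R zs k)) \<le> ereal (?b (u * a1 + v * a2 + \<epsilon>))"
        by (simp add: uv(3))
      then show ?case
        by (simp only: value_le[OF t(1)])
    qed
    moreover have "(\<lambda>k. u *\<^sub>R ys k + v *\<^sub>R zs k) \<longlonglongrightarrow> u *\<^sub>R z1 + v *\<^sub>R z2"
      by (intro tendsto_intros ys zs)
    ultimately have "par_subderiv f x w (u *\<^sub>R z1 + v *\<^sub>R z2) \<le> ereal (u * a1 + v * a2 + \<epsilon>)"
      unfolding par_subderiv_def using t by (intro Liminf_le_lim_sequence) auto
    then show "par_subderiv f x w (u *\<^sub>R z1 + v *\<^sub>R z2) \<le> ereal (u * a1 + v * a2) + ereal \<epsilon>"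
      by simp
  qed
qed

section \<open>Convexity, second order tangents and the converse\<close>

text \<open>Schur's half of the Schur-Horn theorem. A hyperplane separating the diagonal from the
  hull would contradict the weighted Ky Fan inequality.\<close>

lemma frame_diagonal_in_hull_eigvals:
  fixes A :: "'n::{finite,linorder} sqmat"
  assumes A: "symmetric_mat A" and p: "orthonormal_frame p"
  shows "(\<chi> i. p i \<bullet> (A *v p i)) \<in> convex hull ((\<lambda>\<sigma>. \<chi> i. eigvals A $ \<sigma> i) ` {\<sigma>. \<sigma> permutes UNIV})"
    (is "?a \<in> convex hull ?P")
proof (rule ccontr)
  assume "?a \<notin> convex hull ?P"
  moreover have "closed (convex hull ?P)"
    by (intro compact_imp_closed finite_imp_compact_convex_hull finite_imageI finite_permutations) simp
  ultimately obtain c b where c: "c \<bullet> ?a < b" "\<And>y. y \<in> convex hull ?P \<Longrightarrow> b < c \<bullet> y"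
    using separating_hyperplane_closed_point[of "convex hull ?P" ?a] convex_convex_hull by blast
  \<comment> \<open>\<open>\<tau>\<close> puts the negated coefficients of the separating functional
    in decreasing order, as the weighted inequality requires; the violating vertex of the hull is
    then the eigenvalue vector rearranged by \<open>inv \<tau>\<close>.\<close>
  obtain \<tau> where \<tau>: "\<tau> permutes UNIV" "\<And>i j. i \<le> j \<Longrightarrow> - c $ \<tau> j \<le> - c $ \<tau> i"
    using ex_antimono_permutation[of "\<lambda>i. - c $ i"] by blast
  have "(\<Sum>i\<in>UNIV. - c $ \<tau> i * (p (\<tau> i) \<bullet> (A *v p (\<tau> i)))) \<le> (\<Sum>i\<in>UNIV. - c $ \<tau> i * eigvals A $ i)"
    by (rule weighted_ky_fan[OF A orthonormal_frame_compose[OF p \<tau>(1)]])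
      (use \<tau>(2) in \<open>simp add: antimono_def\<close>)
  moreover have "(\<Sum>i\<in>UNIV. - c $ \<tau> i * (p (\<tau> i) \<bullet> (A *v p (\<tau> i)))) = - (c \<bullet> ?a)"
    using sum.permute[OF \<tau>(1), of "\<lambda>i. c $ i * (p i \<bullet> (A *v p i))"]
    by (simp add: inner_vec_def sum_negf o_def)
  moreover have "(\<Sum>i\<in>UNIV. - c $ \<tau> i * eigvals A $ i) = - (c \<bullet> (\<chi> i. eigvals A $ inv \<tau> i))"
    using sum.permute[OF \<tau>(1), of "\<lambda>i. c $ i * eigvals A $ inv \<tau> i"]
    by (simp add: inner_vec_def sum_negf o_def permutes_inverses[OF \<tau>(1)])
  moreover have "b < c \<bullet> (\<chi> i. eigvals A $ inv \<tau> i)"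
    by (rule c(2), rule hull_inc) (use permutes_inv[OF \<tau>(1)] in auto)
  ultimately show False
    using c(1) by linarith
qed

text \<open>A sublevel set of \<open>\<theta>\<close> is convex and closed under permutations, so
  with the eigenvalues it contains the whole hull of their rearrangements.\<close>

lemma symmetric_fun_frame_diagonal_le:
  fixes A :: "'n::{finite,linorder} sqmat"
  assumes \<theta>: "symmetric_fun \<theta>" "ereal_convex \<theta>" and A: "symmetric_mat A" and p: "orthonormal_frame p"
    and le: "\<theta> (eigvals A) \<le> ereal a"
  shows "\<theta> (\<chi> i. p i \<bullet> (A *v p i)) \<le> ereal a"
proof -
  have "convex {y. \<theta> y \<le> ereal a}"
  proof (rule convexI)
    fix x y and u v :: real
    assume *: "x \<in> {y. \<theta> y \<le> ereal a}" "y \<in> {y. \<theta> y \<le> ereal a}" "0 \<le> u" "0 \<le> v" "u + v = 1"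
    then have "u *\<^sub>R (x, a) + v *\<^sub>R (y, a) \<in> {(x, a). \<theta> x \<le> ereal a}"
      using \<theta>(2) unfolding ereal_convex_def by (intro convexD) auto
    moreover have "u * a + v * a = a"
      using *(5) by (metis distrib_right mult_1)
    ultimately show "u *\<^sub>R x + v *\<^sub>R y \<in> {y. \<theta> y \<le> ereal a}"
      by simp
  qed
  moreover have "(\<lambda>\<sigma>. \<chi> i. eigvals A $ \<sigma> i) ` {\<sigma>. \<sigma> permutes UNIV} \<subseteq> {y. \<theta> y \<le> ereal a}"
    using \<theta>(1) le by (auto simp: symmetric_fun_def)
  ultimately have "convex hull ((\<lambda>\<sigma>. \<chi> i. eigvals A $ \<sigma> i) ` {\<sigma>. \<sigma> permutes UNIV}) \<subseteq> {y. \<theta> y \<le> ereal a}"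
    by (rule hull_minimal[rotated])
  with frame_diagonal_in_hull_eigvals[OF A p] show ?thesis
    by blast
qed

text \<open>Davis' theorem. In an eigenbasis \<open>p\<close> of the combination, its eigenvalues
  are its diagonal, and the diagonal in a fixed frame is linear in the matrix; for each summand,
  passing to the diagonal preserves upper bounds of \<open>\<theta>\<close>.\<close>

lemma spectral_fun_convex:
  fixes \<theta> :: "(real, 'n::{finite,linorder}) vec \<Rightarrow> ereal"
  assumes \<theta>: "symmetric_fun \<theta>" "ereal_convex \<theta>"
  shows "ereal_convex (spectral_fun \<theta>)"
  unfolding ereal_convex_def
proof (rule convexI, clarsimp)
  fix A B :: "'n sqmat" and a b u v :: real
  assume le: "spectral_fun \<theta> A \<le> ereal a" "spectral_fun \<theta> B \<le> ereal b"
    and uv: "0 \<le> u" "0 \<le> v" "u + v = 1"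
  have A: "symmetric_mat A" and B: "symmetric_mat B"
    using le by (auto simp: spectral_fun_def split: if_splits)
  define Y where "Y = u *\<^sub>R A + v *\<^sub>R B"
  have Y: "symmetric_mat Y"
    unfolding Y_def by (intro symmetric_mat_intros A B)
  obtain p where p: "orthonormal_frame p" and Yp: "Y = spec_mat p (eigvals Y)"
    using symmetric_mat_eigvals[OF Y] .
  let ?d = "\<lambda>A. \<chi> i. p i \<bullet> (A *v p i)"
  have "eigvals Y $ i = p i \<bullet> (Y *v p i)" for i
    using spec_mat_eigen[OF p, of "eigvals Y" i] Yp by (simp add: orthonormal_frame_inner[OF p])
  then have "eigvals Y = u *\<^sub>R ?d A + v *\<^sub>R ?d B"
    by (simp add: vec_eq_iff Y_def matrix_vector_mult_add_rdistrib scaleR_matrix_vector_assoc[symmetric]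
        inner_add_right)
  moreover have "u *\<^sub>R (?d A, a) + v *\<^sub>R (?d B, b) \<in> {(x, a). \<theta> x \<le> ereal a}"
    using \<theta>(2) uv le unfolding ereal_convex_def
    by (intro convexD) (simp_all add: symmetric_fun_frame_diagonal_le[OF \<theta> _ p] A B spectral_fun_eq)
  ultimately show "spectral_fun \<theta> (u *\<^sub>R A + v *\<^sub>R B) \<le> ereal (u * a + v * b)"
    using spectral_fun_eq[OF Y, of \<theta>] by (simp add: Y_def)
qed

text \<open>A second order tangent curve of matrices is projected to its eigenvalues, which form
  such a curve for the domain of \<open>\<theta>\<close>. The Lipschitz argument is thus applied to
  \<open>\<theta>\<close> itself rather than to the composite.\<close>

lemma second_tangent_spectral_fun:
  fixes X H :: "'n::{finite,linorder} sqmat"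
  assumes \<theta>: "symmetric_fun \<theta>" and lip: "loc_lipschitz_rel_dom \<theta>"
    and X: "symmetric_mat X" and H: "symmetric_mat H" and fin: "\<bar>spectral_fun \<theta> X\<bar> \<noteq> \<infinity>"
    and epi: "par_epi_diff_for \<theta> (eigvals X) (eig_dir1 X H)"
  shows "{W. par_subderiv (spectral_fun \<theta>) X H W < \<infinity>} = second_tangent (edom (spectral_fun \<theta>)) X H"
proof (intro equalityI subsetI)
  have sub: "\<bar>subderiv (spectral_fun \<theta>) X H\<bar> \<noteq> \<infinity>"
    using epi by (simp add: subderiv_spectral_fun[OF \<theta> X H fin] par_epi_diff_for_def)
  fix W
  {
    assume "W \<in> {W. par_subderiv (spectral_fun \<theta>) X H W < \<infinity>}"
    then show "W \<in> second_tangent (edom (spectral_fun \<theta>)) X H"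
      using second_tangent_if_par_subderiv_less_infinity[OF fin sub] by blast
  }
  assume "W \<in> second_tangent (edom (spectral_fun \<theta>)) X H"
  then obtain t Ws where t: "\<And>k. 0 < t k" "t \<longlonglongrightarrow> 0" and Ws: "Ws \<longlonglongrightarrow> W"
    and dom: "\<And>k. X + t k *\<^sub>R H + ((t k)\<^sup>2 / 2) *\<^sub>R Ws k \<in> edom (spectral_fun \<theta>)"
    unfolding second_tangent_def by blast
  have symW: "symmetric_mat (Ws k)" for k
    using dom[of k] symmetric_mat_curve_iff[OF X H t(1), of k "Ws k"]
    by (auto simp: edom_def spectral_fun_def split: if_splits)
  have W: "symmetric_mat W"
    using closed_sequentially[OF closed_symmetric_mat, of Ws W] symW Ws by simp
  obtain \<pi> where \<pi>: "\<And>\<theta> t W'. symmetric_mat W' \<Longrightarrow> 0 < t \<Longrightarrow> spectral_fun \<theta> (X + t *\<^sub>R H + (t\<^sup>2 / 2) *\<^sub>R W')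
        = \<theta> (eigvals X + t *\<^sub>R eig_dir1 X H + (t\<^sup>2 / 2) *\<^sub>R \<pi> t W')"
    "filterlim (\<lambda>(t, W'). (t, \<pi> t W')) (at_right 0 \<times>\<^sub>F nhds (eig_dir2 X H W)) (at_right 0 \<times>\<^sub>F nhds W)"
    using second_order_projection[OF X H W] by blast
  have "(\<lambda>k. \<pi> (t k) (Ws k)) \<longlonglongrightarrow> eig_dir2 X H W"
    by (rule filterlim_snd_sequence[OF \<pi>(2) t Ws])
  moreover have "eigvals X + t k *\<^sub>R eig_dir1 X H + ((t k)\<^sup>2 / 2) *\<^sub>R \<pi> (t k) (Ws k) \<in> edom \<theta>" for k
    using dom[of k] \<pi>(1)[OF symW t(1), of \<theta> k k] by (simp add: edom_def)
  ultimately have "eig_dir2 X H W \<in> second_tangent (edom \<theta>) (eigvals X) (eig_dir1 X H)"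
    unfolding second_tangent_def using t by blast
  then have "par_subderiv \<theta> (eigvals X) (eig_dir1 X H) (eig_dir2 X H W) < \<infinity>"
    using fin by (intro par_subderiv_less_infinity_if_second_tangent[OF lip _ epi]) (simp_all add: spectral_fun_eq[OF X])
  then show "W \<in> {W. par_subderiv (spectral_fun \<theta>) X H W < \<infinity>}"
    by (simp add: par_subderiv_spectral_fun[OF \<theta> X H W fin sub])
qed

section \<open>Permutations fixing the base point and diagonal directions\<close>

definition perm_vec :: "('n \<Rightarrow> 'n) \<Rightarrow> real^'n \<Rightarrow> real^'n" where
  "perm_vec \<sigma> v = (\<chi> i. v $ \<sigma> i)"

lemma perm_vec_linear: "perm_vec \<sigma> (x + t *\<^sub>R w) = perm_vec \<sigma> x + t *\<^sub>R perm_vec \<sigma> w"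
  by (simp add: perm_vec_def vec_eq_iff)

lemma perm_vec_inv:
  assumes "\<sigma> permutes UNIV"
  shows "perm_vec (inv \<sigma>) (perm_vec \<sigma> v) = v" "perm_vec \<sigma> (perm_vec (inv \<sigma>) v) = v"
  by (simp_all add: perm_vec_def permutes_inverses[OF assms] vec_eq_iff)

lemma tendsto_perm_vec: "(f \<longlongrightarrow> l) F \<Longrightarrow> ((\<lambda>x. perm_vec \<sigma> (f x)) \<longlongrightarrow> perm_vec \<sigma> l) F"
  unfolding perm_vec_def by (intro vec_tendstoI) (simp add: tendsto_vec_nth)

lemma symmetric_fun_perm_vec: "symmetric_fun \<theta> \<Longrightarrow> \<sigma> permutes UNIV \<Longrightarrow> \<theta> (perm_vec \<sigma> v) = \<theta> v"
  by (simp add: symmetric_fun_def perm_vec_def)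

lemma filterlim_perm_vec:
  "filterlim (\<lambda>(t, z). (t, perm_vec \<sigma> z)) (F \<times>\<^sub>F nhds (perm_vec \<sigma> w)) (F \<times>\<^sub>F nhds w)"
  unfolding case_prod_beta
  by (intro filterlim_Pair filterlim_fst' tendsto_perm_vec filterlim_snd')

text \<open>A permutation fixing \<open>x\<close> maps rays from \<open>x\<close> to rays from
  \<open>x\<close>, so it is a symmetry of the quotients at \<open>x\<close>. Applying the
  inequality to the inverse permutation later gives equality.\<close>

lemma subderiv_perm_vec_le:
  assumes \<theta>: "symmetric_fun \<theta>" and \<sigma>: "\<sigma> permutes UNIV" and x: "perm_vec \<sigma> x = x"
  shows "subderiv \<theta> x (perm_vec \<sigma> w) \<le> subderiv \<theta> x w"
proof -
  have "\<theta> (x + t *\<^sub>R perm_vec \<sigma> z) = \<theta> (x + t *\<^sub>R z)" for t z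
    using symmetric_fun_perm_vec[OF \<theta> \<sigma>, of "x + t *\<^sub>R z"] by (simp add: perm_vec_linear x)
  then show ?thesis
    unfolding subderiv_def
    using Liminf_le_compose[OF filterlim_perm_vec, of "at_right 0" \<sigma> w
        "\<lambda>(t, w). (\<theta> (x + t *\<^sub>R w) - \<theta> x) / ereal t"]
    by (simp add: case_prod_unfold)
qed

lemma subderiv_perm_vec:
  assumes \<theta>: "symmetric_fun \<theta>" and \<sigma>: "\<sigma> permutes UNIV" and x: "perm_vec \<sigma> x = x"
  shows "subderiv \<theta> x (perm_vec \<sigma> w) = subderiv \<theta> x w"
proof (rule antisym[OF subderiv_perm_vec_le[OF assms]])
  have "perm_vec (inv \<sigma>) x = x"
    using perm_vec_inv(1)[OF \<sigma>, of x] by (simp add: x)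
  from subderiv_perm_vec_le[OF \<theta> permutes_inv[OF \<sigma>] this, of "perm_vec \<sigma> w"]
  show "subderiv \<theta> x w \<le> subderiv \<theta> x (perm_vec \<sigma> w)"
    by (simp add: perm_vec_inv[OF \<sigma>])
qed

lemma par_quot_perm_vec:
  assumes \<theta>: "symmetric_fun \<theta>" and \<sigma>: "\<sigma> permutes UNIV" and x: "perm_vec \<sigma> x = x"
  shows "par_quot \<theta> x (perm_vec \<sigma> w) t (perm_vec \<sigma> z) = par_quot \<theta> x w t z"
  using symmetric_fun_perm_vec[OF \<theta> \<sigma>, of "x + t *\<^sub>R w + (t\<^sup>2 / 2) *\<^sub>R z"]
  by (simp add: par_quot_eq subderiv_perm_vec[OF assms] perm_vec_linear x)

lemma par_subderiv_perm_vec_le: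
  assumes \<theta>: "symmetric_fun \<theta>" and \<sigma>: "\<sigma> permutes UNIV" and x: "perm_vec \<sigma> x = x"
  shows "par_subderiv \<theta> x (perm_vec \<sigma> w) (perm_vec \<sigma> z) \<le> par_subderiv \<theta> x w z"
  unfolding par_subderiv_def
  using Liminf_le_compose[OF filterlim_perm_vec, of "at_right 0" \<sigma> z
      "\<lambda>(t, z). par_quot \<theta> x (perm_vec \<sigma> w) t z"]
  by (simp add: case_prod_unfold par_quot_perm_vec[OF assms])

lemma par_subderiv_perm_vec:
  assumes \<theta>: "symmetric_fun \<theta>" and \<sigma>: "\<sigma> permutes UNIV" and x: "perm_vec \<sigma> x = x"
  shows "par_subderiv \<theta> x (perm_vec \<sigma> w) (perm_vec \<sigma> z) = par_subderiv \<theta> x w z"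
proof (rule antisym[OF par_subderiv_perm_vec_le[OF assms]])
  have "perm_vec (inv \<sigma>) x = x"
    using perm_vec_inv(1)[OF \<sigma>, of x] by (simp add: x)
  from par_subderiv_perm_vec_le[OF \<theta> permutes_inv[OF \<sigma>] this, of "perm_vec \<sigma> w" "perm_vec \<sigma> z"]
  show "par_subderiv \<theta> x w z \<le> par_subderiv \<theta> x (perm_vec \<sigma> w) (perm_vec \<sigma> z)"
    by (simp add: perm_vec_inv[OF \<sigma>])
qed

text \<open>The components are polynomials in \<open>t\<close>, so each comparison between two of
  them has a constant truth value near 0; a permutation that sorts at one sufficiently small time
  therefore sorts at all smaller ones.\<close>

lemma eventually_sorting_permutation:
  fixes x w z :: "(real, 'n::{finite,linorder}) vec"
  obtains \<sigma> where "\<sigma> permutes UNIV"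
    "\<forall>\<^sub>F t in at_right 0. \<forall>i j. i \<le> j \<longrightarrow>
      (x + t *\<^sub>R w + (t\<^sup>2 / 2) *\<^sub>R z) $ \<sigma> j \<le> (x + t *\<^sub>R w + (t\<^sup>2 / 2) *\<^sub>R z) $ \<sigma> i"
proof -
  define k where "k i t = (x + t *\<^sub>R w + (t\<^sup>2 / 2) *\<^sub>R z) $ i" for i t
  define R where "R i j \<longleftrightarrow> (\<forall>\<^sub>F t in at_right 0. k i t \<le> k j t)" for i j
  have k_poly: "real_polynomial_function (k i)" for i
    unfolding k_def vector_add_component vector_scaleR_component real_scaleR_def
    by (intro real_polynomial_function_intros)
  have ev: "\<forall>\<^sub>F t in at_right 0. R i j \<longleftrightarrow> k i t \<le> k j t" for i j
  proof (cases "\<forall>t. k i t - k j t = 0")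
    case True
    then show ?thesis by (simp add: R_def)
  next
    case False
    have poly: "real_polynomial_function (\<lambda>t. k i t - k j t)"
      by (intro real_polynomial_function_diff k_poly)
    then have "\<forall>\<^sub>F t in at_right 0. k i t - k j t \<noteq> 0"
      using False real_polynomial_function_eventually_nonzero by blast
    moreover have "continuous_on {0<..} (\<lambda>t. k i t - k j t)"
      using poly by (intro continuous_on_polymonial_function) (simp add: real_polynomial_function_eq)
    ultimately consider "\<forall>\<^sub>F t in at_right 0. k i t - k j t < 0" | "\<forall>\<^sub>F t in at_right 0. 0 < k i t - k j t"
      using eventually_less_or_greater by blast
    then show ?thesis
    proof cases
      case 1
      then have le: "\<forall>\<^sub>F t in at_right 0. k i t \<le> k j t"
        by eventually_elim simp
      then have "R i j"
        by (simp add: R_def)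
      then show ?thesis
        using le by simp
    next
      case 2
      then have gt: "\<forall>\<^sub>F t in at_right 0. \<not> k i t \<le> k j t"
        by eventually_elim simp
      have "\<not> R i j"
      proof
        assume "R i j"
        then have "\<forall>\<^sub>F t in at_right (0::real). False"
          using gt unfolding R_def by eventually_elim simp
        then show False by simp
      qed
      then show ?thesis
        using gt by simp
    qed
  qed
  have all: "\<forall>\<^sub>F t in at_right 0. \<forall>i j. R i j \<longleftrightarrow> k i t \<le> k j t"
    using ev by (simp add: eventually_all_finite)
  \<comment> \<open>At this time \<open>s\<close>, all comparisons simultaneously agree with their
    eventual truth values \<open>R\<close>.\<close>
  then obtain s where s: "\<And>i j. R i j \<longleftrightarrow> k i s \<le> k j s"
    using eventually_happens[OF all] by auto
  obtain \<sigma> where \<sigma>: "\<sigma> permutes UNIV" "\<And>i j. i \<le> j \<Longrightarrow> k (\<sigma> j) s \<le> k (\<sigma> i) s"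
    using ex_antimono_permutation[of "\<lambda>i. k i s"] by blast
  have "\<forall>\<^sub>F t in at_right 0. \<forall>i j. i \<le> j \<longrightarrow> k (\<sigma> j) t \<le> k (\<sigma> i) t"
    using all by eventually_elim (use s \<sigma>(2) in blast)
  with \<sigma>(1) show ?thesis
    using that unfolding k_def by blast
qed

text \<open>Along directions that are diagonal in an eigenbasis of \<open>X\<close>, the eigenvalues
  are the components of an explicit quadratic curve, sorted by one fixed permutation for small
  \<open>t\<close>. Both derivatives can be read off, with the same permutation for \<open>w\<close>
  and \<open>z\<close>.\<close>

lemma eig_dirs_spec_mat:
  fixes X :: "'n::{finite,linorder} sqmat" and w z :: "(real, 'n) vec"
  assumes q: "orthonormal_frame q" and X: "symmetric_mat X" and Xq: "X = spec_mat q (eigvals X)"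
  obtains \<sigma> where "\<sigma> permutes UNIV" "perm_vec \<sigma> (eigvals X) = eigvals X"
    "eig_dir1 X (spec_mat q w) = perm_vec \<sigma> w"
    "eig_dir2 X (spec_mat q w) (spec_mat q z) = perm_vec \<sigma> z"
proof -
  define x where "x = eigvals X"
  define y where "y t = x + t *\<^sub>R w + (t\<^sup>2 / 2) *\<^sub>R z" for t
  obtain \<sigma> where \<sigma>: "\<sigma> permutes UNIV"
    and sorted: "\<forall>\<^sub>F t in at_right 0. \<forall>i j. i \<le> j \<longrightarrow> y t $ \<sigma> j \<le> y t $ \<sigma> i"
    using eventually_sorting_permutation[of x w z] unfolding y_def by blast
  have curve: "X + t *\<^sub>R spec_mat q w + (t\<^sup>2 / 2) *\<^sub>R spec_mat q z = spec_mat q (y t)" for t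
    by (subst Xq) (simp add: y_def x_def spec_mat_add spec_mat_scaleR)
  have y_lim: "((\<lambda>t. y t $ i) \<longlongrightarrow> x $ i) (at_right 0)" for i
  proof -
    have "((\<lambda>t. y t $ i) \<longlongrightarrow> (x + 0 *\<^sub>R w + (0\<^sup>2 / 2) *\<^sub>R z) $ i) (at_right 0)"
      unfolding y_def by (intro tendsto_intros) auto
    then show ?thesis by simp
  qed
  \<comment> \<open>The sorting inequalities survive the limit, so \<open>\<sigma>\<close> also
    sorts \<open>x\<close>; as \<open>x\<close> is already sorted, \<open>\<sigma>\<close> fixes
    it.\<close>
  have "x $ \<sigma> j \<le> x $ \<sigma> i" if "i \<le> j" for i j
    by (rule tendsto_le[OF _ y_lim y_lim]) (simp, use sorted in \<open>rule eventually_mono\<close>, use that in blast)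
  then have "eigvals (spec_mat q x) = perm_vec \<sigma> x"
    unfolding perm_vec_def by (rule eigvals_spec_mat_permute[OF q \<sigma>])
  then have x: "perm_vec \<sigma> x = x"
    using Xq by (simp add: x_def)
  have ev: "\<forall>\<^sub>F t in at_right 0. eigvals (spec_mat q (y t)) = x + t *\<^sub>R perm_vec \<sigma> w + (t\<^sup>2 / 2) *\<^sub>R perm_vec \<sigma> z"
    using sorted
  proof eventually_elim
    case (elim t)
    then have "eigvals (spec_mat q (y t)) = perm_vec \<sigma> (y t)"
      unfolding perm_vec_def by (intro eigvals_spec_mat_permute[OF q \<sigma>]) blast
    then show ?case
      by (simp add: y_def perm_vec_linear x)
  qed
  define h where "h = eig_dir1 X (spec_mat q w)"
  define l where "l = eig_dir2 X (spec_mat q w) (spec_mat q z)"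
  define \<psi> where "\<psi> t = (1 / (t\<^sup>2 / 2)) *\<^sub>R (eigvals (spec_mat q (y t)) - x - t *\<^sub>R h)" for t
  have \<psi>: "(\<psi> \<longlongrightarrow> l) (at_right 0)"
    using eig_dir2_tendsto[OF X symmetric_mat_spec_mat symmetric_mat_spec_mat, of q w q z]
    unfolding \<psi>_def h_def l_def x_def curve by simp
  have pos: "\<forall>\<^sub>F t in at_right (0::real). 0 < t"
    by (rule eventually_at_right_less)
  \<comment> \<open>The first derivative is extracted from the second order limit: multiplied by
    \<open>t / 2\<close>, the convergent quotient tends to 0, whereas its explicit form tends to
    \<open>perm_vec \<sigma> w - h\<close>.\<close>
  have "((\<lambda>t. (t / 2) *\<^sub>R \<psi> t) \<longlongrightarrow> (0 / 2) *\<^sub>R l) (at_right 0)"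
    by (intro tendsto_intros \<psi>) auto
  moreover have "\<forall>\<^sub>F t in at_right 0. (t / 2) *\<^sub>R \<psi> t = (perm_vec \<sigma> w - h) + (t / 2) *\<^sub>R perm_vec \<sigma> z"
    using ev pos
  proof eventually_elim
    case (elim t)
    then have "(t / 2) *\<^sub>R \<psi> t = (1 / t) *\<^sub>R (t *\<^sub>R (perm_vec \<sigma> w - h) + (t\<^sup>2 / 2) *\<^sub>R perm_vec \<sigma> z)"
      by (simp add: \<psi>_def power2_eq_square algebra_simps)
    then show ?case
      using elim(2) by (simp add: scaleR_add_right power2_eq_square)
  qed
  ultimately have "((\<lambda>t. (perm_vec \<sigma> w - h) + (t / 2) *\<^sub>R perm_vec \<sigma> z) \<longlongrightarrow> (0 / 2) *\<^sub>R l) (at_right 0)"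
    by (rule Lim_transform_eventually)
  moreover have "((\<lambda>t. (perm_vec \<sigma> w - h) + (t / 2) *\<^sub>R perm_vec \<sigma> z)
      \<longlongrightarrow> (perm_vec \<sigma> w - h) + (0 / 2) *\<^sub>R perm_vec \<sigma> z) (at_right 0)"
    by (intro tendsto_intros) auto
  ultimately have "(0 / 2) *\<^sub>R l = (perm_vec \<sigma> w - h) + (0 / 2) *\<^sub>R perm_vec \<sigma> z"
    by (rule tendsto_unique[rotated]) simp
  then have h: "h = perm_vec \<sigma> w"
    by simp
  have "\<forall>\<^sub>F t in at_right 0. \<psi> t = perm_vec \<sigma> z"
    using ev pos by eventually_elim (simp add: \<psi>_def h)
  with \<psi> have "((\<lambda>_. perm_vec \<sigma> z) \<longlongrightarrow> l) (at_right (0::real))"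
    by (rule Lim_transform_eventually)
  then have "l = perm_vec \<sigma> z"
    by (simp add: tendsto_const_iff)
  then show ?thesis
    using that[OF \<sigma>] x h unfolding x_def h_def l_def by blast
qed

lemma par_quot_tendsto_if_infinity:
  fixes f :: "'a::real_normed_vector \<Rightarrow> ereal"
  assumes "par_subderiv f x w z = \<infinity>" and t: "\<And>k. 0 < t k" "t \<longlonglongrightarrow> 0" and "zs \<longlonglongrightarrow> z"
  shows "(\<lambda>k. par_quot f x w (t k) (zs k)) \<longlonglongrightarrow> \<infinity>"
proof -
  have "par_subderiv f x w z \<le> Liminf sequentially (\<lambda>k. par_quot f x w (t k) (zs k))"
    unfolding par_subderiv_def
    using Liminf_le_compose[OF filterlim_Pair_at_right[OF t assms(4)], of "\<lambda>(t, z). par_quot f x w t z"]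
    by simp
  then show ?thesis
    using assms(1) by (intro Liminf_PInfty[THEN iffD2]) auto
qed

text \<open>With \<open>H\<close> and \<open>W\<close> diagonal in an eigenbasis of
  \<open>X\<close>, a recovery sequence of matrices for \<open>W\<close> is projected to
  eigenvalues, and undoing the sorting permutation yields one for \<open>z\<close>.\<close>

lemma par_epi_diff_if_spectral_fun:
  fixes X :: "'n::{finite,linorder} sqmat"
  assumes \<theta>: "symmetric_fun \<theta>" and X: "symmetric_mat X" and fin: "\<bar>spectral_fun \<theta> X\<bar> \<noteq> \<infinity>"
    and epi: "par_epi_diff (spectral_fun \<theta>) X"
  shows "par_epi_diff \<theta> (eigvals X)"
  unfolding par_epi_diff_def
proof (intro allI impI)
  let ?x = "eigvals X" and ?f = "spectral_fun \<theta>"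
  fix w assume w: "\<bar>subderiv \<theta> ?x w\<bar> \<noteq> \<infinity>"
  obtain q where q: "orthonormal_frame q" and Xq: "X = spec_mat q ?x"
    using symmetric_mat_eigvals[OF X] .
  define H where "H = spec_mat q w"
  have H: "symmetric_mat H"
    by (simp add: H_def symmetric_mat_spec_mat)
  \<comment> \<open>The sorting permutation may depend on \<open>z\<close>. \<open>\<tau>\<close>
    belongs to \<open>z = 0\<close> and serves to analyse \<open>H\<close>; for each given
    \<open>z\<close> a permutation \<open>\<sigma>\<close> is chosen anew below.\<close>
  obtain \<tau> where \<tau>: "\<tau> permutes UNIV" "perm_vec \<tau> ?x = ?x" "eig_dir1 X H = perm_vec \<tau> w"
    using eig_dirs_spec_mat[OF q X Xq, of w 0] unfolding H_def by blast
  have subH: "\<bar>subderiv ?f X H\<bar> \<noteq> \<infinity>"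
    using w by (simp add: subderiv_spectral_fun[OF \<theta> X H fin] \<tau>(3) subderiv_perm_vec[OF \<theta> \<tau>(1,2)])
  then have epiH: "par_epi_diff_for ?f X H"
    using epi by (simp add: par_epi_diff_def)
  show "par_epi_diff_for \<theta> ?x w"
    unfolding par_epi_diff_for_def
  proof (intro conjI allI impI)
    show "\<bar>subderiv \<theta> ?x w\<bar> \<noteq> \<infinity>" by fact
    obtain W where less: "par_subderiv ?f X H W < \<infinity>"
      using epiH unfolding par_epi_diff_for_def by blast
    then have W: "symmetric_mat W"
      using par_subderiv_spectral_fun_nonsymmetric[OF X H _ fin subH] by fastforce
    have "par_subderiv \<theta> ?x (perm_vec \<tau> w) (perm_vec \<tau> (perm_vec (inv \<tau>) (eig_dir2 X H W))) < \<infinity>"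
      using less by (simp add: par_subderiv_spectral_fun[OF \<theta> X H W fin subH] \<tau>(3) perm_vec_inv[OF \<tau>(1)])
    then show "{z. par_subderiv \<theta> ?x w z < \<infinity>} \<noteq> {}"
      unfolding par_subderiv_perm_vec[OF \<theta> \<tau>(1,2)] by blast
  next
    fix z t assume t: "(\<forall>k. 0 < t k) \<and> t \<longlonglongrightarrow> (0::real)"
    show "\<exists>zs. zs \<longlonglongrightarrow> z \<and> (\<lambda>k. par_quot \<theta> ?x w (t k) (zs k)) \<longlonglongrightarrow> par_subderiv \<theta> ?x w z"
    \<comment> \<open>If the value is infinite, every sequence tending to \<open>z\<close> recovers
      it. Otherwise the quotients of the recovery matrices are eventually below
      \<open>\<infinity>\<close>, which forces these matrices to be symmetric and makes the
      projection applicable.\<close>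
    proof (cases "par_subderiv \<theta> ?x w z = \<infinity>")
      case True
      then show ?thesis
        using par_quot_tendsto_if_infinity[OF True, of t "\<lambda>_. z"] t by (intro exI[of _ "\<lambda>_. z"]) simp
    next
      case False
      define W where "W = spec_mat q z"
      have W: "symmetric_mat W"
        by (simp add: W_def symmetric_mat_spec_mat)
      obtain \<sigma> where \<sigma>: "\<sigma> permutes UNIV" "perm_vec \<sigma> ?x = ?x" "eig_dir1 X H = perm_vec \<sigma> w"
          "eig_dir2 X H W = perm_vec \<sigma> z"
        using eig_dirs_spec_mat[OF q X Xq, of w z] unfolding H_def W_def by blast
      have eq: "par_subderiv ?f X H W = par_subderiv \<theta> ?x w z"
        by (simp add: par_subderiv_spectral_fun[OF \<theta> X H W fin subH] \<sigma>(3,4) par_subderiv_perm_vec[OF \<theta> \<sigma>(1,2)])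
      obtain Ws where Ws: "Ws \<longlonglongrightarrow> W" "(\<lambda>k. par_quot ?f X H (t k) (Ws k)) \<longlonglongrightarrow> par_subderiv \<theta> ?x w z"
        using epiH t unfolding par_epi_diff_for_def eq[symmetric] by blast
      obtain \<pi> where \<pi>: "\<And>\<theta> t W'. symmetric_mat W' \<Longrightarrow> 0 < t \<Longrightarrow> spectral_fun \<theta> (X + t *\<^sub>R H + (t\<^sup>2 / 2) *\<^sub>R W')
            = \<theta> (?x + t *\<^sub>R eig_dir1 X H + (t\<^sup>2 / 2) *\<^sub>R \<pi> t W')"
        "filterlim (\<lambda>(t, W'). (t, \<pi> t W')) (at_right 0 \<times>\<^sub>F nhds (eig_dir2 X H W)) (at_right 0 \<times>\<^sub>F nhds W)"
        using second_order_projection[OF X H W] by blast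
      define zs where "zs k = perm_vec (inv \<sigma>) (\<pi> (t k) (Ws k))" for k
      have "(\<lambda>k. \<pi> (t k) (Ws k)) \<longlonglongrightarrow> eig_dir2 X H W"
        using filterlim_snd_sequence[OF \<pi>(2) _ _ Ws(1)] t by blast
      then have "zs \<longlonglongrightarrow> z"
        using tendsto_perm_vec[of _ "eig_dir2 X H W" _ "inv \<sigma>"]
        unfolding zs_def by (simp add: \<sigma>(4) perm_vec_inv[OF \<sigma>(1)])
      moreover have "(\<lambda>k. par_quot \<theta> ?x w (t k) (zs k)) \<longlonglongrightarrow> par_subderiv \<theta> ?x w z"
      proof (rule Lim_transform_eventually[OF Ws(2)])
        have "\<forall>\<^sub>F k in sequentially. par_quot ?f X H (t k) (Ws k) < \<infinity>"
          by (rule order_tendstoD(2)[OF Ws(2)]) (use False in simp)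
        then show "\<forall>\<^sub>F k in sequentially. par_quot ?f X H (t k) (Ws k) = par_quot \<theta> ?x w (t k) (zs k)"
        proof eventually_elim
          case (elim k)
          have tk: "0 < t k" using t by blast
          have "symmetric_mat (Ws k)"
            using elim par_quot_spectral_fun_nonsymmetric[OF X H _ tk fin subH] by fastforce
          then have "par_quot ?f X H (t k) (Ws k) = par_quot \<theta> ?x (perm_vec \<sigma> w) (t k) (\<pi> (t k) (Ws k))"
            by (simp add: par_quot_eq \<pi>(1)[OF _ tk] \<sigma>(3) spectral_fun_eq[OF X] subderiv_spectral_fun[OF \<theta> X H fin])
          also have "\<dots> = par_quot \<theta> ?x (perm_vec \<sigma> w) (t k) (perm_vec \<sigma> (zs k))"
            by (simp add: zs_def perm_vec_inv[OF \<sigma>(1)])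
          finally show ?case
            by (simp add: par_quot_perm_vec[OF \<theta> \<sigma>(1,2)])
        qed
      qed
      ultimately show ?thesis by blast
    qed
  qed
qed

text \<open>Points of the domain are symmetric, hence so are the approximating directions, and
  symmetry passes to the limit.\<close>

lemma tangent_cone_spectral_fun_symmetric:
  assumes X: "symmetric_mat X" and H: "H \<in> tangent_cone (edom (spectral_fun \<theta>)) X"
  shows "symmetric_mat H"
proof -
  obtain t Hs where t: "\<And>k. 0 < t k" and Hs: "Hs \<longlonglongrightarrow> H"
    and dom: "\<And>k. X + t k *\<^sub>R Hs k \<in> edom (spectral_fun \<theta>)"
    using H unfolding tangent_cone_def by blast
  have "symmetric_mat (X + t k *\<^sub>R Hs k)" for k
    using dom[of k] by (auto simp: edom_def spectral_fun_def split: if_splits)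
  then have "symmetric_mat (Hs k)" for k
    using symmetric_mat_add_cancel[OF X] symmetric_mat_scaleR_cancel t by (metis less_irrefl)
  then show ?thesis
    using closed_sequentially[OF closed_symmetric_mat, of Hs H] Hs by simp
qed

theorem theorem4p7:
  fixes \<theta> :: "real^('n::{finite,linorder}) \<Rightarrow> ereal"
    and X :: "real^('n::{finite,linorder})^('n::{finite,linorder})"
  assumes sym: "symmetric_fun \<theta>"
    and lip: "loc_lipschitz_rel_dom \<theta>"
    and XS: "symmetric_mat X"
    and fin: "\<bar>spectral_fun \<theta> X\<bar> \<noteq> \<infinity>"
  shows
    "(\<forall>H. H \<in> tangent_cone (edom (spectral_fun \<theta>)) X \<and>
          par_epi_diff_for \<theta> (eigvals X) (eig_dir1 X H) \<longrightarrow>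
        par_epi_diff_for (spectral_fun \<theta>) X H \<and>
        (\<forall>W. symmetric_mat W \<longrightarrow>
           par_subderiv (spectral_fun \<theta>) X H W =
           par_subderiv \<theta> (eigvals X) (eig_dir1 X H) (eig_dir2 X H W)) \<and>
        {W. par_subderiv (spectral_fun \<theta>) X H W < \<infinity>} =
          second_tangent (edom (spectral_fun \<theta>)) X H \<and>
        (ereal_lsc \<theta> \<and> ereal_convex \<theta> \<longrightarrow>
           ereal_convex (\<lambda>W. par_subderiv (spectral_fun \<theta>) X H W)))
     \<and> (par_epi_diff (spectral_fun \<theta>) X \<longrightarrow> par_epi_diff \<theta> (eigvals X))"
proof (intro conjI allI impI; (elim conjE)?)
  fix H
  assume "H \<in> tangent_cone (edom (spectral_fun \<theta>)) X"
    and epi: "par_epi_diff_for \<theta> (eigvals X) (eig_dir1 X H)"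
  then have H: "symmetric_mat H"
    using tangent_cone_spectral_fun_symmetric[OF XS] by blast
  show epif: "par_epi_diff_for (spectral_fun \<theta>) X H"
    by (rule par_epi_diff_for_spectral_fun[OF sym XS H fin epi])
  show "{W. par_subderiv (spectral_fun \<theta>) X H W < \<infinity>} = second_tangent (edom (spectral_fun \<theta>)) X H"
    by (rule second_tangent_spectral_fun[OF sym lip XS H fin epi])
  show "par_subderiv (spectral_fun \<theta>) X H W = par_subderiv \<theta> (eigvals X) (eig_dir1 X H) (eig_dir2 X H W)"
    if "symmetric_mat W" for W
    using epif by (intro par_subderiv_spectral_fun[OF sym XS H that fin]) (simp add: par_epi_diff_for_def)
  show "ereal_convex (\<lambda>W. par_subderiv (spectral_fun \<theta>) X H W)" if "ereal_convex \<theta>"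
    by (rule par_subderiv_convex[OF spectral_fun_convex[OF sym that] fin epif])
next
  assume "par_epi_diff (spectral_fun \<theta>) X"
  then show "par_epi_diff \<theta> (eigvals X)"
    by (rule par_epi_diff_if_spectral_fun[OF sym XS fin])
qed

end
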